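(* Let $(a,b,c,t)$ be face and trail weights on a cylindric 2-loop plabic graph as in the context and $T_f(a,b,c)=(a',b',c')$. Then: (1) the face and trail weighted network $(a',b',c',t)$ has the same boundary measurements as $(a,b,c,t)$; (2) $T_f$ is an involution; (3) $(a,b,c,t)$ and $(a',b',c',t)$ are the only choices of face and trail weights on this fixed cylindric 2-loop plabic graph that give these boundary measurements; (4) $T_f$ satisfies the braid relation: for a cylindric 3-loop plabic network with strings $1,2,3$ from left to right and no interior vertices, writing $T_f^{(i,i+1)}$ for $T_f$ applied to strings $i,i+1$, one has $T_f^{(1,2)}\circ T_f^{(2,3)}\circ T_f^{(1,2)}=T_f^{(2,3)}\circ T_f^{(1,2)}\circ T_f^{(2,3)}$.
   Context: Cylindric 2-loop plabic graph: a plabic graph on a cylinder (drawn as a rectangle with boundary components on left and right, top and bottom identified) coming from a Postnikov diagram (alternating strand diagram; black vertices in counterclockwise faces, white in clockwise faces, joined when the faces share a corner) with exactly two strands that are loops around the cylinder with the same orientation; these give a left and a right string of alternating black/white vertices around the cylinder, and we assume there are no other vertices. Black left-string vertices have extra edges to the left boundary, white left-string vertices to the right string, black right-string vertices to the left string, white right-string vertices to the right boundary. Canonical orientation: string edges upward, other edges left to right. Boundary measurements of a network on a cylinder are as usual: with a cut $\gamma$ (top/bottom of the rectangle), $M_{ij}=\sum_{P:b_i\to b_j}(-1)^{wind(C_P)-1}\zeta^{int(P)}x_P$ summed to a rational function of $\zeta$, where $int(P)$ is the signed number of crossings of the cut and $C_P$ the closed curve formed by $P$ and boundary/cut segments. Face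 weights: $y_f$ is the product of weights of edges on the boundary of $f$ oriented clockwise (outer boundary) times the inverses of the weights of edges oriented counterclockwise; a trail is a sequence of adjacent vertices from one boundary component to the other, its weight being the product of the weights of edges traversed forward times the inverses of those traversed backward. Face weights (product 1) together with one trail weight determine the edge weights up to gauge (rescaling at a vertex), and hence the boundary measurements. Labels. The trail is a path with 5 edges: from the left boundary to a black vertex of the left string, up one edge of the left string, across to the right string, up one edge of the right string, and to the right boundary; its weight is $t$. Faces between the left boundary and left string are $a_1,\dots,a_\ell$ (starting above the trail, going up); faces between the right string and right boundary are $b_1,\dots,b_m$; faces between the strings are $c_1,\dots,c_{n-1},c_n$ with $c_n=\frac{1}{a_1\cdots a_\ell b_1\cdots b_m c_1\cdots c_{n-1}}$; indices modular. $a_j$ is associated to $i$ if the highest left-string edge bordering face $a_j$ also borders $c_i$; $b_j$ is associated to $i$ if the lowest right-string edge bordering $b_j$ also borders $c_i$. Edge weights from face weights: expand the graph (split vertices having several edges to the other string, inserting vertices of opposite color; new edges weight 1). Give the white-to-black left-string edge highest on face $a_j$ weight $a_j^{-1}$; give the white-to-black right-string edge lowest on face $b_j$ weight $b_j$; all other string edges weight 1; the crossing edge on the trail weight $t$; and the crossing edge between $c_i$ and $c_{i+1}$ weight $t\big(\prod_{a_j\text{ assoc. to }k\le i}a_j\big)\big(\prod_{b_j\text{ assoc. to }k\le i}b_j\big)\big(\prod_{j\le i}c_j\big)$. Label the resulting edge weights $x_1,\dots,x_n$ (white-to-black edges going up the left string), $y_1,\dots,y_n$ (going up the right string), $z_i$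 the crossing edge from the lower endpoint of $x_{i+1}$ to the upper endpoint of $y_i$, indexed so that $y_1=b_1$, and set $\widehat\lambda_i(a,b,c)=\lambda_i(x,y,z)=\sum_{j=i}^{i+n-1}\big(\prod_{k=i+1}^{j}x_k\big)z_j\big(\prod_{k=j+1}^{i+n-1}y_k\big)$ (indices mod $n$), the sum of path weights on the universal cover from the lower endpoint of $x_{i+1}$ to the upper endpoint of $y_{i-1}$ one period higher. The face weighted plabic R-matrix $T_f:(a,b,c)\mapsto(a',b',c')$ (with $\widehat\lambda_i=\widehat\lambda_i(a,b,c)$): $a_i'=\dfrac{\widehat\lambda_j}{\widehat\lambda_p\prod_{b_r\text{ assoc. to }s,\ p\le s<j}b_r}$ where $a_i$ is associated to $j$ and $a_{i-1}$ to $p$; $b_i'=\dfrac{\widehat\lambda_q}{\widehat\lambda_j\prod_{a_r\text{ assoc. to }s,\ j<s\le q}a_r}$ where $b_i$ is associated to $j$ and $b_{i+1}$ to $q$; $c_i'=\dfrac{c_i\widehat\lambda_{i-1}\left(\prod_{a_r\text{ assoc. to }s,\ i\le s\le i+1}a_r\right)\left(\prod_{b_r\text{ assoc. to }s,\ i-1\le s\le i}b_r\right)}{\widehat\lambda_{i+1}}$; the trail weight $t$ is unchanged.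
   Formalization: The trail's crossing edge is also required to be the lowest at its left-string white vertex and the highest at its right-string black vertex (5 edges in the expanded graph too, y_1 = b_1); for other 5-edge trails t is not preserved and (1) fails. Such a trail always exists. *)

theory Defs
  imports "HOL-Analysis.Analysis" "HOL-Computational_Algebra.Computational_Algebra"
begin

text \<open>
  The cylinder is the strip \<open>0 \<le> Re z \<le> L + 1\<close> modulo \<open>z \<mapsto> z + \<i>\<close>, the cut being the image of
  \<open>Im z = 0\<close>.  Everything is described on the universal cover: integers index the lifts of
  vertices, edges and faces, and all weights are invariant under the deck transformation.
  For \<open>L = 2\<close> the left string is string 1 and the right string is string 2.
\<close>

datatype vertex =
    Bdl int        \<comment> \<open>vertex on the left boundary\<close>
  | Blk nat int    \<comment> \<open>black vertex of a string\<close>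
  | Wht nat int    \<comment> \<open>white vertex of a string\<close>
  | Bdr int        \<comment> \<open>vertex on the right boundary\<close>

datatype edge =
    Ein int        \<comment> \<open>left boundary to black vertex of string 1\<close>
  | Up nat int     \<comment> \<open>black to white, going up a string\<close>
  | Nxt nat int    \<comment> \<open>white to black, going up a string\<close>
  | Crs nat int    \<comment> \<open>white vertex of string \<open>s\<close> to black vertex of string \<open>s + 1\<close>\<close>
  | Eout int       \<comment> \<open>white vertex of the last string to right boundary\<close>

text \<open>
  String \<open>s\<close> has \<open>strlen s\<close> black and \<open>strlen s\<close> white vertices, and \<open>ncr s\<close> edges cross from
  string \<open>s\<close> to string \<open>s + 1\<close>; the \<open>i\<close>-th of them, counted upwards, joins the white vertex
  \<open>lft s i\<close> of string \<open>s\<close> to the black vertex \<open>rgt s i\<close> of string \<open>s + 1\<close>.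
\<close>

record cyl_graph =
  loops :: nat
  strlen :: "nat \<Rightarrow> nat"
  ncr :: "nat \<Rightarrow> nat"
  lft :: "nat \<Rightarrow> int \<Rightarrow> int"
  rgt :: "nat \<Rightarrow> int \<Rightarrow> int"
  height :: "vertex \<Rightarrow> real"

fun verts :: "cyl_graph \<Rightarrow> vertex \<Rightarrow> bool" where
  "verts G (Bdl j) = True"
| "verts G (Blk s j) = (s \<in> {1..loops G})"
| "verts G (Wht s j) = (s \<in> {1..loops G})"
| "verts G (Bdr j) = True"

fun edges :: "cyl_graph \<Rightarrow> edge \<Rightarrow> bool" where
  "edges G (Ein j) = True"
| "edges G (Up s j) = (s \<in> {1..loops G})"
| "edges G (Nxt s j) = (s \<in> {1..loops G})"
| "edges G (Crs s i) = (s \<in> {1..<loops G})"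
| "edges G (Eout j) = True"

text \<open>Canonical orientation: string edges go up, all other edges go from left to right.\<close>

fun src :: "cyl_graph \<Rightarrow> edge \<Rightarrow> vertex" where
  "src G (Ein j) = Bdl j"
| "src G (Up s j) = Blk s j"
| "src G (Nxt s j) = Wht s j"
| "src G (Crs s i) = Wht s (lft G s i)"
| "src G (Eout j) = Wht (loops G) j"

fun tgt :: "cyl_graph \<Rightarrow> edge \<Rightarrow> vertex" where
  "tgt G (Ein j) = Blk 1 j"
| "tgt G (Up s j) = Wht s j"
| "tgt G (Nxt s j) = Blk s (j + 1)"
| "tgt G (Crs s i) = Blk (s + 1) (rgt G s i)"
| "tgt G (Eout j) = Bdr j"

fun vshift :: "cyl_graph \<Rightarrow> vertex \<Rightarrow> vertex" where
  "vshift G (Bdl j) = Bdl (j + int (strlen G 1))"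
| "vshift G (Blk s j) = Blk s (j + int (strlen G s))"
| "vshift G (Wht s j) = Wht s (j + int (strlen G s))"
| "vshift G (Bdr j) = Bdr (j + int (strlen G (loops G)))"

fun eshift :: "cyl_graph \<Rightarrow> edge \<Rightarrow> edge" where
  "eshift G (Ein j) = Ein (j + int (strlen G 1))"
| "eshift G (Up s j) = Up s (j + int (strlen G s))"
| "eshift G (Nxt s j) = Nxt s (j + int (strlen G s))"
| "eshift G (Crs s i) = Crs s (i + int (ncr G s))"
| "eshift G (Eout j) = Eout (j + int (strlen G (loops G)))"

text \<open>
  The steps 0 or 1 of \<open>lft\<close> and \<open>rgt\<close> say that the crossing edges do not intersect and that every
  white vertex of string \<open>s\<close> and every black vertex of string \<open>s + 1\<close> is on at least one of them.
  Two consecutive crossing edges never have the same lifted endpoints: they would bound a digon,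
  i.e. two strands of the Postnikov diagram would form a bad double crossing.

  The labels of the faces and edges between strings \<open>s\<close> and \<open>s + 1\<close> start at the crossing edge
  \<open>Crs s 0\<close>, which lies on the trail.  The trail has 5 edges also in the expanded graph on which
  the edge weights live, so \<open>Crs s 0\<close> is the lowest crossing edge at its white vertex and the
  highest one at its black vertex (the latter says \<open>y\<^sub>1 = b\<^sub>1\<close>).  Such an edge always exists.
\<close>

definition layer_ok :: "cyl_graph \<Rightarrow> nat \<Rightarrow> bool" where
  "layer_ok G s \<longleftrightarrow> ncr G s > 0 \<and>
     (\<forall>i. lft G s (i + int (ncr G s)) = lft G s i + int (strlen G s) \<and>
          rgt G s (i + int (ncr G s)) = rgt G s i + int (strlen G (s + 1)) \<and>
          lft G s (i + 1) \<in> {lft G s i, lft G s i + 1} \<and>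
          rgt G s (i + 1) \<in> {rgt G s i, rgt G s i + 1} \<and>
          (lft G s (i + 1), rgt G s (i + 1)) \<noteq> (lft G s i, rgt G s i)) \<and>
     lft G s (-1) \<noteq> lft G s 0 \<and> rgt G s 1 \<noteq> rgt G s 0"

text \<open>
  The graph is drawn on the strip with straight edges, string \<open>s\<close> on the line \<open>Re z = s\<close>, no vertex
  on the cut.  The freedom in the heights is the freedom in the position of the cut.
\<close>

definition drawing_ok :: "cyl_graph \<Rightarrow> bool" where
  "drawing_ok G \<longleftrightarrow>
     (\<forall>v. verts G v \<longrightarrow> height G v \<notin> \<int> \<and> height G (vshift G v) = height G v + 1) \<and>
     (\<forall>j. height G (Bdl j) < height G (Bdl (j + 1)) \<and> height G (Bdr j) < height G (Bdr (j + 1))) \<and>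
     (\<forall>s\<in>{1..loops G}. \<forall>j. height G (Blk s j) < height G (Wht s j) \<and>
                            height G (Wht s j) < height G (Blk s (j + 1)))"

definition cylindric_plabic :: "cyl_graph \<Rightarrow> bool" where
  "cylindric_plabic G \<longleftrightarrow> (\<forall>s\<in>{1..loops G}. strlen G s > 0) \<and>
     (\<forall>s\<in>{1..<loops G}. layer_ok G s) \<and> drawing_ok G"

definition edge_weighting :: "cyl_graph \<Rightarrow> (edge \<Rightarrow> real) \<Rightarrow> bool" where
  "edge_weighting G E \<longleftrightarrow> (\<forall>e. edges G e \<longrightarrow> E e > 0 \<and> E (eshift G e) = E e)"


text \<open>In walks, an edge paired with \<open>False\<close> is traversed backward.\<close>

fun walk :: "cyl_graph \<Rightarrow> vertex \<Rightarrow> (edge \<times> bool) list \<Rightarrow> vertex \<Rightarrow> bool" where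
  "walk G u [] v \<longleftrightarrow> u = v"
| "walk G u ((e, d) # ws) v \<longleftrightarrow> edges G e \<and> u = (if d then src G e else tgt G e) \<and>
     walk G (if d then tgt G e else src G e) ws v"

definition walk_weight :: "(edge \<Rightarrow> real) \<Rightarrow> (edge \<times> bool) list \<Rightarrow> real" where
  "walk_weight E ws = (\<Prod>(e, d)\<leftarrow>ws. if d then E e else inverse (E e))"

definition trail :: "cyl_graph \<Rightarrow> (edge \<times> bool) list \<Rightarrow> bool" where
  "trail G ws \<longleftrightarrow> (\<exists>i j. walk G (Bdl i) ws (Bdr j))"


section \<open>Boundary measurements\<close>

text \<open>
  A path on the cylinder from \<open>b\<^sub>i\<close> to \<open>b\<^sub>j\<close> is represented by its lift starting at \<open>Bdl i\<close>.
\<close>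

definition bpaths :: "cyl_graph \<Rightarrow> int \<Rightarrow> int \<Rightarrow> edge list set" where
  "bpaths G i j = {P. \<exists>k. walk G (Bdl i) (map (\<lambda>e. (e, True)) P)
                                (Bdr (j + k * int (strlen G (loops G))))}"

definition cut_int :: "cyl_graph \<Rightarrow> edge list \<Rightarrow> int" where
  "cut_int G P = (\<Sum>e\<leftarrow>P. \<lfloor>height G (tgt G e)\<rfloor> - \<lfloor>height G (src G e)\<rfloor>)"

fun pos :: "cyl_graph \<Rightarrow> vertex \<Rightarrow> complex" where
  "pos G (Bdl j) = Complex 0 (height G (Bdl j))"
| "pos G (Blk s j) = Complex (real s) (height G (Blk s j))"
| "pos G (Wht s j) = Complex (real s) (height G (Wht s j))"
| "pos G (Bdr j) = Complex (real (loops G) + 1) (height G (Bdr j))"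

text \<open>
  The corners of a lift of \<open>C\<^sub>P\<close>: after \<open>P\<close>, go down the right boundary to the cut, along the cut
  to the left boundary, and up the left boundary to the starting point of \<open>P\<close> on the cylinder.
\<close>

definition closed_curve :: "cyl_graph \<Rightarrow> edge list \<Rightarrow> complex list" where
  "closed_curve G P =
     (let zs = map (pos G) (src G (hd P) # map (tgt G) P);
          p = hd zs; q = last zs; h = of_int \<lfloor>Im q\<rfloor>
      in zs @ [Complex (Re q) h, Complex (Re p) h, Complex (Re p) (h + frac (Im p))])"

text \<open>
  Winding index: the rotation number, in turns, of the tangent of the closed curve after gluing the
  cylinder to a planar annulus by \<open>z \<mapsto> exp (2 \<pi> z)\<close>.  This map is conformal and multiplies tangent
  vectors at \<open>z\<close> by \<open>2 \<pi> exp (2 \<pi> z)\<close>, so the rotation number is the sum of the exterior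
  angles of the polygon divided by \<open>2 \<pi>\<close>, plus the number of turns of the curve around the
  cylinder.  The sum is an integer; \<open>floor\<close> only converts its type.
\<close>

definition wind :: "complex list \<Rightarrow> int" where
  "wind zs = (let ds = map2 (\<lambda>u v. v - u) zs (tl zs)
              in \<lfloor>(\<Sum>(d, d')\<leftarrow>zip ds (rotate1 ds). Arg (d' / d)) / (2 * pi)
                   + Im (last zs - hd zs)\<rfloor>)"

definition path_series :: "cyl_graph \<Rightarrow> (edge \<Rightarrow> real) \<Rightarrow> int \<Rightarrow> int \<Rightarrow> real fls" where
  "path_series G E i j = Abs_fls (\<lambda>k. \<Sum>P | P \<in> bpaths G i j \<and> cut_int G P = k.
       (-1) powi (wind (closed_curve G P) - 1) * (\<Prod>e\<leftarrow>P. E e))"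

definition rational_value :: "real fls \<Rightarrow> real poly fract" where
  "rational_value F = (THE R. \<exists>p q. q \<noteq> 0 \<and> R = Fraction_Field.Fract p q \<and>
       fps_to_fls (fps_of_poly q) * F = fps_to_fls (fps_of_poly p))"

definition boundary_measurement ::
    "cyl_graph \<Rightarrow> (edge \<Rightarrow> real) \<Rightarrow> int \<Rightarrow> int \<Rightarrow> real poly fract" where
  "boundary_measurement G E i j = rational_value (path_series G E i j)"


section \<open>Face and trail weights\<close>

text \<open>
  Clockwise boundaries of the faces, without the parts on the boundary of the cylinder.
  \<open>face_left j\<close> lies between \<open>Ein j\<close> and \<open>Ein (j + 1)\<close>, \<open>face_right j\<close> between \<open>Eout j\<close> and
  \<open>Eout (j + 1)\<close>, and \<open>face_mid s i\<close> between \<open>Crs s (i - 1)\<close> and \<open>Crs s i\<close>.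
\<close>

definition face_left :: "cyl_graph \<Rightarrow> int \<Rightarrow> (edge \<times> bool) list" where
  "face_left G j = [(Ein (j + 1), True), (Nxt 1 j, False), (Up 1 j, False), (Ein j, False)]"

definition face_right :: "cyl_graph \<Rightarrow> int \<Rightarrow> (edge \<times> bool) list" where
  "face_right G j = [(Eout j, False), (Nxt (loops G) j, True), (Up (loops G) (j + 1), True),
                     (Eout (j + 1), True)]"

definition face_mid :: "cyl_graph \<Rightarrow> nat \<Rightarrow> int \<Rightarrow> (edge \<times> bool) list" where
  "face_mid G s i =
     (if lft G s i = lft G s (i - 1) then []
      else [(Nxt s (lft G s (i - 1)), True), (Up s (lft G s i), True)]) @
     [(Crs s i, True)] @
     (if rgt G s i = rgt G s (i - 1) then []
      else [(Nxt (s + 1) (rgt G s (i - 1)), False), (Up (s + 1) (rgt G s (i - 1)), False)]) @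
     [(Crs s (i - 1), False)]"

definition trail2 :: "cyl_graph \<Rightarrow> (edge \<times> bool) list" where
  "trail2 G = [(Ein (lft G 1 0), True), (Up 1 (lft G 1 0), True), (Crs 1 0, True),
               (Up 2 (rgt G 1 0), True), (Eout (rgt G 1 0), True)]"

text \<open>
  Weights \<open>(a, b, c, t)\<close> on a 2-loop graph.  The index of a left or right face is the index of the
  black, respectively white, string vertex at its bottom, so that the first ones above the
  trail are \<open>a (lft 0)\<close> and \<open>b (rgt 0)\<close>; the face just above the trail between the strings is
  \<open>c 1\<close>.
\<close>

type_synonym weights2 = "(int \<Rightarrow> real) \<times> (int \<Rightarrow> real) \<times> (int \<Rightarrow> real) \<times> real"

definition face_trail2 :: "cyl_graph \<Rightarrow> (edge \<Rightarrow> real) \<Rightarrow> weights2" where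
  "face_trail2 G E =
     (\<lambda>j. walk_weight E (face_left G j), \<lambda>j. walk_weight E (face_right G j),
      \<lambda>i. walk_weight E (face_mid G 1 i), walk_weight E (trail2 G))"

definition realizes2 :: "cyl_graph \<Rightarrow> (edge \<Rightarrow> real) \<Rightarrow> weights2 \<Rightarrow> bool" where
  "realizes2 G E w \<longleftrightarrow> edge_weighting G E \<and> face_trail2 G E = w"

definition cyc_pos :: "nat \<Rightarrow> (int \<Rightarrow> real) \<Rightarrow> bool" where
  "cyc_pos n f \<longleftrightarrow> (\<forall>i. f i > 0 \<and> f (i + int n) = f i)"

fun face_trail_weights2 :: "cyl_graph \<Rightarrow> weights2 \<Rightarrow> bool" where
  "face_trail_weights2 G (a, b, c, t) \<longleftrightarrow>
     cyc_pos (strlen G 1) a \<and> cyc_pos (strlen G 2) b \<and> cyc_pos (ncr G 1) c \<and> t > 0 \<and>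
     (\<Prod>j<strlen G 1. a (int j)) * (\<Prod>j<strlen G 2. b (int j)) * (\<Prod>i<ncr G 1. c (int i)) = 1"


section \<open>The face weighted plabic R-matrix\<close>

text \<open>
  \<open>Nxt 1 j\<close> is the highest left-string edge bordering \<open>a\<^sub>j\<close> and \<open>Nxt 2 j\<close> the lowest right-string
  edge bordering \<open>b\<^sub>j\<close>.
\<close>

definition assoc_a :: "cyl_graph \<Rightarrow> int \<Rightarrow> int \<Rightarrow> bool" where
  "assoc_a G j i \<longleftrightarrow> Nxt 1 j \<in> fst ` set (face_mid G 1 i)"

definition assoc_b :: "cyl_graph \<Rightarrow> int \<Rightarrow> int \<Rightarrow> bool" where
  "assoc_b G j i \<longleftrightarrow> Nxt 2 j \<in> fst ` set (face_mid G 1 i)"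

definition prod_a :: "cyl_graph \<Rightarrow> (int \<Rightarrow> real) \<Rightarrow> int set \<Rightarrow> real" where
  "prod_a G a I = (\<Prod>i\<in>I. \<Prod>j | assoc_a G j i. a j)"

definition prod_b :: "cyl_graph \<Rightarrow> (int \<Rightarrow> real) \<Rightarrow> int set \<Rightarrow> real" where
  "prod_b G b I = (\<Prod>i\<in>I. \<Prod>j | assoc_b G j i. b j)"

definition index_a :: "cyl_graph \<Rightarrow> int \<Rightarrow> int" where
  "index_a G j = (THE i. assoc_a G j i)"

definition index_b :: "cyl_graph \<Rightarrow> int \<Rightarrow> int" where
  "index_b G j = (THE i. assoc_b G j i)"

text \<open>
  Edge weights of the expanded graph: \<open>xw i\<close> and \<open>yw i\<close> are the white-to-black string edges
  bordering \<open>c\<^sub>i\<close>, of weight 1 if inserted by the expansion; \<open>zw i\<close> is the crossing edge between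
  \<open>c\<^sub>i\<close> and \<open>c\<^sub>i\<^sub>+\<^sub>1\<close>.
\<close>

definition xw :: "cyl_graph \<Rightarrow> (int \<Rightarrow> real) \<Rightarrow> int \<Rightarrow> real" where
  "xw G a i = (\<Prod>j | assoc_a G j i. inverse (a j))"

definition yw :: "cyl_graph \<Rightarrow> (int \<Rightarrow> real) \<Rightarrow> int \<Rightarrow> real" where
  "yw G b i = (\<Prod>j | assoc_b G j i. b j)"

fun zw :: "cyl_graph \<Rightarrow> weights2 \<Rightarrow> int \<Rightarrow> real" where
  "zw G (a, b, c, t) i = (let k = i mod int (ncr G 1)
     in t * prod_a G a {1..k} * prod_b G b {1..k} * (\<Prod>j\<in>{1..k}. c j))"

definition lam :: "nat \<Rightarrow> (int \<Rightarrow> real) \<Rightarrow> (int \<Rightarrow> real) \<Rightarrow> (int \<Rightarrow> real) \<Rightarrow> int \<Rightarrow> real" where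
  "lam n x y z i = (\<Sum>j\<in>{i..i + int n - 1}.
     (\<Prod>k\<in>{i + 1..j}. x k) * z j * (\<Prod>k\<in>{j + 1..i + int n - 1}. y k))"

fun lam_hat :: "cyl_graph \<Rightarrow> weights2 \<Rightarrow> int \<Rightarrow> real" where
  "lam_hat G (a, b, c, t) = lam (ncr G 1) (xw G a) (yw G b) (zw G (a, b, c, t))"

fun Tf :: "cyl_graph \<Rightarrow> weights2 \<Rightarrow> weights2" where
  "Tf G (a, b, c, t) =
     (let l = lam_hat G (a, b, c, t) in
      (\<lambda>i. let j = index_a G i; p = index_a G (i - 1) in l j / (l p * prod_b G b {p..<j}),
       \<lambda>i. let j = index_b G i; q = index_b G (i + 1) in l q / (l j * prod_a G a {j<..q}),
       \<lambda>i. c i * l (i - 1) * prod_a G a {i..i + 1} * prod_b G b {i - 1..i} / l (i + 1),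
       t))"


section \<open>Two adjacent strings of a larger network\<close>

text \<open>
  The network formed by strings \<open>s\<close> and \<open>s + 1\<close> is cut out after splitting off, by an edge of
  weight 1, all edges joining them to other strings or to the boundary: each black vertex of
  string \<open>s\<close> and each white vertex of string \<open>s + 1\<close> gets one boundary edge, of weight 1.
\<close>

definition sub_graph :: "cyl_graph \<Rightarrow> nat \<Rightarrow> cyl_graph" where
  "sub_graph G s = \<lparr> loops = 2, strlen = (\<lambda>r. strlen G (s + r - 1)), ncr = (\<lambda>_. ncr G s),
     lft = (\<lambda>_. lft G s), rgt = (\<lambda>_. rgt G s),
     height = (\<lambda>v. case v of Bdl j \<Rightarrow> height G (Blk s j) | Bdr j \<Rightarrow> height G (Wht (s + 1) j)
        | Blk r j \<Rightarrow> height G (Blk (s + r - 1) j) | Wht r j \<Rightarrow> height G (Wht (s + r - 1) j)) \<rparr>"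

fun sub_weighting :: "nat \<Rightarrow> (edge \<Rightarrow> real) \<Rightarrow> edge \<Rightarrow> real" where
  "sub_weighting s E (Ein j) = 1"
| "sub_weighting s E (Up r j) = E (Up (s + r - 1) j)"
| "sub_weighting s E (Nxt r j) = E (Nxt (s + r - 1) j)"
| "sub_weighting s E (Crs r i) = E (Crs s i)"
| "sub_weighting s E (Eout j) = 1"

fun in_sub :: "nat \<Rightarrow> edge \<Rightarrow> bool" where
  "in_sub s (Up r j) \<longleftrightarrow> r \<in> {s, s + 1}"
| "in_sub s (Nxt r j) \<longleftrightarrow> r \<in> {s, s + 1}"
| "in_sub s (Crs r i) \<longleftrightarrow> r = s"
| "in_sub s (Ein j) \<longleftrightarrow> False"
| "in_sub s (Eout j) \<longleftrightarrow> False"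

text \<open>\<open>E'\<close> arises from \<open>E\<close> by applying \<open>T\<^sub>f\<close> to strings \<open>s\<close> and \<open>s + 1\<close>.\<close>

definition Tf_move :: "cyl_graph \<Rightarrow> nat \<Rightarrow> (edge \<Rightarrow> real) \<Rightarrow> (edge \<Rightarrow> real) \<Rightarrow> bool" where
  "Tf_move G s E E' \<longleftrightarrow> edge_weighting G E \<and> edge_weighting G E' \<and>
     (\<forall>e. edges G e \<and> \<not> in_sub s e \<longrightarrow> E' e = E e) \<and>
     face_trail2 (sub_graph G s) (sub_weighting s E')
       = Tf (sub_graph G s) (face_trail2 (sub_graph G s) (sub_weighting s E))"

text \<open>
  Weights \<open>(a, c, d, b, t)\<close> on a 3-loop graph, the faces being listed from left to right, and \<open>t\<close>
  being the weight of a given trail \<open>\<tau>\<close>.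
\<close>

type_synonym weights3 =
  "(int \<Rightarrow> real) \<times> (int \<Rightarrow> real) \<times> (int \<Rightarrow> real) \<times> (int \<Rightarrow> real) \<times> real"

definition face_trail3 :: "cyl_graph \<Rightarrow> (edge \<times> bool) list \<Rightarrow> (edge \<Rightarrow> real) \<Rightarrow> weights3" where
  "face_trail3 G \<tau> E =
     (\<lambda>j. walk_weight E (face_left G j), \<lambda>i. walk_weight E (face_mid G 1 i),
      \<lambda>i. walk_weight E (face_mid G 2 i), \<lambda>j. walk_weight E (face_right G j),
      walk_weight E \<tau>)"

fun face_trail_weights3 :: "cyl_graph \<Rightarrow> weights3 \<Rightarrow> bool" where
  "face_trail_weights3 G (a, c, d, b, t) \<longleftrightarrow>
     cyc_pos (strlen G 1) a \<and> cyc_pos (ncr G 1) c \<and> cyc_pos (ncr G 2) d \<and>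
     cyc_pos (strlen G 3) b \<and> t > 0 \<and>
     (\<Prod>j<strlen G 1. a (int j)) * (\<Prod>i<ncr G 1. c (int i)) *
     (\<Prod>i<ncr G 2. d (int i)) * (\<Prod>j<strlen G 3. b (int j)) = 1"

definition Tf_strings_rel ::
    "cyl_graph \<Rightarrow> (edge \<times> bool) list \<Rightarrow> nat \<Rightarrow> weights3 \<Rightarrow> weights3 \<Rightarrow> bool" where
  "Tf_strings_rel G \<tau> s v v' \<longleftrightarrow>
     (\<exists>E E'. Tf_move G s E E' \<and> face_trail3 G \<tau> E = v \<and> face_trail3 G \<tau> E' = v')"

definition Tf_strings :: "cyl_graph \<Rightarrow> (edge \<times> bool) list \<Rightarrow> nat \<Rightarrow> weights3 \<Rightarrow> weights3" where
  "Tf_strings G \<tau> s v = (THE v'. Tf_strings_rel G \<tau> s v v')"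

end

theory Submission
  imports Defs
begin

text \<open>
  On the universal cover all string edges can be gauged to weight 1, at the price that the remaining
  weights \<open>l\<close> (left boundary edges), \<open>k s\<close> (crossing edges) and \<open>r\<close> (right boundary edges) are only
  periodic up to factors, which are determined by the products \<open>P s\<close> of the weights around string
  \<open>s\<close>.  Face weights are then ratios of successive entries.  With \<open>W i = k i + \<dots> + k (i + n - 1)\<close>,
  \<open>T\<^sub>f\<close> replaces \<open>k i\<close> by \<open>k i / (W i * W (i + 1))\<close> and multiplies \<open>l\<close> and \<open>r\<close> by values of \<open>W\<close>, so it
  exchanges \<open>P 1\<close> and \<open>P 2\<close>.  The paths from a given source to a given sink have total weight
  \<open>l p * r q * (k i + \<dots> + k (j - 1))\<close>, and since \<open>W\<close> has increments proportional to \<open>k\<close>, a telescoping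
  sum shows that \<open>T\<^sub>f\<close> preserves it.  Conversely, path weights obey a linear recurrence of order two
  with roots \<open>P 1\<close> and \<open>P 2\<close>, which are therefore determined up to order, and for a fixed order the
  differences of path weights over one period determine \<open>l\<close>, \<open>r\<close> and \<open>k\<close> up to constants.

  For the braid relation, boundary vertices are added at all crossing edges of the outer strings.
  The moves preserve the path weights of this finer network, both sides permute \<open>(P 1, P 2, P 3)\<close>
  in the same way, and the finer path weights determine the weights once the order is fixed.
\<close>

section \<open>Sequences that are periodic up to a factor\<close>

text \<open>Signs and rational functions hide nothing. The closed curve of a path has winding index
  \<open>cut_int\<close> minus 1, so the sign depends only on the power of \<zeta>, and the
  recurrence makes each series rational; equality of boundary measurements thus means equality of
  all path weights. The two roots are recoverable because removing either of them from a path weight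
  leaves a positive window term. The boundary of a two-loop graph sees only blocks of consecutive
  crossing edges, from the lowest edge at a source to the highest edge at a sink. Excluding digons
  makes every index the start or the end of such a block, so single edges can be isolated. With
  three strings this argument breaks on string 2, which has no boundary vertices: edges that start
  at one vertex of string 1 are told apart only there. This is the reason for the finer network. On
  a larger graph \<open>Tf_move\<close> relates edge weights, which are fixed only up to gauge. That
  it acts on face weights rests on the remaining gauge freedom being supported at vertices without
  edges to the rest of the graph.\<close>

lemma sum_int_Suc: "(\<Sum>m\<in>{i..<j + 1}. f m) = (\<Sum>m\<in>{i..<j}. f m) + (f j :: real)" if "i \<le> j" for i j :: int
proof -
  have "{i..<j + 1} = insert j {i..<j}" using that by auto
  then show ?thesis by simp
qed

lemma sum_int_concat: "(\<Sum>m\<in>{i..<j}. f m) + (\<Sum>m\<in>{j..<k}. f m) = (\<Sum>m\<in>{i..<k}. f m :: real)"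
  if "i \<le> j" "j \<le> k" for i j k :: int
  using sum.union_disjoint[of "{i..<j}" "{j..<k}" f] that ivl_disj_un_two(3)[of i j k] by auto

lemma sum_int_shift: "(\<Sum>m\<in>{i + d..<j + d}. f m) = (\<Sum>m\<in>{i..<j}. f (m + d) :: real)" for i j d :: int
  by (rule sum.reindex_bij_witness[of _ "\<lambda>m. m + d" "\<lambda>m. m - d"]) auto

definition mult_per :: "nat \<Rightarrow> real \<Rightarrow> (int \<Rightarrow> real) \<Rightarrow> bool" where
  "mult_per n c f \<longleftrightarrow> (\<forall>i. f i > 0 \<and> f (i + int n) = c * f i)"

lemma mult_perD:
  assumes "mult_per n c f"
  shows "f i > 0" "f i \<noteq> 0" "f (i + int n) = c * f i"
  using assms less_irrefl unfolding mult_per_def by metis+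

lemma mult_per_pos: "mult_per n c f \<Longrightarrow> c > 0"
  using mult_perD(1,3) by (metis zero_less_mult_pos2)

lemma mult_per_mult: "mult_per n c f \<Longrightarrow> mult_per n d g \<Longrightarrow> mult_per n (c * d) (\<lambda>i. f i * g i)"
  by (auto simp: mult_per_def)

lemma mult_per_inverse: "mult_per n c f \<Longrightarrow> mult_per n (1 / c) (\<lambda>i. 1 / f i)"
  by (auto simp: mult_per_def)

lemma mult_per_unique: "mult_per n c f \<Longrightarrow> mult_per n d g \<Longrightarrow> (\<And>i. g i = a * f i) \<Longrightarrow> d = c"
  using mult_perD(2,3)[of n c f 0] mult_perD(2,3)[of n d g 0] by auto

lemma mult_per_shift: "mult_per n c f \<Longrightarrow> mult_per n c (\<lambda>i. f (i + d))"
  by (auto simp: mult_per_def add.assoc) (metis add.commute add.left_commute)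

lemma mult_per_compose:
  assumes "mult_per n c f" "\<And>i. h (i + int m) = h i + int n"
  shows "mult_per m c (\<lambda>i. f (h i))"
  using assms by (auto simp: mult_per_def)

section \<open>Window sums over one period, and the telescoping transformation
  \<open>flip\<close>\<close>

definition win :: "nat \<Rightarrow> (int \<Rightarrow> real) \<Rightarrow> int \<Rightarrow> real" where
  "win n k i = (\<Sum>m\<in>{i..<i + int n}. k m)"

text \<open>The sum over \<open>{i..<j + n}\<close> is split once after its first \<open>n\<close>
  terms and once before its last \<open>n\<close> terms; the shifted part is \<open>c\<close> times
  the sum over \<open>{i..<j}\<close>.\<close>

lemma win_eq:
  assumes k: "mult_per n c k" and "i \<le> j"
  shows "win n k j = win n k i + (c - 1) * (\<Sum>m\<in>{i..<j}. k m)"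
proof -
  have "(\<Sum>m\<in>{i..<i + int n}. k m) + (\<Sum>m\<in>{i + int n..<j + int n}. k m)
      = (\<Sum>m\<in>{i..<j}. k m) + (\<Sum>m\<in>{j..<j + int n}. k m)"
    using assms sum_int_concat[of i "i + int n" "j + int n" k] sum_int_concat[of i j "j + int n" k] by simp
  moreover have "(\<Sum>m\<in>{i + int n..<j + int n}. k m) = c * (\<Sum>m\<in>{i..<j}. k m)"
    by (simp add: sum_int_shift mult_perD(3)[OF k] sum_distrib_left)
  ultimately show ?thesis by (simp add: win_def algebra_simps)
qed

lemma mult_per_win:
  assumes k: "mult_per n c k" and n: "n > 0"
  shows "mult_per n c (win n k)"
  unfolding mult_per_def
proof (intro allI conjI)
  fix i
  show "win n k i > 0" unfolding win_def
    by (rule sum_pos) (use n mult_perD(1)[OF k] in auto)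
  show "win n k (i + int n) = c * win n k i"
    using sum_int_shift[of k i "int n" "i + int n"]
    by (simp add: win_def mult_perD(3)[OF k] sum_distrib_left)
qed

text \<open>An interval grows by one period either by inserting a window at its lower end and
  shifting the rest, or, in \<open>sum_extend_right\<close>, by appending a window at its upper end.
  Comparing the two exhibits the two roots of the recurrence for path sums.\<close>

lemma sum_extend_left:
  assumes k: "mult_per n c k" and "i \<le> j"
  shows "(\<Sum>m\<in>{i..<j + int n}. k m) = win n k i + c * (\<Sum>m\<in>{i..<j}. k m)"
proof -
  have "(\<Sum>m\<in>{i + int n..<j + int n}. k m) = c * (\<Sum>m\<in>{i..<j}. k m)"
    by (simp add: sum_int_shift mult_perD(3)[OF k] sum_distrib_left)
  then show ?thesis
    using sum_int_concat[of i "i + int n" "j + int n" k] assms(2) by (simp add: win_def)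
qed

lemma sum_extend_right:
  assumes "i \<le> j"
  shows "(\<Sum>m\<in>{i..<j + int n}. k m) = (\<Sum>m\<in>{i..<j}. k m) + win n k j"
  using sum_int_concat[of i j "j + int n" k] assms by (simp add: win_def)

definition flip :: "nat \<Rightarrow> (int \<Rightarrow> real) \<Rightarrow> int \<Rightarrow> real" where
  "flip n k i = k i / (win n k i * win n k (i + 1))"

lemma mult_per_flip:
  assumes k: "mult_per n c k" and n: "n > 0"
  shows "mult_per n (1 / c) (flip n k)"
proof -
  note w = mult_per_win[OF assms]
  have "mult_per n (c * (1 / c) * (1 / c)) (\<lambda>i. k i * (1 / win n k i) * (1 / win n k (i + 1)))"
    by (intro mult_per_mult k mult_per_inverse w mult_per_shift[OF w])
  moreover have "(\<lambda>i. k i * (1 / win n k i) * (1 / win n k (i + 1))) = flip n k"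
    by (simp add: flip_def fun_eq_iff)
  moreover have "c * (1 / c) * (1 / c) = 1 / c"
    using mult_per_pos[OF k] by simp
  ultimately show ?thesis by metis
qed

text \<open>Since \<open>W (m + 1) - W m = (c - 1) * k m\<close> for \<open>W = win n k\<close>,
  \<open>(c - 1) * flip n k m\<close> equals \<open>1 / W m - 1 / W (m + 1)\<close> and the sum
  telescopes. The induction also covers \<open>c = 1\<close>, where \<open>W\<close> is
  constant.\<close>

lemma sum_flip:
  assumes k: "mult_per n c k" and n: "n > 0" and ij: "i \<le> j"
  shows "(\<Sum>m\<in>{i..<j}. flip n k m) = (\<Sum>m\<in>{i..<j}. k m) / (win n k i * win n k j)"
  using ij
proof (induction j rule: int_ge_induct)
  case base
  then show ?case by simp
next
  case (step j)
  define S a b d where "S = (\<Sum>m\<in>{i..<j}. k m)" and "a = win n k i" and "b = win n k j" and "d = win n k (j + 1)"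
  have pos: "a > 0" "b > 0" "d > 0"
    using mult_perD(1)[OF mult_per_win[OF k n]] by (auto simp: a_def b_def d_def)
  have b: "b = a + (c - 1) * S" using win_eq[OF k step(1)] by (simp add: a_def b_def S_def)
  have d: "d = b + (c - 1) * k j"
    using win_eq[OF k, of j "j + 1"] sum_int_Suc[of j j k] by (simp add: d_def b_def)
  have "S * d + k j * a = (S + k j) * b" unfolding d b by (simp add: algebra_simps)
  then have "S / (a * b) + k j / (b * d) = (S + k j) / (a * d)"
    using pos by (simp add: divide_simps)
  then show ?case
    using step sum_int_Suc[of i j k] sum_int_Suc[of i j "flip n k"]
    by (simp add: flip_def S_def a_def b_def d_def)
qed

text \<open>This is the telescoped sum over a full period, with
  \<open>win n k (i + n) = c * win n k i\<close>. Hence flipping twice only multiplies by a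
  constant.\<close>

lemma win_flip:
  assumes k: "mult_per n c k" and n: "n > 0"
  shows "win n (flip n k) i = 1 / (c * win n k i)"
  using sum_flip[OF k n, of i "i + int n"] mult_perD(2,3)[OF mult_per_win[OF k n], of i]
  by (simp add: win_def[of n "flip n k"] win_def[of n k i, symmetric])

section \<open>Step functions of the crossing edges and their adjoints\<close>

definition first_ge :: "(int \<Rightarrow> int) \<Rightarrow> int \<Rightarrow> int" where
  "first_ge f p = (THE m. \<forall>i. p \<le> f i \<longleftrightarrow> m \<le> i)"

text \<open>Models \<open>lft G s\<close> and \<open>rgt G s\<close>, with \<open>n\<close> crossing
  edges per turn and \<open>N\<close> vertices of one color on the string.\<close>

locale staircase =
  fixes f :: "int \<Rightarrow> int" and n N :: nat
  assumes n_pos: "n > 0" and N_pos: "N > 0"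
    and period: "\<And>i. f (i + int n) = f i + int N"
    and incr: "\<And>i. f (i + 1) \<in> {f i, f i + 1}"
begin

lemma mono: "i \<le> j \<Longrightarrow> f i \<le> f j"
proof (induction j rule: int_ge_induct)
  case (step j)
  then show ?case using incr[of j] by auto
qed simp

lemma period_mult: "f (i + int n * int k) = f i + int N * int k"
proof (induction k)
  case (Suc k)
  then show ?case using period[of "i + int n * int k"] by (simp add: algebra_simps)
qed simp

lemma ex_first: "\<exists>m. \<forall>i. p \<le> f i \<longleftrightarrow> m \<le> i"
proof -
  \<comment> \<open>As \<open>N \<ge> 1\<close>, \<open>k\<close> turns move the value of
    \<open>f\<close> by at least \<open>k\<close>, enough to bracket \<open>p\<close> between the
    values at \<open>- (n * k)\<close> and \<open>n * k\<close>.\<close>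
  define k where "k = nat (\<bar>p\<bar> + \<bar>f 0\<bar> + 1)"
  have k: "int k \<le> int N * int k" using N_pos by (simp add: mult_le_cancel_right1)
  have kp: "int k = \<bar>p\<bar> + \<bar>f 0\<bar> + 1" by (simp add: k_def)
  have up: "p \<le> f (int n * int k)" using period_mult[of 0 k] k kp unfolding add_0 by linarith
  have low: "f (- (int n * int k)) < p" using period_mult[of "- (int n * int k)" k] k kp unfolding left_minus by linarith
  define A where "A = {i. p \<le> f i \<and> - (int n * int k) \<le> i \<and> i \<le> int n * int k}"
  have A: "finite A" "int n * int k \<in> A" using up by (auto simp: A_def)
  let ?m = "Min A"
  have m: "?m \<in> A" using A by (intro Min_in) auto
  have "p \<le> f i \<longleftrightarrow> ?m \<le> i" for i
  proof
    assume i: "p \<le> f i"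
    show "?m \<le> i"
    proof (cases "i \<le> int n * int k")
      case True
      have "\<not> i \<le> - (int n * int k)" using mono[of i "- (int n * int k)"] low i by auto
      then show ?thesis using True i A by (intro Min_le) (auto simp: A_def)
    next
      case False
      then show ?thesis using m by (auto simp: A_def)
    qed
  next
    assume "?m \<le> i"
    then show "p \<le> f i" using m mono[of ?m i] by (auto simp: A_def)
  qed
  then show ?thesis by blast
qed

text \<open>\<open>first_ge f\<close> is the lower adjoint of \<open>f\<close>: the lowest crossing
  edge attached at vertex \<open>p\<close> or above. Accordingly \<open>first_ge f (p + 1)\<close>
  is the exclusive upper end of the edges attached at vertex \<open>p\<close> or below.\<close>

lemma first_ge: "p \<le> f i \<longleftrightarrow> first_ge f p \<le> i"
proof -
  have "\<exists>!m. \<forall>i. p \<le> f i \<longleftrightarrow> m \<le> i"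
    using ex_first by (metis order.antisym order.refl)
  from theI'[OF this] show ?thesis unfolding first_ge_def by blast
qed

lemma first_ge_eqI: "f m = p \<Longrightarrow> f (m - 1) \<noteq> p \<Longrightarrow> first_ge f p = m"
  using first_ge[of p m] first_ge[of p "m - 1"] incr[of "m - 1"] by force

lemma f_first_ge: "f (first_ge f p) = p" and f_before_first_ge: "f (first_ge f p - 1) = p - 1"
  using first_ge[of p "first_ge f p"] first_ge[of p "first_ge f p - 1"] incr[of "first_ge f p - 1"] by auto

lemma first_ge_period: "first_ge f (p + int N) = first_ge f p + int n"
  by (rule first_ge_eqI)
    (use period[of "first_ge f p"] period[of "first_ge f p - 1"] f_first_ge[of p] f_before_first_ge[of p]
     in \<open>auto simp: algebra_simps\<close>)

lemma first_ge_mono: "p \<le> q \<Longrightarrow> first_ge f p \<le> first_ge f q"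
  using first_ge[of p "first_ge f q"] f_first_ge[of q] by simp

text \<open>The left side says that the face between crossing edges \<open>i - 1\<close> and
  \<open>i\<close> borders the white-to-black string edge above vertex \<open>p\<close>. This turns
  association of faces into \<open>first_ge\<close>.\<close>

lemma changes_iff: "f i \<noteq> f (i - 1) \<and> f (i - 1) = p \<longleftrightarrow> i = first_ge f (p + 1)"
  using first_ge_eqI[of i "p + 1"] incr[of "i - 1"] f_first_ge[of "p + 1"] f_before_first_ge[of "p + 1"]
  by force

lemma first_ge_f: "first_ge f (f i) \<le> i" "i < first_ge f (f i + 1)"
  using first_ge[of "f i" i] first_ge[of "f i + 1" i] by auto

end

section \<open>Flat weightings and gauge equivalence\<close>

declare One_nat_def [simp del]

fun flat :: "(int \<Rightarrow> real) \<Rightarrow> (nat \<Rightarrow> int \<Rightarrow> real) \<Rightarrow> (int \<Rightarrow> real) \<Rightarrow> edge \<Rightarrow> real" where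
  "flat l k r (Ein j) = l j"
| "flat l k r (Up s j) = 1"
| "flat l k r (Nxt s j) = 1"
| "flat l k r (Crs s i) = k s i"
| "flat l k r (Eout j) = r j"

text \<open>The potential \<open>g\<close> need not be periodic, which is what allows a weighting of
  the cylinder to be compared with a flat one on the universal cover.\<close>

definition gauge_equiv :: "cyl_graph \<Rightarrow> (vertex \<Rightarrow> real) \<Rightarrow> (edge \<Rightarrow> real) \<Rightarrow> (edge \<Rightarrow> real) \<Rightarrow> bool" where
  "gauge_equiv G g E0 E \<longleftrightarrow> (\<forall>v. g v > 0) \<and> (\<forall>e. edges G e \<longrightarrow> E e = E0 e * g (tgt G e) / g (src G e))"

lemma gauge_trans: "gauge_equiv G g E0 E \<Longrightarrow> gauge_equiv G h E E1 \<Longrightarrow> gauge_equiv G (\<lambda>v. g v * h v) E0 E1"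
  by (auto simp: gauge_equiv_def)

lemma walk_weight_simps [simp]:
  "walk_weight E [] = 1"
  "walk_weight E ((e, d) # ws) = (if d then E e else inverse (E e)) * walk_weight E ws"
  by (auto simp: walk_weight_def)

lemma walk_weight_gauge:
  assumes g: "gauge_equiv G g E0 E"
  shows "walk G u ws v \<Longrightarrow> walk_weight E ws = walk_weight E0 ws * g v / g u"
proof (induction ws arbitrary: u)
  case Nil
  have "g v \<noteq> 0" using assms less_irrefl unfolding gauge_equiv_def by metis
  then show ?case using Nil by simp
next
  case (Cons ed ws)
  obtain e d where ed: "ed = (e, d)" by force
  have nz: "g x \<noteq> 0" for x using assms less_irrefl unfolding gauge_equiv_def by metis
  have e: "E e = E0 e * g (tgt G e) / g (src G e)" using Cons.prems assms by (auto simp: gauge_equiv_def ed)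
  show ?case
    using Cons.IH[of "if d then tgt G e else src G e"] Cons.prems nz by (auto simp: ed e divide_simps mult.commute)
qed

lemma walk_weight_pos:
  assumes pos: "\<And>e. edges G e \<Longrightarrow> E e > 0"
  shows "walk G u ws v \<Longrightarrow> walk_weight E ws > 0"
proof (induction ws arbitrary: u)
  case (Cons ed ws)
  obtain e d where ed: "ed = (e, d)" by force
  show ?case
    using Cons.IH[of "if d then tgt G e else src G e"] Cons.prems pos[of e] by (auto simp: ed)
qed simp

locale cyl =
  fixes G :: cyl_graph
  assumes loops_ge: "loops G \<ge> 1"
    and strlen_pos: "\<And>s. s \<in> {1..loops G} \<Longrightarrow> strlen G s > 0"
    and layer: "\<And>s. s \<in> {1..<loops G} \<Longrightarrow> layer_ok G s"
begin

lemma ncr_pos: "s \<in> {1..<loops G} \<Longrightarrow> ncr G s > 0"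
  using layer[of s] by (simp add: layer_ok_def)

lemma staircase_lft: "s \<in> {1..<loops G} \<Longrightarrow> staircase (lft G s) (ncr G s) (strlen G s)"
  using layer[of s] strlen_pos[of s] by unfold_locales (auto simp: layer_ok_def)

lemma staircase_rgt: "s \<in> {1..<loops G} \<Longrightarrow> staircase (rgt G s) (ncr G s) (strlen G (s + 1))"
  using layer[of s] strlen_pos[of "s + 1"] by unfold_locales (auto simp: layer_ok_def)

lemma walk_faces:
  "walk G (Bdl (j + 1)) (face_left G j) (Bdl j)"
  "walk G (Bdr j) (face_right G j) (Bdr (j + 1))"
  "s \<in> {1..<loops G} \<Longrightarrow> walk G (Wht s (lft G s (i - 1))) (face_mid G s i) (Wht s (lft G s (i - 1)))"
proof -
  show "walk G (Bdl (j + 1)) (face_left G j) (Bdl j)" "walk G (Bdr j) (face_right G j) (Bdr (j + 1))"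
    using loops_ge by (auto simp: face_left_def face_right_def)
  assume s: "s \<in> {1..<loops G}"
  have "lft G s (i - 1 + 1) \<in> {lft G s (i - 1), lft G s (i - 1) + 1}"
    "rgt G s (i - 1 + 1) \<in> {rgt G s (i - 1), rgt G s (i - 1) + 1}"
    using layer[OF s] unfolding layer_ok_def by blast+
  then show "walk G (Wht s (lft G s (i - 1))) (face_mid G s i) (Wht s (lft G s (i - 1)))"
    using s by (auto simp: face_mid_def)
qed

end

text \<open>Boundary vertices may not be rescaled; this is what makes trail and path weights gauge
  invariant.\<close>

definition bd_one :: "(vertex \<Rightarrow> real) \<Rightarrow> bool" where
  "bd_one g \<longleftrightarrow> (\<forall>j. g (Bdl j) = 1 \<and> g (Bdr j) = 1)"

text \<open>Serves two and three loops alike, as \<open>weights2\<close> and \<open>weights3\<close>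
  are different types.\<close>

definition same_weights :: "cyl_graph \<Rightarrow> (edge \<times> bool) list \<Rightarrow> (edge \<Rightarrow> real) \<Rightarrow> (edge \<Rightarrow> real) \<Rightarrow> bool" where
  "same_weights G \<tau> E E' \<longleftrightarrow>
     (\<forall>j. walk_weight E (face_left G j) = walk_weight E' (face_left G j)) \<and>
     (\<forall>s\<in>{1..<loops G}. \<forall>i. walk_weight E (face_mid G s i) = walk_weight E' (face_mid G s i)) \<and>
     (\<forall>j. walk_weight E (face_right G j) = walk_weight E' (face_right G j)) \<and>
     walk_weight E \<tau> = walk_weight E' \<tau>"

lemma same_weights_sym: "same_weights G \<tau> E E' \<Longrightarrow> same_weights G \<tau> E' E"
  by (simp add: same_weights_def)

lemma same_weights_trans: "same_weights G \<tau> E E' \<Longrightarrow> same_weights G \<tau> E' E'' \<Longrightarrow> same_weights G \<tau> E E''"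
  by (simp add: same_weights_def)

lemma same_weights_loops2: "loops G = 2 \<Longrightarrow> same_weights G (trail2 G) E E' \<longleftrightarrow> face_trail2 G E = face_trail2 G E'"
proof -
  have "{1..<2} = {1::nat}" by auto
  then show "loops G = 2 \<Longrightarrow> ?thesis" by (auto simp: same_weights_def face_trail2_def fun_eq_iff)
qed

lemma same_weights_loops3: "loops G = 3 \<Longrightarrow> same_weights G \<tau> E E' \<longleftrightarrow> face_trail3 G \<tau> E = face_trail3 G \<tau> E'"
proof -
  have "{1..<3} = {1, 2::nat}" by auto
  then show "loops G = 3 \<Longrightarrow> ?thesis" by (auto simp: same_weights_def face_trail3_def fun_eq_iff)
qed

lemma (in cyl) same_weights_gauge:
  assumes g: "gauge_equiv G g E E'" and bd: "bd_one g" and \<tau>: "trail G \<tau>"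
  shows "same_weights G \<tau> E' E"
proof -
  have pos: "g v \<noteq> 0" for v using g less_irrefl unfolding gauge_equiv_def by metis
  note w = walk_weight_gauge[OF g]
  obtain i j where "walk G (Bdl i) \<tau> (Bdr j)" using \<tau> by (auto simp: trail_def)
  from w[OF this] show ?thesis
    using w[OF walk_faces(1)] w[OF walk_faces(2)] w[OF walk_faces(3)] bd pos
    by (simp add: same_weights_def bd_one_def)
qed

lemma walk_weight_flat_faces:
  "walk_weight (flat l k r) (face_left G j) = l (j + 1) / l j"
  "walk_weight (flat l k r) (face_right G j) = r (j + 1) / r j"
  "walk_weight (flat l k r) (face_mid G s i) = k s i / k s (i - 1)"
  by (auto simp: face_left_def face_right_def face_mid_def divide_simps)

lemma face_trail2_flat:
  "face_trail2 G (flat l k r) = (\<lambda>j. l (j + 1) / l j, \<lambda>j. r (j + 1) / r j, \<lambda>i. k 1 i / k 1 (i - 1),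
     l (lft G 1 0) * k 1 0 * r (rgt G 1 0))"
  by (simp add: face_trail2_def walk_weight_flat_faces fun_eq_iff trail2_def)

text \<open>\<open>P s\<close> is the product of the edge weights once around string
  \<open>s\<close>. With string weights 1 it survives in the quasi-periods: each other edge picks up
  the factor of its source string and the inverse factor of its target string.\<close>

definition state :: "cyl_graph \<Rightarrow> (nat \<Rightarrow> real) \<Rightarrow> (int \<Rightarrow> real) \<Rightarrow> (nat \<Rightarrow> int \<Rightarrow> real) \<Rightarrow> (int \<Rightarrow> real) \<Rightarrow> bool" where
  "state G P l k r \<longleftrightarrow> (\<forall>s. P s > 0) \<and> mult_per (strlen G 1) (1 / P 1) l \<and>
     (\<forall>s\<in>{1..<loops G}. mult_per (ncr G s) (P s / P (s + 1)) (k s)) \<and>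
     mult_per (strlen G (loops G)) (P (loops G)) r"

definition potential :: "cyl_graph \<Rightarrow> (nat \<Rightarrow> real) \<Rightarrow> (vertex \<Rightarrow> real) \<Rightarrow> bool" where
  "potential G P g \<longleftrightarrow> (\<forall>v. g v > 0) \<and> bd_one g \<and>
     (\<forall>s\<in>{1..loops G}. \<forall>j. g (Blk s (j + int (strlen G s))) = P s * g (Blk s j) \<and>
        g (Wht s (j + int (strlen G s))) = P s * g (Wht s j))"

text \<open>The quasi-periods in \<open>state\<close> and in \<open>potential\<close> cancel on
  every edge.\<close>

lemma (in cyl) gauge_flat_weighting:
  assumes st: "state G P l k r" and pot: "potential G P g" and ga: "gauge_equiv G g (flat l k r) E"
  shows "edge_weighting G E"
  unfolding edge_weighting_def
proof (intro allI impI)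
  fix e assume e: "edges G e"
  have es: "edges G (eshift G e)" using e by (cases e) auto
  have g: "g v > 0" "g v \<noteq> 0" for v using pot less_irrefl unfolding potential_def by metis+
  have P: "P s > 0" "P s \<noteq> 0" for s using st less_irrefl unfolding state_def by metis+
  have k: "s \<in> {1..<loops G} \<Longrightarrow> mult_per (ncr G s) (P s / P (s + 1)) (k s)" for s
    using st by (auto simp: state_def)
  have l: "mult_per (strlen G 1) (1 / P 1) l" and r: "mult_per (strlen G (loops G)) (P (loops G)) r"
    using st by (auto simp: state_def)
  have lr: "lft G s (i + int (ncr G s)) = lft G s i + int (strlen G s)"
    "rgt G s (i + int (ncr G s)) = rgt G s i + int (strlen G (s + 1))" if "s \<in> {1..<loops G}" for s i
    using layer[OF that] by (auto simp: layer_ok_def)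
  have Nxt_eq: "s \<in> {1..loops G} \<Longrightarrow> g (Blk s (j + int (strlen G s) + 1)) = P s * g (Blk s (j + 1))" for s j
  proof -
    assume "s \<in> {1..loops G}"
    then have "g (Blk s (j + 1 + int (strlen G s))) = P s * g (Blk s (j + 1))"
      using pot unfolding potential_def by blast
    then show ?thesis by (simp add: algebra_simps)
  qed
  have pe: "flat l k r e > 0" using e
    by (cases e) (auto intro: mult_perD(1)[OF l] mult_perD(1)[OF r] mult_perD(1)[OF k])
  show "E e > 0 \<and> E (eshift G e) = E e"
  proof
    show "E e > 0" using ga e pe g by (auto simp: gauge_equiv_def)
    have "flat l k r (eshift G e) * g (tgt G (eshift G e)) / g (src G (eshift G e))
        = flat l k r e * g (tgt G e) / g (src G e)"
      using e loops_ge pot g(2) P(2) lr Nxt_eq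
      by (cases e) (auto simp: potential_def bd_one_def mult_perD(3)[OF l] mult_perD(3)[OF r] mult_perD(3)[OF k])
    then show "E (eshift G e) = E e" using ga e es by (auto simp: gauge_equiv_def)
  qed
qed

section \<open>Every weighting has a flat form, unique up to scaling\<close>

lemma ex_mult_primitive:
  assumes f: "cyc_pos N f" and N: "N > 0"
  obtains h where "\<And>j. h (j + 1) = h j * f j" "mult_per N (\<Prod>j<N. f (int j)) h"
proof -
  define h where "h j = (if j \<ge> 0 then \<Prod>i\<in>{0..<j}. f i else 1 / (\<Prod>i\<in>{j..<0}. f i))" for j
  have pos: "f j > 0" "f j \<noteq> 0" for j using f less_irrefl unfolding cyc_pos_def by metis+
  have h: "h (j + 1) = h j * f j" for j
  proof (cases "j \<ge> 0")
    case True
    then have "{0..<j + 1} = insert j {0..<j}" by auto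
    then show ?thesis using True by (simp add: h_def)
  next
    case False
    then have "{j..<0} = insert j {j + 1..<0}" by auto
    then show ?thesis using False pos[of j] by (cases "j = -1") (auto simp: h_def)
  qed
  have hpos: "h j > 0" for j using pos by (auto simp: h_def intro!: prod_pos)
  have adv: "h (j + int k) = h j * (\<Prod>i<k. f (j + int i))" for j k
  proof (induction k)
    case (Suc k)
    then show ?case using h[of "j + int k"] by (simp add: algebra_simps)
  qed simp
  \<comment> \<open>The product of \<open>f\<close> over the period that starts at \<open>j\<close>;
    it turns out not to depend on \<open>j\<close> and is the multiplier of
    \<open>h\<close>.\<close>
  define c where "c j = (\<Prod>i<N. f (j + int i))" for j
  have "c (j + 1) = c j" for j
  proof -
    have "c (j + 1) * f j = f j * (\<Prod>i<N. f (j + 1 + int i))" by (simp add: c_def)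
    also have "\<dots> = (\<Prod>i<Suc N. f (j + int i))"
      by (subst prod.lessThan_Suc_shift) (simp add: algebra_simps)
    also have "\<dots> = c j * f (j + int N)" by (simp add: c_def)
    also have "f (j + int N) = f j" using f by (simp add: cyc_pos_def)
    finally show ?thesis using pos(2)[of j] by simp
  qed
  then have "c j = c 0" for j
    by (induction j rule: int_induct[of _ 0]) (auto, metis diff_add_cancel)
  then have "mult_per N (\<Prod>j<N. f (int j)) h"
    using hpos adv by (simp add: mult_per_def c_def)
  then show ?thesis using h that by blast
qed

text \<open>A face between two strings is indexed by its upper crossing edge, so its ratio looks
  back instead of ahead.\<close>

lemma ex_mult_primitive_back:
  assumes f: "cyc_pos N f" and N: "N > 0"
  obtains h where "\<And>i. h i = h (i - 1) * f i" "mult_per N (\<Prod>j<N. f (int j)) h"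
proof -
  obtain h where h: "\<And>j. h (j + 1) = h j * f j" "mult_per N (\<Prod>j<N. f (int j)) h"
    by (rule ex_mult_primitive[OF assms]) (rule that)
  show ?thesis
    by (rule that[of "\<lambda>i. h (i + 1)"]) (use h(1) mult_per_shift[OF h(2), of 1] in simp_all)
qed

lemma mult_per_prod_ratio:
  assumes "mult_per N c h"
  shows "cyc_pos N (\<lambda>j. h (j + 1) / h j)" "(\<Prod>j<N. h (int j + 1) / h (int j)) = c"
proof -
  note h = mult_perD[OF assms]
  have c: "c > 0" using assms by (rule mult_per_pos)
  have "h (j + int N + 1) = c * h (j + 1)" for j using h(3)[of "j + 1"] by (simp add: algebra_simps)
  then show "cyc_pos N (\<lambda>j. h (j + 1) / h j)" using h c by (auto simp: cyc_pos_def)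
  have "(\<Prod>j<M. h (int j + 1) / h (int j)) = h (int M) / h 0" for M
    by (induction M) (use h(2) in \<open>auto simp: algebra_simps\<close>)
  then show "(\<Prod>j<N. h (int j + 1) / h (int j)) = c" using h(3)[of 0] h(2)[of 0] by simp
qed

lemma ratio_determines:
  fixes f g :: "int \<Rightarrow> real"
  assumes f: "\<And>j. f j > 0" and g: "\<And>j. g j > 0" and eq: "\<And>j. f (j + 1) / f j = g (j + 1) / g j"
  obtains a where "a > 0" "\<And>j. g j = a * f j"
proof -
  have "g (j + 1) / f (j + 1) = g j / f j" for j
    using eq[of j] f[of j] f[of "j + 1"] g[of j] by (simp add: field_simps)
  then have "g j / f j = g 0 / f 0" for j
    by (induction j rule: int_induct[of _ 0]) (auto, metis diff_add_cancel)
  then have "g j = g 0 / f 0 * f j" for j using f[of j] by (metis less_irrefl nonzero_eq_divide_eq)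
  moreover have "g 0 / f 0 > 0" using f g by simp
  ultimately show ?thesis using that by blast
qed

text \<open>The potential at a vertex of string \<open>s\<close> is the product of the string
  weights from a base point up to that vertex, which makes all string edges 1; the other edges
  absorb the difference.\<close>

lemma (in cyl) ex_flat:
  assumes E: "edge_weighting G E"
  obtains P l k r g where "state G P l k r" "potential G P g" "gauge_equiv G g (flat l k r) E"
proof -
  have pos: "edges G e \<Longrightarrow> E e > 0" and per: "edges G e \<Longrightarrow> E (eshift G e) = E e" for e
    using E by (auto simp: edge_weighting_def)
  have nz: "edges G e \<Longrightarrow> E e \<noteq> 0" for e using pos[of e] by simp
  have "\<exists>h. \<forall>s\<in>{1..loops G}. (\<forall>j. h s (j + 1) = h s j * (E (Up s j) * E (Nxt s j))) \<and>
      mult_per (strlen G s) (\<Prod>j<strlen G s. E (Up s (int j)) * E (Nxt s (int j))) (h s)"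
  proof (rule bchoice, rule ballI)
    fix s assume s: "s \<in> {1..loops G}"
    have "cyc_pos (strlen G s) (\<lambda>j. E (Up s j) * E (Nxt s j))"
      using pos[of "Up s _"] pos[of "Nxt s _"] per[of "Up s _"] per[of "Nxt s _"] s
      by (auto simp: cyc_pos_def)
    from ex_mult_primitive[OF this strlen_pos[OF s]]
    show "\<exists>h. (\<forall>j. h (j + 1) = h j * (E (Up s j) * E (Nxt s j))) \<and>
      mult_per (strlen G s) (\<Prod>j<strlen G s. E (Up s (int j)) * E (Nxt s (int j))) h" by metis
  qed
  then obtain h where h: "\<And>s j. s \<in> {1..loops G} \<Longrightarrow> h s (j + 1) = h s j * (E (Up s j) * E (Nxt s j))"
    and hper: "\<And>s. s \<in> {1..loops G} \<Longrightarrow> mult_per (strlen G s) (\<Prod>j<strlen G s. E (Up s (int j)) * E (Nxt s (int j))) (h s)"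
    by blast
  \<comment> \<open>The value 1 elsewhere keeps \<open>P s > 0\<close> for all \<open>s\<close>, as
    \<open>state\<close> demands.\<close>
  define P where "P s = (if s \<in> {1..loops G} then \<Prod>j<strlen G s. E (Up s (int j)) * E (Nxt s (int j)) else 1)" for s
  have hper: "s \<in> {1..loops G} \<Longrightarrow> mult_per (strlen G s) (P s) (h s)" for s
    using hper by (simp add: P_def)
  define g where "g v = (case v of Blk s j \<Rightarrow> if s \<in> {1..loops G} then h s j else 1
     | Wht s j \<Rightarrow> if s \<in> {1..loops G} then h s j * E (Up s j) else 1 | _ \<Rightarrow> 1)" for v
  define l where "l j = E (Ein j) / g (Blk 1 j)" for j
  define r where "r j = E (Eout j) * g (Wht (loops G) j)" for j
  define k where "k s i = E (Crs s i) * g (Wht s (lft G s i)) / g (Blk (s + 1) (rgt G s i))" for s i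
  have gpos: "g v > 0" for v
    using mult_perD(1)[OF hper] pos[of "Up _ _"] by (auto simp: g_def split: vertex.split)
  have Ppos: "P s > 0" for s
    using mult_per_pos[OF hper[of s]] by (cases "s \<in> {1..loops G}") (auto simp: P_def)
  have gnz: "g v \<noteq> 0" and Pnz: "P s \<noteq> 0" for v s using gpos[of v] Ppos[of s] by auto
  have pot: "potential G P g"
    using gpos mult_perD(3)[OF hper] per[of "Up _ _"] by (auto simp: potential_def bd_one_def g_def)
  have gper: "g (Blk s (j + int (strlen G s))) = P s * g (Blk s j)"
     "g (Wht s (j + int (strlen G s))) = P s * g (Wht s j)" if "s \<in> {1..loops G}" for s j
    using pot that by (auto simp: potential_def)
  have lr: "lft G s (i + int (ncr G s)) = lft G s i + int (strlen G s)"
    "rgt G s (i + int (ncr G s)) = rgt G s i + int (strlen G (s + 1))" if "s \<in> {1..<loops G}" for s i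
    using layer[OF that] by (auto simp: layer_ok_def)
  have "state G P l k r" unfolding state_def mult_per_def
  proof (intro conjI allI ballI)
    show "P s > 0" for s by (rule Ppos)
    show "l i > 0" "r i > 0" for i using pos[of "Ein i"] pos[of "Eout i"] gpos by (auto simp: l_def r_def)
    show "l (i + int (strlen G 1)) = 1 / P 1 * l i" for i
      using per[of "Ein i"] gper[of 1 i] loops_ge by (simp add: l_def)
    show "r (i + int (strlen G (loops G))) = P (loops G) * r i" for i
      using per[of "Eout i"] gper[of "loops G" i] loops_ge by (simp add: r_def)
    fix s i assume s: "s \<in> {1..<loops G}"
    show "k s i > 0" using pos[of "Crs s i"] gpos s by (auto simp: k_def)
    show "k s (i + int (ncr G s)) = P s / P (s + 1) * k s i"
      using per[of "Crs s i"] gper[of s "lft G s i"] gper[of "s + 1" "rgt G s i"] lr[OF s, of i] s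
      by (simp add: k_def)
  qed
  moreover have "gauge_equiv G g (flat l k r) E" unfolding gauge_equiv_def
  proof (intro conjI allI impI gpos)
    fix e assume "edges G e"
    then show "E e = flat l k r e * g (tgt G e) / g (src G e)"
      using gnz nz mult_perD(2)[OF hper] h
      by (cases e) (auto simp: l_def r_def k_def, auto simp: g_def)
  qed
  ultimately show ?thesis using pot that by blast
qed

definition bend :: "cyl_graph \<Rightarrow> (edge \<Rightarrow> real) \<Rightarrow> (vertex \<Rightarrow> real) \<Rightarrow> edge \<Rightarrow> real" where
  "bend G E0 g e = E0 e * g (tgt G e) / g (src G e)"

lemma gauge_bend: "(\<And>v. g v > 0) \<Longrightarrow> gauge_equiv G g E0 (bend G E0 g)"
  by (simp add: gauge_equiv_def bend_def)

lemma (in cyl) ex_potential: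
  assumes st: "state G P l k r"
  obtains g where "potential G P g"
proof -
  \<comment> \<open>A real power spreads the factor \<open>P s\<close> evenly over the vertices of
    one turn.\<close>
  define g where "g v = (case v of Blk s j \<Rightarrow> P s powr (j / strlen G s)
     | Wht s j \<Rightarrow> P s powr (j / strlen G s) | _ \<Rightarrow> 1)" for v
  have P: "P s > 0" for s using st by (auto simp: state_def)
  have "P s powr (real_of_int (j + int (strlen G s)) / strlen G s) = P s * P s powr (j / strlen G s)"
    if "s \<in> {1..loops G}" for s j
    using P[of s] strlen_pos[OF that] by (simp add: add_divide_distrib powr_add)
  then have "potential G P g" using P by (auto simp: potential_def bd_one_def g_def less_imp_neq[symmetric] split: vertex.split)
  then show ?thesis by (rule that)
qed

lemma potential_pos: "potential G P g \<Longrightarrow> g v > 0" and potential_bd: "potential G P g \<Longrightarrow> bd_one g"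
  by (auto simp: potential_def)

lemma (in cyl) ex_weighting:
  assumes st: "state G P l k r"
  obtains g E where "potential G P g" "gauge_equiv G g (flat l k r) E" "edge_weighting G E"
proof -
  obtain g where g: "potential G P g" using ex_potential[OF st] .
  have "gauge_equiv G g (flat l k r) (bend G (flat l k r) g)" using potential_pos[OF g] by (rule gauge_bend)
  with gauge_flat_weighting[OF st g] g that show ?thesis by blast
qed

text \<open>Constant on each string: the prefix products make edges between strings \<open>s\<close>
  and \<open>s + 1\<close> scale by \<open>c s\<close>. The value at the right boundary is the
  factor that every trail picks up.\<close>

definition scaling :: "cyl_graph \<Rightarrow> (nat \<Rightarrow> real) \<Rightarrow> real \<Rightarrow> vertex \<Rightarrow> real" where
  "scaling G c d v = (case v of Bdl j \<Rightarrow> 1 | Blk s j \<Rightarrow> \<Prod>i<s. c i | Wht s j \<Rightarrow> \<Prod>i<s. c i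
     | Bdr j \<Rightarrow> (\<Prod>i<loops G. c i) * d)"

lemma gauge_scaling:
  assumes "\<And>i. c i > 0" "d > 0"
    and "\<And>j. l' j = c 0 * l j" "\<And>s i. s \<in> {1..<loops G} \<Longrightarrow> k' s i = c s * k s i" "\<And>j. r' j = d * r j"
  shows "gauge_equiv G (scaling G c d) (flat l k r) (flat l' k' r')"
  unfolding gauge_equiv_def
proof (intro conjI allI impI)
  have pos: "(\<Prod>i<s. c i) > 0" for s using assms by (intro prod_pos) auto
  then have nz: "(\<Prod>i<s. c i) \<noteq> 0" for s using less_irrefl by metis
  show "scaling G c d v > 0" for v using assms(2) pos by (auto simp: scaling_def split: vertex.split)
  fix e assume "edges G e"
  then show "flat l' k' r' e = flat l k r e * scaling G c d (tgt G e) / scaling G c d (src G e)"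
    using assms nz by (cases e) (auto simp: scaling_def One_nat_def)
qed

text \<open>Ratios of successive entries fix each sequence up to a constant, and the trail fixes the
  product of the constants. Proportional sequences have equal multipliers, which gives equality of
  \<open>P'\<close> and \<open>P\<close> string by string from the left.\<close>

lemma (in cyl) same_weights_flatD:
  assumes \<tau>: "trail G \<tau>" and st: "state G P l k r" and st': "state G P' l' k' r'"
    and eq: "same_weights G \<tau> (flat l k r) (flat l' k' r')"
  obtains c d where "\<And>i. c i > 0" "d > 0" "\<And>j. l' j = c 0 * l j"
    "\<And>s i. s \<in> {1..<loops G} \<Longrightarrow> k' s i = c s * k s i" "\<And>j. r' j = d * r j"
    "(\<Prod>i<loops G. c i) * d = 1" "\<And>s. s \<in> {1..loops G} \<Longrightarrow> P' s = P s"
proof -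
  have l: "mult_per (strlen G 1) (1 / P 1) l" "mult_per (strlen G 1) (1 / P' 1) l'"
    and r: "mult_per (strlen G (loops G)) (P (loops G)) r" "mult_per (strlen G (loops G)) (P' (loops G)) r'"
    and k: "\<And>s. s \<in> {1..<loops G} \<Longrightarrow> mult_per (ncr G s) (P s / P (s + 1)) (k s)"
      "\<And>s. s \<in> {1..<loops G} \<Longrightarrow> mult_per (ncr G s) (P' s / P' (s + 1)) (k' s)"
    and P: "\<And>s. P s > 0" "\<And>s. P' s > 0"
    using st st' unfolding state_def by blast+
  have "l (j + 1) / l j = l' (j + 1) / l' j" "r (j + 1) / r j = r' (j + 1) / r' j" for j
    using eq unfolding same_weights_def walk_weight_flat_faces by blast+
  note eqs = this
  obtain c0 where c0: "c0 > 0" "\<And>j. l' j = c0 * l j"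
    by (rule ratio_determines[where f = l and g = l', OF mult_perD(1)[OF l(1)] mult_perD(1)[OF l(2)] eqs(1)]) (rule that)
  obtain d where d: "d > 0" "\<And>j. r' j = d * r j"
    by (rule ratio_determines[where f = r and g = r', OF mult_perD(1)[OF r(1)] mult_perD(1)[OF r(2)] eqs(2)]) (rule that)
  have "\<forall>s\<in>{1..<loops G}. \<exists>a. a > 0 \<and> (\<forall>i. k' s i = a * k s i)"
  proof
    fix s assume s: "s \<in> {1..<loops G}"
    have "k s (j + 1) / k s j = k' s (j + 1) / k' s j" for j
    proof -
      have "walk_weight (flat l k r) (face_mid G s (j + 1)) = walk_weight (flat l' k' r') (face_mid G s (j + 1))"
        using eq s unfolding same_weights_def by blast
      then show ?thesis by (simp add: walk_weight_flat_faces)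
    qed
    then obtain a where "a > 0" "\<And>j. k' s j = a * k s j"
      by (rule ratio_determines[where f = "k s" and g = "k' s", OF mult_perD(1)[OF k(1)[OF s]] mult_perD(1)[OF k(2)[OF s]]])
        (rule that)
    then show "\<exists>a. a > 0 \<and> (\<forall>i. k' s i = a * k s i)" by blast
  qed
  then obtain c' where c': "\<And>s. s \<in> {1..<loops G} \<Longrightarrow> c' s > 0 \<and> (\<forall>i. k' s i = c' s * k s i)"
    using bchoice[of "{1..<loops G}" "\<lambda>s a. a > 0 \<and> (\<forall>i. k' s i = a * k s i)"] by blast
  define c where "c s = (if s = 0 then c0 else if s \<in> {1..<loops G} then c' s else 1)" for s
  have c: "\<And>i. c i > 0" "\<And>j. l' j = c 0 * l j" "\<And>s i. s \<in> {1..<loops G} \<Longrightarrow> k' s i = c s * k s i"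
    using c0 c' by (auto simp: c_def)
  have ga: "gauge_equiv G (scaling G c d) (flat l k r) (flat l' k' r')"
    using c d by (intro gauge_scaling) auto
  obtain i j where w: "walk G (Bdl i) \<tau> (Bdr j)" using \<tau> by (auto simp: trail_def)
  have "walk_weight (flat l k r) \<tau> \<noteq> 0"
  proof -
    have "flat l k r e > 0" if "edges G e" for e
      using that mult_perD(1)[OF l(1)] mult_perD(1)[OF r(1)] mult_perD(1)[OF k(1)] by (cases e) auto
    from walk_weight_pos[of G "flat l k r", OF this w] show ?thesis by simp
  qed
  then have p: "(\<Prod>i<loops G. c i) * d = 1"
    using walk_weight_gauge[OF ga w] eq by (auto simp: same_weights_def scaling_def)
  have "P' s = P s" if "s \<ge> 1" "s \<le> loops G" for s
    using that
  proof (induction s rule: nat_induct_at_least)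
    case base
    have "1 / P' 1 = 1 / P 1" by (rule mult_per_unique[OF l c(2)])
    then show ?case using P(1)[of 1] P(2)[of 1] by simp
  next
    case (Suc s)
    have s: "s \<in> {1..<loops G}" using Suc by auto
    have "P' s / P' (s + 1) = P s / P (s + 1)" by (rule mult_per_unique[OF k(1)[OF s] k(2)[OF s] c(3)[OF s]])
    then have "P' s / P' (Suc s) = P s / P (Suc s)" by (simp only: Suc_eq_plus1)
    then show ?case
      using Suc P(1)[of s] P(1)[of "Suc s"] P(2)[of "Suc s"] by (simp add: field_simps)
  qed
  then show ?thesis using that[OF c(1) d(1) c(2,3) d(2) p] by auto
qed

text \<open>Face and trail weights determine the edge weights up to gauge: the constants by which
  two flat forms differ are absorbed into the second potential, and the trail makes this potential 1
  at the right boundary.\<close>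

lemma (in cyl) common_flat:
  assumes \<tau>: "trail G \<tau>" and E: "edge_weighting G E" "edge_weighting G E'" and eq: "same_weights G \<tau> E E'"
  obtains P l k r g g' where "state G P l k r" "potential G P g" "gauge_equiv G g (flat l k r) E"
    "potential G P g'" "gauge_equiv G g' (flat l k r) E'"
proof -
  obtain P l k r g where 1: "state G P l k r" "potential G P g" "gauge_equiv G g (flat l k r) E"
    using ex_flat[OF E(1)] .
  obtain P' l' k' r' g' where 2: "state G P' l' k' r'" "potential G P' g'" "gauge_equiv G g' (flat l' k' r') E'"
    using ex_flat[OF E(2)] .
  have "same_weights G \<tau> (flat l k r) (flat l' k' r')"
    using same_weights_gauge[OF 1(3) potential_bd[OF 1(2)] \<tau>] same_weights_gauge[OF 2(3) potential_bd[OF 2(2)] \<tau>] eq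
    by (auto simp: same_weights_def)
  then obtain c d where c: "\<And>i. c i > 0" "d > 0" "\<And>j. l' j = c 0 * l j"
    "\<And>s i. s \<in> {1..<loops G} \<Longrightarrow> k' s i = c s * k s i" "\<And>j. r' j = d * r j"
    "(\<Prod>i<loops G. c i) * d = 1" "\<And>s. s \<in> {1..loops G} \<Longrightarrow> P' s = P s"
    using same_weights_flatD[OF \<tau> 1(1) 2(1)] by blast
  have ga: "gauge_equiv G (scaling G c d) (flat l k r) (flat l' k' r')"
    using c by (intro gauge_scaling) auto
  have "potential G P (\<lambda>v. scaling G c d v * g' v)"
    using ga 2(2) c(6,7) by (auto simp: potential_def gauge_equiv_def bd_one_def scaling_def)
  then show ?thesis using that[OF 1] gauge_trans[OF ga 2(3)] by blast
qed

section \<open>The move in the flat gauge\<close>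

definition mv_l :: "cyl_graph \<Rightarrow> nat \<Rightarrow> (nat \<Rightarrow> int \<Rightarrow> real) \<Rightarrow> (int \<Rightarrow> real) \<Rightarrow> int \<Rightarrow> real" where
  "mv_l G s k l j = (if s = 1 then l j * win (ncr G s) (k s) (first_ge (lft G s) j) else l j)"

definition mv_r :: "cyl_graph \<Rightarrow> nat \<Rightarrow> (nat \<Rightarrow> int \<Rightarrow> real) \<Rightarrow> (int \<Rightarrow> real) \<Rightarrow> int \<Rightarrow> real" where
  "mv_r G s k r j = (if s + 1 = loops G then r j * win (ncr G s) (k s) (first_ge (rgt G s) (j + 1)) else r j)"

text \<open>For strings \<open>s\<close> and \<open>s + 1\<close>, an edge from string
  \<open>s - 1\<close> acts as a source and an edge to string \<open>s + 2\<close> as a sink. The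
  former reaches the crossing edges from \<open>first_ge (lft G s) j\<close> on, the latter those
  below \<open>first_ge (rgt G s) (j + 1)\<close>; the values of \<open>win\<close> at these ends
  compensate the denominators in \<open>sum_flip\<close>.\<close>

definition mv_k :: "cyl_graph \<Rightarrow> nat \<Rightarrow> (nat \<Rightarrow> int \<Rightarrow> real) \<Rightarrow> nat \<Rightarrow> int \<Rightarrow> real" where
  "mv_k G s k q i = (if q = s then flip (ncr G s) (k s) i
     else if q = s + 1 then k q i * win (ncr G s) (k s) (first_ge (rgt G s) (lft G q i + 1))
     else if q + 1 = s then k q i * win (ncr G s) (k s) (first_ge (lft G s) (rgt G q i))
     else k q i)"

text \<open>\<open>mv_l\<close>, \<open>mv_k\<close>, \<open>mv_r\<close> describe \<open>T\<^sub>f\<close> on strings \<open>s\<close> and \<open>s + 1\<close> in the flat gauge; the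
  potential that restores the weights of the untouched edges changes by \<open>mv_g\<close>.\<close>

definition mv_g :: "cyl_graph \<Rightarrow> nat \<Rightarrow> (nat \<Rightarrow> int \<Rightarrow> real) \<Rightarrow> vertex \<Rightarrow> real" where
  "mv_g G s k v =
     (let low = (\<lambda>j. 1 / win (ncr G s) (k s) (first_ge (lft G s) j));
          high = (\<lambda>j. win (ncr G s) (k s) (first_ge (rgt G s) (j + 1)));
          w = (\<lambda>q j. if q = s then low j else if q = s + 1 then high j else 1)
      in case v of Blk q j \<Rightarrow> w q j | Wht q j \<Rightarrow> w q j | _ \<Rightarrow> 1)"

definition swap_P :: "nat \<Rightarrow> (nat \<Rightarrow> real) \<Rightarrow> nat \<Rightarrow> real" where
  "swap_P s P = P(s := P (s + 1), s + 1 := P s)"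

context cyl
begin

text \<open>\<open>win\<close> has multiplier \<open>P s / P (s + 1)\<close> and \<open>flip\<close>
  the inverse one, which is how exchanging \<open>P s\<close> and \<open>P (s + 1)\<close> affects
  the quasi-periods.\<close>

lemma state_mv:
  assumes s: "s \<in> {1..<loops G}" and st: "state G P l k r"
  shows "state G (swap_P s P) (mv_l G s k l) (mv_k G s k) (mv_r G s k r)"
proof -
  interpret L: staircase "lft G s" "ncr G s" "strlen G s" by (rule staircase_lft[OF s])
  interpret R: staircase "rgt G s" "ncr G s" "strlen G (s + 1)" by (rule staircase_rgt[OF s])
  have P: "P q > 0" "P q \<noteq> 0" for q using st less_irrefl unfolding state_def by metis+
  have k: "\<And>q. q \<in> {1..<loops G} \<Longrightarrow> mult_per (ncr G q) (P q / P (q + 1)) (k q)"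
    and l: "mult_per (strlen G 1) (1 / P 1) l" and r: "mult_per (strlen G (loops G)) (P (loops G)) r"
    using st by (auto simp: state_def)
  have w: "mult_per (ncr G s) (P s / P (s + 1)) (win (ncr G s) (k s))"
    by (rule mult_per_win[OF k[OF s] ncr_pos[OF s]])
  have low: "mult_per (strlen G s) (P s / P (s + 1)) (\<lambda>j. win (ncr G s) (k s) (first_ge (lft G s) j))"
    by (rule mult_per_compose[OF w]) (rule L.first_ge_period)
  have high: "mult_per (strlen G (s + 1)) (P s / P (s + 1)) (\<lambda>j. win (ncr G s) (k s) (first_ge (rgt G s) (j + 1)))"
    by (rule mult_per_compose[OF w]) (use R.first_ge_period[of "_ + 1"] in \<open>simp add: algebra_simps\<close>)
  have lr: "lft G q (i + int (ncr G q)) = lft G q i + int (strlen G q)"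
    "rgt G q (i + int (ncr G q)) = rgt G q i + int (strlen G (q + 1))" if "q \<in> {1..<loops G}" for q i
    using layer[OF that] by (auto simp: layer_ok_def)
  have cast: "mult_per n c f \<Longrightarrow> c = c' \<Longrightarrow> (\<And>i. f i = f' i) \<Longrightarrow> mult_per n c' f'" for n c c' f f'
    by (simp add: mult_per_def)
  show ?thesis unfolding state_def
  proof (intro conjI allI ballI)
    show "swap_P s P q > 0" for q using P by (simp add: swap_P_def)
    show "mult_per (strlen G 1) (1 / swap_P s P 1) (mv_l G s k l)"
    proof (cases "s = 1")
      case True
      show ?thesis
        by (rule cast[OF mult_per_mult[OF l low[unfolded True]]]) (use P(2) True in \<open>auto simp: mv_l_def swap_P_def\<close>)
    next
      case False
      then show ?thesis using s by (intro cast[OF l]) (auto simp: mv_l_def swap_P_def)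
    qed
    show "mult_per (strlen G (loops G)) (swap_P s P (loops G)) (mv_r G s k r)"
    proof (cases "s + 1 = loops G")
      case True
      show ?thesis
        by (rule cast[OF mult_per_mult[OF r high[unfolded True]]]) (use P(2) True in \<open>auto simp: mv_r_def swap_P_def\<close>)
    next
      case False
      then show ?thesis using s by (intro cast[OF r]) (auto simp: mv_r_def swap_P_def)
    qed
    fix q assume q: "q \<in> {1..<loops G}"
    consider "q = s" | "q = s + 1" | "q + 1 = s" | "q \<noteq> s" "q \<noteq> s + 1" "q + 1 \<noteq> s" by blast
    then show "mult_per (ncr G q) (swap_P s P q / swap_P s P (q + 1)) (mv_k G s k q)"
    proof cases
      case 1
      show ?thesis unfolding 1
        by (rule cast[OF mult_per_flip[OF k[OF s] ncr_pos[OF s]]]) (auto simp: mv_k_def swap_P_def)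
    next
      case 2
      have "mult_per (ncr G q) (P s / P (s + 1)) (\<lambda>i. win (ncr G s) (k s) (first_ge (rgt G s) (lft G q i + 1)))"
        by (rule mult_per_compose[OF high]) (use lr[OF q] 2 in auto)
      from cast[OF mult_per_mult[OF k[OF q] this]] show ?thesis
        using 2 P(2) by (auto simp: mv_k_def swap_P_def)
    next
      case 3
      have "mult_per (ncr G q) (P s / P (s + 1)) (\<lambda>i. win (ncr G s) (k s) (first_ge (lft G s) (rgt G q i)))"
        by (rule mult_per_compose[OF low]) (use lr[OF q] 3 in auto)
      from cast[OF mult_per_mult[OF k[OF q] this]] show ?thesis
        using 3 P(2) by (auto simp: mv_k_def swap_P_def)
    next
      case 4
      then show ?thesis by (intro cast[OF k[OF q]]) (auto simp: mv_k_def swap_P_def)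
    qed
  qed
qed

lemma potential_mv:
  assumes s: "s \<in> {1..<loops G}" and st: "state G P l k r" and pot: "potential G P g"
  shows "potential G (swap_P s P) (\<lambda>v. g v * mv_g G s k v)"
proof -
  interpret L: staircase "lft G s" "ncr G s" "strlen G s" by (rule staircase_lft[OF s])
  interpret R: staircase "rgt G s" "ncr G s" "strlen G (s + 1)" by (rule staircase_rgt[OF s])
  have P: "P q > 0" "P q \<noteq> 0" for q using st less_irrefl unfolding state_def by metis+
  have "mult_per (ncr G s) (P s / P (s + 1)) (k s)" using st s by (auto simp: state_def)
  then have w: "mult_per (ncr G s) (P s / P (s + 1)) (win (ncr G s) (k s))"
    by (rule mult_per_win[OF _ ncr_pos[OF s]])
  have "first_ge (rgt G s) (j + int (strlen G (s + 1)) + 1) = first_ge (rgt G s) (j + 1) + int (ncr G s)" for j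
    using R.first_ge_period[of "j + 1"] by (simp add: algebra_simps)
  then show ?thesis
    using pot P(2) mult_perD(1)[OF w]
    by (auto simp: potential_def bd_one_def mv_g_def Let_def swap_P_def L.first_ge_period mult_perD(3)[OF w]
        split: vertex.split)
qed

text \<open>On an edge entering or leaving the two strings, the window factor in
  \<open>mv_l\<close>, \<open>mv_k\<close> or \<open>mv_r\<close> cancels against that of
  \<open>mv_g\<close>.\<close>

lemma gauge_mv_outside:
  assumes s: "s \<in> {1..<loops G}" and st: "state G P l k r" and ga: "gauge_equiv G g (flat l k r) E"
    and ga': "gauge_equiv G (\<lambda>v. g v * mv_g G s k v) (flat (mv_l G s k l) (mv_k G s k) (mv_r G s k r)) E'"
    and e: "edges G e" "\<not> in_sub s e"
  shows "E' e = E e"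
proof -
  have "mult_per (ncr G s) (P s / P (s + 1)) (k s)" using st s by (auto simp: state_def)
  note w = mult_perD(2)[OF mult_per_win[OF this ncr_pos[OF s]]]
  show ?thesis
    using ga ga' e s w by (cases e) (auto simp: gauge_equiv_def mv_g_def mv_l_def mv_r_def mv_k_def Let_def)
qed

end

section \<open>Comparison with the face weighted R-matrix\<close>

lemma prod_ratio:
  fixes u v :: int
  assumes "\<And>i. F i \<noteq> (0::real)" and "u \<le> v"
  shows "(\<Prod>i\<in>{u..<v}. F i / F (i - 1)) = F (v - 1) / F (u - 1)"
  using assms(2)
proof (induction v rule: int_ge_induct)
  case base
  then show ?case using assms(1) by simp
next
  case (step v)
  have "{u..<v + 1} = insert v {u..<v}" using step by auto
  then show ?case using step assms(1)[of "v - 1"] by simp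
qed

locale cyl2 = cyl + assumes loops2: "loops G = 2"
begin

abbreviation "N1 \<equiv> strlen G 1"
abbreviation "N2 \<equiv> strlen G 2"
abbreviation "n \<equiv> ncr G 1"
abbreviation "f \<equiv> lft G 1"
abbreviation "h \<equiv> rgt G 1"

lemma layer1: "(1::nat) \<in> {1..<loops G}"
  using loops2 by simp

sublocale L: staircase f n N1
  by (rule staircase_lft[OF layer1])

sublocale R: staircase h n N2
  using staircase_rgt[OF layer1] by simp

text \<open>The trail uses the lowest crossing edge at its white vertex and the highest one at its
  black vertex. This makes the window factors at 0 and 1 cancel along the trail.\<close>

lemma first_ge_trail: "first_ge f (f 0) = 0" "first_ge h (h 0 + 1) = 1"
proof -
  have *: "f (-1) \<noteq> f 0" "h 1 \<noteq> h 0" using layer[OF layer1] by (auto simp: layer_ok_def)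
  show "first_ge f (f 0) = 0" by (rule L.first_ge_eqI) (use * in auto)
  show "first_ge h (h 0 + 1) = 1" by (rule R.first_ge_eqI) (use * R.incr[of 0] in auto)
qed

lemma assoc_a_iff: "assoc_a G j i \<longleftrightarrow> f i \<noteq> f (i - 1) \<and> f (i - 1) = j"
  by (auto simp: assoc_a_def face_mid_def)

lemma assoc_b_iff: "assoc_b G j i \<longleftrightarrow> h i \<noteq> h (i - 1) \<and> h (i - 1) = j"
  by (auto simp: assoc_b_def face_mid_def)

lemma index_a_eq: "index_a G j = first_ge f (j + 1)"
  unfolding index_a_def by (rule the_equality) (auto simp: assoc_a_iff L.changes_iff)

lemma index_b_eq: "index_b G j = first_ge h (j + 1)"
  unfolding index_b_def by (rule the_equality) (auto simp: assoc_b_iff R.changes_iff)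

text \<open>At most one left face is associated to \<open>i\<close>, because \<open>f\<close> grows
  by at most 1 per step.\<close>

lemma prod_assoc_a:
  assumes "\<And>j. l j \<noteq> (0::real)"
  shows "(\<Prod>j | assoc_a G j i. l (j + 1) / l j) = l (f i) / l (f (i - 1))"
proof (cases "f i = f (i - 1)")
  case True
  then have "{j. assoc_a G j i} = {}" by (auto simp: assoc_a_iff)
  then show ?thesis using True assms by (simp add: assoc_a_iff)
next
  case False
  then have "{j. assoc_a G j i} = {f (i - 1)}" "f i = f (i - 1) + 1"
    using L.incr[of "i - 1"] by (auto simp: assoc_a_iff)
  then show ?thesis by simp
qed

lemma prod_assoc_b:
  assumes "\<And>j. r j \<noteq> (0::real)"
  shows "(\<Prod>j | assoc_b G j i. r (j + 1) / r j) = r (h i) / r (h (i - 1))"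
proof (cases "h i = h (i - 1)")
  case True
  then have "{j. assoc_b G j i} = {}" by (auto simp: assoc_b_iff)
  then show ?thesis using True assms by (simp add: assoc_b_iff)
next
  case False
  then have "{j. assoc_b G j i} = {h (i - 1)}" "h i = h (i - 1) + 1"
    using R.incr[of "i - 1"] by (auto simp: assoc_b_iff)
  then show ?thesis by simp
qed

lemma prod_a_eq:
  assumes "\<And>j. l j \<noteq> (0::real)" "u \<le> v"
  shows "prod_a G (\<lambda>j. l (j + 1) / l j) {u..<v} = l (f (v - 1)) / l (f (u - 1))"
  unfolding prod_a_def prod_assoc_a[where l = l, OF assms(1)]
  by (rule prod_ratio[where F = "\<lambda>i. l (f i)"]) (use assms in auto)

lemma prod_b_eq:
  assumes "\<And>j. r j \<noteq> (0::real)" "u \<le> v"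
  shows "prod_b G (\<lambda>j. r (j + 1) / r j) {u..<v} = r (h (v - 1)) / r (h (u - 1))"
  unfolding prod_b_def prod_assoc_b[where r = r, OF assms(1)]
  by (rule prod_ratio[where F = "\<lambda>i. r (h i)"]) (use assms in auto)

lemma state2:
  assumes "state G P l k r"
  shows "mult_per N1 (1 / P 1) l" "mult_per n (P 1 / P 2) (k 1)" "mult_per N2 (P 2) r" "P s > 0"
proof -
  have *: "1 + 1 = (2::nat)" by simp
  show "mult_per N1 (1 / P 1) l" "mult_per n (P 1 / P 2) (k 1)" "mult_per N2 (P 2) r" "P s > 0"
    using assms layer1 unfolding state_def loops2 by (blast, metis *, blast, blast)
qed

text \<open>The expanded weights are \<open>x i = l (f (i - 1)) / l (f i)\<close>,
  \<open>y i = r (h i) / r (h (i - 1))\<close> and \<open>z i = l (f i) * k 1 i * r (h i)\<close>.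
  Along each path \<open>l\<close> and \<open>r\<close> telescope to end factors common to all
  paths, which leaves \<open>k 1 j\<close>; \<open>P 2\<close> appears because the paths end one
  period higher on the right string.\<close>

lemma lam_hat_flat:
  assumes st: "state G P l k r"
  shows "lam_hat G (face_trail2 G (flat l k r)) i = P 2 * l (f i) * r (h (i - 1)) * win n (k 1) i"
proof -
  define a b c t where "a = (\<lambda>j. l (j + 1) / l j)" and "b = (\<lambda>j. r (j + 1) / r j)"
    and "c = (\<lambda>i. k 1 i / k 1 (i - 1))" and "t = l (f 0) * k 1 0 * r (h 0)"
  have w: "face_trail2 G (flat l k r) = (a, b, c, t)"
    by (simp add: face_trail2_flat a_def b_def c_def t_def)
  note l = mult_perD[OF state2(1)[OF st]] and k = mult_perD[OF state2(2)[OF st]]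
    and r = mult_perD[OF state2(3)[OF st]] and P = state2(4)[OF st]
  have nz: "P 1 \<noteq> 0" "P 2 \<noteq> 0" using P less_irrefl by metis+
  have n: "int n > 0" using L.n_pos by simp
  have x: "xw G a i = l (f (i - 1)) / l (f i)" for i
  proof -
    have "xw G a i = inverse (\<Prod>j | assoc_a G j i. a j)"
      unfolding xw_def by (rule prod_inversef[unfolded comp_def])
    then show ?thesis unfolding a_def prod_assoc_a[where l = l, OF l(2)] by simp
  qed
  have y: "yw G b i = r (h i) / r (h (i - 1))" for i
    unfolding yw_def b_def by (rule prod_assoc_b) (rule r(2))
  define m where "m i = l (f i) * k 1 i * r (h i)" for i
  have m_per: "m (i + int n) = m i" for i
    using nz by (simp add: m_def L.period R.period l(3) k(3) r(3))
  \<comment> \<open>\<open>zw\<close> is defined through \<open>i mod n\<close>; periodicity removes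
    this reduction.\<close>
  have m_per': "m (i + int n * q) = m i" for i q
  proof (induction q rule: int_induct[of _ 0])
    case (step1 q)
    then show ?case using m_per[of "i + int n * q"] by (simp add: algebra_simps)
  next
    case (step2 q)
    then show ?case using m_per[of "i + int n * (q - 1)"] by (simp add: algebra_simps)
  qed simp
  have z: "zw G (a, b, c, t) i = m i" for i
  proof -
    define q where "q = i mod int n"
    have q: "q \<ge> 0" using n by (simp add: q_def)
    have iv: "{1..q} = {1..<q + 1}" by auto
    have "(\<Prod>j\<in>{1..<q + 1}. c j) = k 1 q / k 1 0"
      unfolding c_def using prod_ratio[of "k 1" 1 "q + 1"] k(2) q by simp
    then have "zw G (a, b, c, t) i = m q"
      using prod_a_eq[of l 1 "q + 1"] prod_b_eq[of r 1 "q + 1"] l(2) k(2) r(2) q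
      by (simp add: Let_def q_def[symmetric] iv a_def[symmetric] b_def[symmetric] m_def t_def)
    also have "m q = m i" using m_per'[of q "i div int n"] by (simp add: q_def)
    finally show ?thesis .
  qed
  have "lam_hat G (a, b, c, t) i = (\<Sum>j\<in>{i..<i + int n}. P 2 * l (f i) * r (h (i - 1)) * k 1 j)"
    unfolding lam_hat.simps lam_def
  proof (rule sum.cong)
    show "{i..i + int n - 1} = {i..<i + int n}" by auto
    fix j assume j: "j \<in> {i..<i + int n}"
    have X: "(\<Prod>k\<in>{i + 1..j}. xw G a k) = l (f i) / l (f j)"
    proof -
      have iv: "{i + 1..j} = {i + 1..<j + 1}" by auto
      show ?thesis unfolding iv
        using prod_ratio[of "\<lambda>i. 1 / l (f i)" "i + 1" "j + 1"] j l(2) by (simp add: x)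
    qed
    have Y: "(\<Prod>k\<in>{j + 1..i + int n - 1}. yw G b k) = P 2 * r (h (i - 1)) / r (h j)"
    proof -
      have iv: "{j + 1..i + int n - 1} = {j + 1..<i + int n}" by auto
      have "h (i + int n - 1) = h (i - 1) + int N2" using R.period[of "i - 1"] by (simp add: algebra_simps)
      then show ?thesis unfolding iv
        using prod_ratio[of "\<lambda>i. r (h i)" "j + 1" "i + int n"] j r(2,3) by (simp add: y)
    qed
    show "(\<Prod>k\<in>{i + 1..j}. xw G a k) * zw G (a, b, c, t) j * (\<Prod>k\<in>{j + 1..i + int n - 1}. yw G b k)
        = P 2 * l (f i) * r (h (i - 1)) * k 1 j"
      unfolding X Y z m_def using l(2) r(2) by simp
  qed
  then show ?thesis by (simp add: w win_def sum_distrib_left)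
qed

lemma mv2:
  "mv_l G 1 k l j = l j * win n (k 1) (first_ge f j)"
  "mv_k G 1 k 1 = flip n (k 1)"
  "mv_r G 1 k r j = r j * win n (k 1) (first_ge h (j + 1))"
  using loops2 by (auto simp: mv_l_def mv_k_def mv_r_def)

text \<open>In the formula for \<open>c'\<close>, the factors \<open>l\<close> and \<open>r\<close>
  of \<open>lam_hat\<close> cancel against the products over associated faces, leaving
  \<open>W (i - 1) / W (i + 1)\<close> for \<open>W = win n (k 1)\<close>, the effect of
  \<open>flip\<close> on a ratio of successive entries. For \<open>a'\<close> and \<open>b'\<close>
  only one of the two factors cancels, and the other gives the old face ratio.\<close>

lemma Tf_flat:
  assumes st: "state G P l k r"
  shows "Tf G (face_trail2 G (flat l k r)) = face_trail2 G (flat (mv_l G 1 k l) (mv_k G 1 k) (mv_r G 1 k r))"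
proof -
  define a b c t where "a = (\<lambda>j. l (j + 1) / l j)" and "b = (\<lambda>j. r (j + 1) / r j)"
    and "c = (\<lambda>i. k 1 i / k 1 (i - 1))" and "t = l (f 0) * k 1 0 * r (h 0)"
  have w: "face_trail2 G (flat l k r) = (a, b, c, t)"
    by (simp add: face_trail2_flat a_def b_def c_def t_def)
  define lam where "lam = lam_hat G (a, b, c, t)"
  have lam: "lam i = P 2 * l (f i) * r (h (i - 1)) * win n (k 1) i" for i
    using lam_hat_flat[OF st] by (simp add: lam_def w)
  note l = mult_perD[OF state2(1)[OF st]] and k = mult_perD[OF state2(2)[OF st]]
    and r = mult_perD[OF state2(3)[OF st]] and P = state2(4)[OF st]
  note win = mult_perD(2)[OF mult_per_win[OF state2(2)[OF st] L.n_pos]]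
  have nz: "P 2 \<noteq> 0" using P less_irrefl by metis
  have pa: "u \<le> v \<Longrightarrow> prod_a G a {u..<v} = l (f (v - 1)) / l (f (u - 1))" for u v
    unfolding a_def by (rule prod_a_eq[OF l(2)])
  have pb: "u \<le> v \<Longrightarrow> prod_b G b {u..<v} = r (h (v - 1)) / r (h (u - 1))" for u v
    unfolding b_def by (rule prod_b_eq[OF r(2)])
  have A: "lam (index_a G i) / (lam (index_a G (i - 1)) * prod_b G b {index_a G (i - 1)..<index_a G i})
      = mv_l G 1 k l (i + 1) / mv_l G 1 k l i" for i
    using L.first_ge_mono[of i "i + 1"] nz l(2) r(2)
    by (simp add: index_a_eq lam pb mv2 L.f_first_ge)
  have B: "lam (index_b G (i + 1)) / (lam (index_b G i) * prod_a G a {index_b G i<..index_b G (i + 1)})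
      = mv_r G 1 k r (i + 1) / mv_r G 1 k r i" for i
  proof -
    have iv: "{u<..v} = {u + 1..<v + 1}" for u v :: int by auto
    show ?thesis unfolding iv
      using R.first_ge_mono[of "i + 1" "i + 1 + 1"] nz l(2) r(2)
      using win by (simp add: index_b_eq lam pa mv2 R.f_before_first_ge add.commute)
  qed
  have C: "c i * lam (i - 1) * prod_a G a {i..i + 1} * prod_b G b {i - 1..i} / lam (i + 1)
      = mv_k G 1 k 1 i / mv_k G 1 k 1 (i - 1)" for i
  proof -
    have iv: "{i..i + 1} = {i..<i + 2}" "{i - 1..i} = {i - 1..<i + 1}" by auto
    show ?thesis unfolding iv
      using nz l(2) r(2) k(2) win
      by (simp add: lam pa pb mv2 flip_def c_def add.commute)
  qed
  have D: "t = mv_l G 1 k l (f 0) * mv_k G 1 k 1 0 * mv_r G 1 k r (h 0)"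
    using win by (simp add: mv2 first_ge_trail flip_def t_def)
  show ?thesis
    unfolding w Tf.simps lam_def[symmetric] Let_def A B C D[symmetric] unfolding face_trail2_flat
    using D by simp
qed

text \<open>With \<open>c = P 1 / P 2\<close>, two moves divide \<open>l\<close> and
  \<open>r\<close> by \<open>c\<close> and multiply \<open>k 1\<close> by \<open>c^2\<close>, which
  neither face ratios nor the trail product can see.\<close>

lemma Tf_Tf_flat:
  assumes st: "state G P l k r"
  shows "Tf G (Tf G (face_trail2 G (flat l k r))) = face_trail2 G (flat l k r)"
proof -
  note st' = state_mv[OF layer1 st]
  note k = state2(2)[OF st]
  note win = mult_perD(2)[OF mult_per_win[OF k L.n_pos]]
  have c: "P 1 / P 2 > 0" "P 1 / P 2 \<noteq> 0" using mult_per_pos[OF k] by auto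
  have 1: "mv_l G 1 (mv_k G 1 k) (mv_l G 1 k l) j = l j / (P 1 / P 2)" for j
    using win by (simp add: mv2 win_flip[OF k L.n_pos])
  have 2: "mv_r G 1 (mv_k G 1 k) (mv_r G 1 k r) j = r j / (P 1 / P 2)" for j
    using win by (simp add: mv2 win_flip[OF k L.n_pos])
  have 3: "mv_k G 1 (mv_k G 1 k) 1 i = k 1 i * (P 1 / P 2)^2" for i
    using win c by (simp add: mv2 flip_def[of n "flip n (k 1)"] win_flip[OF k L.n_pos])
      (simp add: flip_def power2_eq_square)
  show ?thesis
    unfolding Tf_flat[OF st] Tf_flat[OF st'] unfolding face_trail2_flat 1 2 3
    using c by (simp add: power2_eq_square)
qed

lemma same_weights2: "same_weights G (trail2 G) E E' \<longleftrightarrow> face_trail2 G E = face_trail2 G E'"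
  by (rule same_weights_loops2[OF loops2])

lemma trail2: "trail G (trail2 G)"
  using loops2 by (auto simp: trail_def trail2_def)

section \<open>Face and trail weights realized by flat weightings\<close>

lemma ex_state:
  assumes w: "face_trail_weights2 G w"
  obtains P l k r where "state G P l k r" "face_trail2 G (flat l k r) = w"
proof -
  obtain a b c t where wabc: "w = (a, b, c, t)" by (cases w)
  have a: "cyc_pos N1 a" and b: "cyc_pos N2 b" and c: "cyc_pos n c" and t: "t > 0"
    and one: "(\<Prod>j<N1. a (int j)) * (\<Prod>j<N2. b (int j)) * (\<Prod>i<n. c (int i)) = 1"
    using w by (auto simp: wabc)
  obtain l where l: "\<And>j. l (j + 1) = l j * a j" "mult_per N1 (\<Prod>j<N1. a (int j)) l"
    by (rule ex_mult_primitive[OF a L.N_pos]) (rule that)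
  obtain r where r: "\<And>j. r (j + 1) = r j * b j" "mult_per N2 (\<Prod>j<N2. b (int j)) r"
    by (rule ex_mult_primitive[OF b R.N_pos]) (rule that)
  obtain k0 where k0: "\<And>i. k0 i = k0 (i - 1) * c i" "mult_per n (\<Prod>i<n. c (int i)) k0"
    by (rule ex_mult_primitive_back[OF c L.n_pos]) (rule that)
  define pa pb pc where "pa = (\<Prod>j<N1. a (int j))" and "pb = (\<Prod>j<N2. b (int j))" and "pc = (\<Prod>i<n. c (int i))"
  note k0 = k0(1) k0(2)[folded pc_def]
  have pos: "pa > 0" "pb > 0" "pc > 0"
    using mult_per_pos[OF l(2)] mult_per_pos[OF r(2)] mult_per_pos[OF k0(2)] by (auto simp: pa_def pb_def)
  define d where "d = t / (l (f 0) * k0 0 * r (h 0))"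
  have d: "d > 0" using t mult_perD(1)[OF l(2)] mult_perD(1)[OF r(2)] mult_perD(1)[OF k0(2)] by (simp add: d_def)
  \<comment> \<open>The outer faces prescribe \<open>1 / P 1 = pa\<close> and
    \<open>P 2 = pb\<close>; the condition that all face weights multiply to 1 then gives
    \<open>P 1 / P 2 = pc\<close>.\<close>
  define P where "P s = (if s = 1 then 1 / pa else pb)" for s :: nat
  define k where "k s i = d * k0 i" for s :: nat and i
  have one': "pc = 1 / pa / pb" using one pos by (simp add: pa_def[symmetric] pb_def[symmetric] pc_def[symmetric] field_simps)
  have "mult_per n (P 1 / P 2) (k 1)"
    using k0(2) d by (auto simp: mult_per_def k_def P_def one')
  then have "state G P l k r"
  proof -
    assume "mult_per n (P 1 / P 2) (k 1)"
    moreover have "{1..<2} = {1::nat}" "(1::nat) + 1 = 2" by auto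
    ultimately show ?thesis
      using l(2) r(2) pos unfolding state_def loops2 by (simp add: P_def pa_def[symmetric] pb_def[symmetric])
  qed
  moreover have "face_trail2 G (flat l k r) = w"
  proof -
    have "l (j + 1) / l j = a j" for j using l(1) mult_perD(2)[OF l(2)] by simp
    moreover have "r (j + 1) / r j = b j" for j using r(1) mult_perD(2)[OF r(2)] by simp
    moreover have "k 1 i / k 1 (i - 1) = c i" for i using k0(1)[of i] mult_perD(2)[OF k0(2), of "i - 1"] d by (simp add: k_def)
    moreover have "l (f 0) * k 1 0 * r (h 0) = t"
      using mult_perD(2)[OF l(2)] mult_perD(2)[OF r(2)] mult_perD(2)[OF k0(2)] by (simp add: k_def d_def)
    ultimately show ?thesis by (simp add: face_trail2_flat wabc)
  qed
  ultimately show ?thesis by (rule that)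
qed

lemma face_trail_weights2_flat:
  assumes st: "state G P l k r"
  shows "face_trail_weights2 G (face_trail2 G (flat l k r))"
proof -
  note l = mult_per_prod_ratio[OF state2(1)[OF st]] and r = mult_per_prod_ratio[OF state2(3)[OF st]]
    and k = mult_per_prod_ratio[OF mult_per_shift[OF state2(2)[OF st], of "-1"], simplified]
  have P: "P s \<noteq> 0" for s using state2(4)[OF st, of s] by simp
  show ?thesis
    using l r k P mult_perD(1)[OF state2(1)[OF st]] mult_perD(1)[OF state2(2)[OF st]] mult_perD(1)[OF state2(3)[OF st]]
    by (simp add: face_trail2_flat)
qed

end

section \<open>Path sums\<close>

text \<open>The end of a path on the right string, passing \<open>d\<close> further white vertices
  before it leaves. \<open>climb1\<close> puts a part on the left string in front of it; there
  \<open>m\<close> is the crossing edge and \<open>q\<close> the exit.\<close>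

fun climb2 :: "int \<Rightarrow> nat \<Rightarrow> edge list" where
  "climb2 j 0 = [Eout j]"
| "climb2 j (Suc d) = Nxt 2 j # Up 2 (j + 1) # climb2 (j + 1) d"

fun climb1 :: "cyl_graph \<Rightarrow> int \<Rightarrow> int \<Rightarrow> int \<Rightarrow> nat \<Rightarrow> edge list" where
  "climb1 G m q j 0 = Crs 1 m # Up 2 (rgt G 1 m) # climb2 (rgt G 1 m) (nat (q - rgt G 1 m))"
| "climb1 G m q j (Suc d) = Nxt 1 j # Up 1 (j + 1) # climb1 G m q (j + 1) d"

abbreviation fwd :: "cyl_graph \<Rightarrow> vertex \<Rightarrow> edge list \<Rightarrow> vertex \<Rightarrow> bool" where
  "fwd G u P v \<equiv> walk G u (map (\<lambda>e. (e, True)) P) v"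

lemma int_climb: "nat (q - j) = Suc (nat (q - (j + 1)))" if "j + 1 \<le> q" for q j :: int
  using that by simp

context cyl2
begin

lemma fwd_Bdr: "fwd G (Bdr j) P (Bdr q) \<longleftrightarrow> P = [] \<and> j = q"
  by (cases P rule: list.exhaust; cases "hd P") auto

lemma fwd_Wht2: "fwd G (Wht 2 j) P (Bdr q) \<longleftrightarrow> j \<le> q \<and> P = climb2 j (nat (q - j))"
proof (induction P arbitrary: j rule: length_induct)
  case (1 P)
  show ?case
  proof (cases P)
    case Nil
    then show ?thesis by (cases "nat (q - j)") auto
  next
    case (Cons e P')
    show ?thesis
    proof (cases "\<exists>P''. P = Nxt 2 j # Up 2 (j + 1) # P''")
      case True
      then obtain P'' where P: "P = Nxt 2 j # Up 2 (j + 1) # P''" by blast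
      have IH: "fwd G (Wht 2 (j + 1)) P'' (Bdr q) \<longleftrightarrow> j + 1 \<le> q \<and> P'' = climb2 (j + 1) (nat (q - (j + 1)))"
        using 1 P by simp
      have "fwd G (Wht 2 j) P (Bdr q) \<longleftrightarrow> fwd G (Wht 2 (j + 1)) P'' (Bdr q)"
        using loops2 by (auto simp: P)
      also have "\<dots> \<longleftrightarrow> j \<le> q \<and> P = climb2 j (nat (q - j))"
        unfolding IH P using int_climb[of j q] by (cases "j = q") auto
      finally show ?thesis .
    next
      case False
      have "fwd G (Wht 2 j) P (Bdr q) \<longleftrightarrow> P = [Eout j] \<and> j = q"
      proof
        assume w: "fwd G (Wht 2 j) P (Bdr q)"
        show "P = [Eout j] \<and> j = q"
        proof (cases e)
          case (Nxt s i)
          then have e: "e = Nxt 2 j" and w': "fwd G (Blk 2 (j + 1)) P' (Bdr q)" using w Cons by auto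
          obtain e' P'' where P': "P' = e' # P''" using w' by (cases P') auto
          have "e' = Up 2 (j + 1)" using w' P' by (cases e') auto
          then show ?thesis using False Cons e P' by simp
        next
          case (Eout i)
          then show ?thesis using w Cons fwd_Bdr by auto
        qed (use w Cons loops2 in auto)
      qed (use loops2 in auto)
      also have "\<dots> \<longleftrightarrow> j \<le> q \<and> P = climb2 j (nat (q - j))"
        using False by (cases "j < q") (auto simp: int_climb)
      finally show ?thesis .
    qed
  qed
qed

lemma fwd_Blk2: "fwd G (Blk 2 j) P (Bdr q) \<longleftrightarrow> j \<le> q \<and> P = Up 2 j # climb2 j (nat (q - j))"
proof (cases P)
  case (Cons e P')
  show ?thesis unfolding Cons by (cases e) (use loops2 fwd_Wht2[of j P' q] in auto)
qed simp

lemma fwd_Wht1: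
  "fwd G (Wht 1 j) P (Bdr q) \<longleftrightarrow> (\<exists>m. j \<le> f m \<and> h m \<le> q \<and> P = climb1 G m q j (nat (f m - j)))"
proof (induction P arbitrary: j rule: length_induct)
  case (1 P)
  show ?case
  proof (cases "\<exists>P''. P = Nxt 1 j # Up 1 (j + 1) # P''")
    case True
    then obtain P'' where P: "P = Nxt 1 j # Up 1 (j + 1) # P''" by blast
    have IH: "fwd G (Wht 1 (j + 1)) P'' (Bdr q) \<longleftrightarrow>
        (\<exists>m. j + 1 \<le> f m \<and> h m \<le> q \<and> P'' = climb1 G m q (j + 1) (nat (f m - (j + 1))))"
      using 1 P by simp
    have "fwd G (Wht 1 j) P (Bdr q) \<longleftrightarrow> fwd G (Wht 1 (j + 1)) P'' (Bdr q)"
      using loops2 by (auto simp: P)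
    also have "\<dots> \<longleftrightarrow> (\<exists>m. j \<le> f m \<and> h m \<le> q \<and> P = climb1 G m q j (nat (f m - j)))"
      unfolding IH P
    proof (rule ex_cong1)
      fix m
      show "(j + 1 \<le> f m \<and> h m \<le> q \<and> P'' = climb1 G m q (j + 1) (nat (f m - (j + 1)))) \<longleftrightarrow>
        (j \<le> f m \<and> h m \<le> q \<and> Nxt 1 j # Up 1 (j + 1) # P'' = climb1 G m q j (nat (f m - j)))"
        by (cases "j = f m") (auto simp: int_climb)
    qed
    finally show ?thesis .
  next
    case False
    have "fwd G (Wht 1 j) P (Bdr q) \<longleftrightarrow> (\<exists>m. f m = j \<and> h m \<le> q \<and> P = climb1 G m q j 0)"
    proof (cases P)
      case (Cons e P')
      show ?thesis
      proof (cases e)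
        case (Nxt s i)
        have "\<not> fwd G (Wht 1 j) P (Bdr q)"
        proof
          assume w: "fwd G (Wht 1 j) P (Bdr q)"
          then have e: "e = Nxt 1 j" and w': "fwd G (Blk 1 (j + 1)) P' (Bdr q)" using Nxt Cons by auto
          obtain e' P'' where P': "P' = e' # P''" using w' by (cases P') auto
          have "e' = Up 1 (j + 1)" using w' P' by (cases e') auto
          then show False using False Cons e P' by simp
        qed
        then show ?thesis using Nxt Cons by auto
      next
        case (Crs s m)
        then show ?thesis using Cons loops2 fwd_Blk2[of "h m" P' q] by auto
      qed (use Cons loops2 in auto)
    qed simp
    also have "\<dots> \<longleftrightarrow> (\<exists>m. j \<le> f m \<and> h m \<le> q \<and> P = climb1 G m q j (nat (f m - j)))"
    proof (rule ex_cong1)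
      fix m
      show "(f m = j \<and> h m \<le> q \<and> P = climb1 G m q j 0) \<longleftrightarrow>
        (j \<le> f m \<and> h m \<le> q \<and> P = climb1 G m q j (nat (f m - j)))"
        using False by (cases "j < f m") (auto simp: int_climb)
    qed
    finally show ?thesis .
  qed
qed

definition crossing_path :: "int \<Rightarrow> int \<Rightarrow> int \<Rightarrow> edge list" where
  "crossing_path p q m = Ein p # Up 1 p # climb1 G m q p (nat (f m - p))"

text \<open>A path is determined by its only crossing edge \<open>m\<close>, which must start at or
  above the source and arrive at or below the sink; by the adjunctions this is an interval of
  indices.\<close>

lemma fwd_Bdl:
  "fwd G (Bdl p) P (Bdr q) \<longleftrightarrow> (\<exists>m. first_ge f p \<le> m \<and> m < first_ge h (q + 1) \<and> P = crossing_path p q m)"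
proof -
  have "fwd G (Bdl p) P (Bdr q) \<longleftrightarrow> (\<exists>P'. P = Ein p # Up 1 p # P' \<and> fwd G (Wht 1 p) P' (Bdr q))"
  proof
    assume w: "fwd G (Bdl p) P (Bdr q)"
    obtain e P1 where P: "P = e # P1" using w by (cases P) auto
    have e: "e = Ein p" using w P by (cases e) auto
    have w1: "fwd G (Blk 1 p) P1 (Bdr q)" using w P e by simp
    obtain e' P' where P1: "P1 = e' # P'" using w1 by (cases P1) auto
    have "e' = Up 1 p" using w1 P1 by (cases e') auto
    then show "\<exists>P'. P = Ein p # Up 1 p # P' \<and> fwd G (Wht 1 p) P' (Bdr q)"
      using w1 P1 P e by auto
  qed (use loops2 in auto)
  also have "\<dots> \<longleftrightarrow> (\<exists>m. first_ge f p \<le> m \<and> m < first_ge h (q + 1) \<and> P = crossing_path p q m)"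
    unfolding fwd_Wht1 crossing_path_def
    using L.first_ge[of p] R.first_ge[of "q + 1"] by (auto simp: not_le[symmetric]) force+
  finally show ?thesis .
qed

lemma crossing_path_inj: "crossing_path p q m = crossing_path p q m' \<Longrightarrow> m = m'"
proof -
  have 2: "Crs 1 x \<notin> set (climb2 j d)" for x j d by (induction j d rule: climb2.induct) auto
  have "Crs 1 x \<in> set (climb1 G m q j d) \<longleftrightarrow> x = m" for x j d and m
    by (induction d arbitrary: j) (auto simp: 2)
  then have "Crs 1 x \<in> set (crossing_path p q m) \<longleftrightarrow> x = m" for x m by (simp add: crossing_path_def)
  then show "crossing_path p q m = crossing_path p q m' \<Longrightarrow> m = m'" by metis
qed

definition path_sum :: "(int \<Rightarrow> real) \<Rightarrow> (nat \<Rightarrow> int \<Rightarrow> real) \<Rightarrow> (int \<Rightarrow> real) \<Rightarrow> int \<Rightarrow> int \<Rightarrow> real" where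
  "path_sum l k r p q = l p * r q * (\<Sum>m\<in>{first_ge f p..<first_ge h (q + 1)}. k 1 m)"

lemma flat_climb2: "(\<Prod>e\<leftarrow>climb2 j d. flat l k r e) = r (j + int d)"
  by (induction j d rule: climb2.induct) (auto simp: algebra_simps)

lemma flat_climb1: "h m \<le> q \<Longrightarrow> (\<Prod>e\<leftarrow>climb1 G m q j d. flat l k r e) = k 1 m * r q"
  by (induction d arbitrary: j) (auto simp: flat_climb2)

lemma walk_weight_fwd: "walk_weight E (map (\<lambda>e. (e, True)) P) = (\<Prod>e\<leftarrow>P. E e)"
  by (induction P) auto

lemma sum_paths:
  assumes ga: "gauge_equiv G g (flat l k r) E" and bd: "bd_one g"
  shows "(\<Sum>P | fwd G (Bdl p) P (Bdr q). \<Prod>e\<leftarrow>P. E e) = path_sum l k r p q"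
proof -
  let ?M = "{first_ge f p..<first_ge h (q + 1)}"
  have "{P. fwd G (Bdl p) P (Bdr q)} = crossing_path p q ` ?M" by (auto simp: fwd_Bdl)
  then have "(\<Sum>P | fwd G (Bdl p) P (Bdr q). \<Prod>e\<leftarrow>P. E e) = (\<Sum>m\<in>?M. \<Prod>e\<leftarrow>crossing_path p q m. E e)"
    using crossing_path_inj by (subst sum.reindex[symmetric, unfolded comp_def]) (auto intro: inj_onI)
  also have "\<dots> = (\<Sum>m\<in>?M. l p * r q * k 1 m)"
  proof (rule sum.cong[OF refl])
    fix m assume m: "m \<in> ?M"
    then have "fwd G (Bdl p) (crossing_path p q m) (Bdr q)" by (auto simp: fwd_Bdl)
    from walk_weight_gauge[OF ga this]
    have "(\<Prod>e\<leftarrow>crossing_path p q m. E e) = (\<Prod>e\<leftarrow>crossing_path p q m. flat l k r e)"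
      using bd by (simp add: walk_weight_fwd bd_one_def)
    moreover have "h m \<le> q" using m R.first_ge[of "q + 1" m] by auto
    ultimately show "(\<Prod>e\<leftarrow>crossing_path p q m. E e) = l p * r q * k 1 m"
      by (simp add: crossing_path_def flat_climb1)
  qed
  finally show ?thesis by (simp add: path_sum_def sum_distrib_left)
qed

end

section \<open>Winding indices and rational series\<close>

definition turning :: "complex list \<Rightarrow> complex list \<Rightarrow> real" where
  "turning ds ds' = (\<Sum>(d, d')\<leftarrow>zip ds ds'. Arg (d' / d))"

text \<open>Half-open: straight up is allowed and straight down is not. Two such directions differ
  in argument by less than \<pi>, so \<open>Arg\<close> of their quotient is the plain
  difference.\<close>

definition rightward :: "complex \<Rightarrow> bool" where
  "rightward d \<longleftrightarrow> d \<noteq> 0 \<and> - pi / 2 < Arg d \<and> Arg d \<le> pi / 2"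

lemma rightwardI: "Re d > 0 \<or> Re d = 0 \<and> Im d > 0 \<Longrightarrow> rightward d"
proof (elim disjE conjE)
  assume "Re d > 0"
  then show "rightward d" using Arg_Re_pos[of d] by (auto simp: rightward_def)
next
  assume "Re d = 0" "Im d > 0"
  then have "Arg d = pi / 2"
    by (intro Arg_unique'[of "Im d"]) (auto simp: complex_eq_iff rcis_def)
  moreover have "d \<noteq> 0" using \<open>Im d > 0\<close> by auto
  moreover have "- pi / 2 < pi / 2" using pi_gt_zero by simp
  ultimately show "rightward d" by (simp only: rightward_def) simp
qed

lemma turning_rightward:
  assumes "\<forall>x\<in>set (d # xs). rightward x"
  shows "turning (d # xs) (xs @ [e]) = Arg (last (d # xs)) - Arg d + Arg (e / last (d # xs))"
  using assms
proof (induction xs arbitrary: d)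
  case Nil
  then show ?case by (simp add: turning_def)
next
  case (Cons x xs)
  then have "Arg (x / d) = Arg x - Arg d"
    by (subst Arg_divide') (auto simp: rightward_def)
  then show ?case using Cons.IH[of x] Cons.prems by (simp add: turning_def)
qed

text \<open>A path moves to the right or straight up, so its tangent does not turn in total, and the three
  sides that close the curve contribute the rotation number -1.\<close>

lemma wind_closing:
  assumes path: "\<forall>x\<in>set (d # xs). rightward x" and d: "Re d > 0" and last: "Re (last (d # xs)) > 0"
    and "a > 0" "b > 0" "c > 0"
  defines "ds \<equiv> (d # xs) @ [Complex 0 (- a), Complex (- b) 0, Complex 0 c]"
  shows "turning ds (rotate1 ds) = - 2 * pi"
proof -
  let ?A = "Complex 0 (- a)" and ?B = "Complex (- b) 0" and ?C = "Complex 0 c"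
  have args: "Arg ?A = - pi / 2" "Arg ?B = pi" "Arg ?C = pi / 2"
  proof -
    show "Arg ?A = - pi / 2" 
    proof (rule Arg_unique'[of a])
      show "- pi / 2 \<in> {- pi<..pi}" by simp (use pi_gt_zero in linarith)
    qed (use assms(4) in \<open>auto simp: complex_eq_iff rcis_def\<close>)
    show "Arg ?B = pi" by (rule Arg_unique'[of b]) (use assms(5) in \<open>auto simp: complex_eq_iff rcis_def\<close>)
    show "Arg ?C = pi / 2" by (rule Arg_unique'[of c]) (use assms(6) in \<open>auto simp: complex_eq_iff rcis_def\<close>)
  qed
  have nz: "?A \<noteq> 0" "?B \<noteq> 0" "?C \<noteq> 0" "d \<noteq> 0" "last (d # xs) \<noteq> 0"
    using assms(4-6) d last by (auto simp: complex_eq_iff)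
  \<comment> \<open>The first and the last edge of the path have positive real part; the strict
    bounds keep the angles at both ends of the path inside the principal range of
    \<open>Arg\<close>.\<close>
  have d': "\<bar>Arg d\<bar> < pi / 2" "\<bar>Arg (last (d # xs))\<bar> < pi / 2"
    using d last Arg_Re_pos by blast+
  have "turning ds (rotate1 ds) = turning (d # xs) (xs @ [?A]) + Arg (?B / ?A) + Arg (?C / ?B) + Arg (d / ?C)"
  proof -
    have "zip ds (rotate1 ds) = zip ((d # xs) @ [?A, ?B, ?C]) ((xs @ [?A]) @ [?B, ?C, d])"
      by (simp add: ds_def)
    also have "\<dots> = zip (d # xs) (xs @ [?A]) @ zip [?A, ?B, ?C] [?B, ?C, d]"
      by (subst zip_append) auto
    finally show ?thesis by (simp add: turning_def)
  qed
  also have "Arg (?B / ?A) = - pi / 2" using nz args pi_gt_zero by (subst Arg_divide') auto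
  also have "Arg (?C / ?B) = - pi / 2"
  proof -
    have "\<not> pi < pi / 2 - pi" "\<not> pi / 2 - pi \<le> - pi" using pi_gt_zero by linarith+
    then show ?thesis unfolding Arg_divide'[OF nz(3) nz(2)] args by (simp only: if_False)
  qed
  also have "Arg (d / ?C) = Arg d - pi / 2" using nz args d' pi_gt_zero by (subst Arg_divide') auto
  also have "turning (d # xs) (xs @ [?A]) = Arg (last (d # xs)) - Arg d + Arg (?A / last (d # xs))"
    by (rule turning_rightward[OF path])
  also have "Arg (?A / last (d # xs)) = - pi / 2 - Arg (last (d # xs))"
    using nz args d' pi_gt_zero by (subst Arg_divide') auto
  finally show ?thesis by simp
qed

lemma fwd_diffs:
  "fwd G u P v \<Longrightarrow> map2 (\<lambda>x y. y - x) (pos G u # map (pos G \<circ> tgt G) P @ zs) (map (pos G \<circ> tgt G) P @ zs)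
     = map (\<lambda>e. pos G (tgt G e) - pos G (src G e)) P @ map2 (\<lambda>x y. y - x) (pos G v # zs) zs"
  by (induction P arbitrary: u) auto

lemma fwd_cut_int: "fwd G u P v \<Longrightarrow> cut_int G P = \<lfloor>height G v\<rfloor> - \<lfloor>height G u\<rfloor>"
  by (induction P arbitrary: u) (auto simp: cut_int_def)

lemma fwd_last: "fwd G u P v \<Longrightarrow> P \<noteq> [] \<Longrightarrow> tgt G (last P) = v \<and> edges G (last P)"
  by (induction P arbitrary: u) auto

lemma fwd_edges: "fwd G u P v \<Longrightarrow> e \<in> set P \<Longrightarrow> edges G e"
  by (induction P arbitrary: u) auto

lemma edge_rightward:
  assumes dr: "drawing_ok G" and e: "edges G e"
  shows "rightward (pos G (tgt G e) - pos G (src G e))"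
  using e dr by (intro rightwardI, cases e) (auto simp: drawing_ok_def)

text \<open>The tangent contributes -1 and the vertical displacement of the lift contributes
  \<open>cut_int\<close>. Thus the sign in \<open>path_series\<close> is the same for all paths with
  the same power of \<zeta>.\<close>

lemma wind_closed_curve:
  assumes dr: "drawing_ok G" and w: "fwd G (Bdl p) P (Bdr q)"
  shows "wind (closed_curve G P) = cut_int G P - 1"
proof -
  define u v where "u = pos G (Bdl p)" and "v = pos G (Bdr q)"
  have u: "u = Complex 0 (height G (Bdl p))" and v: "v = Complex (real (loops G) + 1) (height G (Bdr q))"
    by (auto simp: u_def v_def)
  obtain e P' where P: "P = e # P'" using w by (cases P) auto
  have e: "e = Ein p" using w P by (cases e) auto
  have last: "last P = Eout q" using fwd_last[OF w] P by (cases "last P") auto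
  have hd: "src G (hd P) = Bdl p" using P e by simp
  have lastv: "last (u # map (pos G \<circ> tgt G) P) = v"
  proof -
    have "P \<noteq> []" using P by simp
    then show ?thesis using fwd_last[OF w] by (simp add: last_map v_def)
  qed
  define zs where "zs = [Complex (Re v) (of_int \<lfloor>Im v\<rfloor>), Complex (Re u) (of_int \<lfloor>Im v\<rfloor>),
      Complex (Re u) (of_int \<lfloor>Im v\<rfloor> + frac (Im u))]"
  have curve: "closed_curve G P = u # map (pos G \<circ> tgt G) P @ zs"
    using lastv unfolding closed_curve_def Let_def hd by (simp add: zs_def u_def comp_def)
  have nonint: "Im u \<notin> \<int>" "Im v \<notin> \<int>" using dr by (auto simp: drawing_ok_def u v)
  \<comment> \<open>No vertex lies on the cut, so the two vertical closing sides have positive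
    length.\<close>
  have fr: "frac (Im u) > 0" "frac (Im v) > 0" using nonint by auto
  define ds where "ds = map (\<lambda>e. pos G (tgt G e) - pos G (src G e)) P'"
  define d where "d = pos G (tgt G e) - pos G (src G e)"
  have diffs: "map2 (\<lambda>x y. y - x) (closed_curve G P) (tl (closed_curve G P))
      = (d # ds) @ [Complex 0 (- frac (Im v)), Complex (- (real (loops G) + 1)) 0, Complex 0 (frac (Im u))]"
  proof -
    have "map2 (\<lambda>x y. y - x) (closed_curve G P) (tl (closed_curve G P))
      = map (\<lambda>e. pos G (tgt G e) - pos G (src G e)) P @ map2 (\<lambda>x y. y - x) (v # zs) zs"
      unfolding curve list.sel u_def v_def by (rule fwd_diffs[OF w])
    moreover have "map2 (\<lambda>x y. y - x) (v # zs) zs =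
      [Complex 0 (- frac (Im v)), Complex (- (real (loops G) + 1)) 0, Complex 0 (frac (Im u))]"
      by (simp add: zs_def complex_eq_iff frac_def u v)
    ultimately show ?thesis by (simp add: P d_def ds_def)
  qed
  have turn: "turning ((d # ds) @ [Complex 0 (- frac (Im v)), Complex (- (real (loops G) + 1)) 0, Complex 0 (frac (Im u))])
      (rotate1 ((d # ds) @ [Complex 0 (- frac (Im v)), Complex (- (real (loops G) + 1)) 0, Complex 0 (frac (Im u))])) = - 2 * pi"
  proof (rule wind_closing)
    show "\<forall>x\<in>set (d # ds). rightward x"
      using edge_rightward[OF dr fwd_edges[OF w]] by (auto simp: d_def ds_def P)
    show "Re d > 0" by (simp add: d_def e)
    have "last (d # ds) = pos G (tgt G (last P)) - pos G (src G (last P))"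
      by (simp add: d_def ds_def P last_map)
    then show "Re (last (d # ds)) > 0" using last by simp
  qed (use fr in auto)
  \<comment> \<open>The closed lift ends \<open>frac (Im u)\<close> above the integer level below
    the exit, so its displacement is a difference of floors.\<close>
  have im: "Im (last (closed_curve G P) - hd (closed_curve G P)) = of_int (\<lfloor>Im v\<rfloor> - \<lfloor>Im u\<rfloor>)"
    by (simp add: curve zs_def frac_def)
  show ?thesis
    unfolding wind_def Let_def diffs turn[unfolded turning_def] im fwd_cut_int[OF w]
    by (simp add: u v)
qed

section \<open>Laurent series of rational functions\<close>

definition rational_series :: "real fls \<Rightarrow> bool" where
  "rational_series F \<longleftrightarrow> (\<exists>p q. q \<noteq> 0 \<and> fps_to_fls (fps_of_poly q) * F = fps_to_fls (fps_of_poly p))"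

lemma fps_to_fls_of_poly_mult:
  "fps_to_fls (fps_of_poly (p * q)) = fps_to_fls (fps_of_poly p) * fps_to_fls (fps_of_poly q)"
  by (simp add: fps_of_poly_mult fls_times_fps_to_fls)

text \<open>Cross multiplication shows that the fraction does not depend on the representation, as
  the definite description requires.\<close>

lemma rational_value_eqI:
  assumes q: "q \<noteq> 0" and F: "fps_to_fls (fps_of_poly q) * F = fps_to_fls (fps_of_poly p)"
  shows "rational_value F = Fraction_Field.Fract p q"
  unfolding rational_value_def
proof (rule the_equality)
  show "\<exists>p' q'. q' \<noteq> 0 \<and> Fraction_Field.Fract p q = Fraction_Field.Fract p' q' \<and>
      fps_to_fls (fps_of_poly q') * F = fps_to_fls (fps_of_poly p')" using assms by blast
  fix R assume "\<exists>p' q'. q' \<noteq> 0 \<and> R = Fraction_Field.Fract p' q' \<and>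
      fps_to_fls (fps_of_poly q') * F = fps_to_fls (fps_of_poly p')"
  then obtain p' q' where q': "q' \<noteq> 0" "R = Fraction_Field.Fract p' q'"
    "fps_to_fls (fps_of_poly q') * F = fps_to_fls (fps_of_poly p')" by blast
  have "fps_to_fls (fps_of_poly (p' * q)) = fps_to_fls (fps_of_poly (p * q'))"
    unfolding fps_to_fls_of_poly_mult F[symmetric] q'(3)[symmetric] by (simp add: mult_ac)
  then have "p' * q = p * q'" by (simp add: fps_of_poly_eq_iff)
  then show "R = Fraction_Field.Fract p q" using q q' by (simp add: eq_fract)
qed

text \<open>Equal fractions give both series the same multiple by \<open>q * q'\<close>, and this
  nonzero factor cancels among Laurent series.\<close>

lemma rational_value_inj:
  assumes "rational_series F" "rational_series F'" "rational_value F = rational_value F'"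
  shows "F = F'"
proof -
  obtain p q where q: "q \<noteq> 0" "fps_to_fls (fps_of_poly q) * F = fps_to_fls (fps_of_poly p)"
    using assms(1) by (auto simp: rational_series_def)
  obtain p' q' where q': "q' \<noteq> 0" "fps_to_fls (fps_of_poly q') * F' = fps_to_fls (fps_of_poly p')"
    using assms(2) by (auto simp: rational_series_def)
  have "p * q' = p' * q"
    using assms(3) q q' by (simp add: rational_value_eqI eq_fract)
  then have "fps_to_fls (fps_of_poly p) * fps_to_fls (fps_of_poly q') =
      fps_to_fls (fps_of_poly p') * fps_to_fls (fps_of_poly q)"
    by (simp flip: fps_to_fls_of_poly_mult)
  then have "fps_to_fls (fps_of_poly q) * fps_to_fls (fps_of_poly q') * F =
      fps_to_fls (fps_of_poly q) * fps_to_fls (fps_of_poly q') * F'"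
    unfolding q(2)[symmetric] q'(2)[symmetric] by (simp add: mult_ac)
  moreover have "fps_of_poly q \<noteq> 0" "fps_of_poly q' \<noteq> 0" using q(1) q'(1) fps_of_poly_0 fps_of_poly_eq_iff by metis+
  ultimately show ?thesis by simp
qed

text \<open>Multiplication by \<open>1 + b X + c X^2\<close> applies the recurrence to the
  coefficients and kills all large ones; the factor \<open>X^N\<close> removes the pole.\<close>

lemma rational_of_recurrence:
  fixes F :: "real fls"
  assumes rec: "\<And>i. i \<ge> M \<Longrightarrow> fls_nth F (i + 2) + b * fls_nth F (i + 1) + c * fls_nth F i = 0"
  shows "rational_series F"
proof -
  define N where "N = nat (- fls_subdegree F)"
  define q where "q = monom 1 N * [:1, b, c:]"
  \<comment> \<open>Coefficient \<open>i\<close> of the product; it vanishes below 0 by the choice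
    of \<open>N\<close>, and from \<open>M + 2 + N\<close> on by the recurrence.\<close>
  define s where "s i = fls_nth F (i - int N) + b * fls_nth F (i - int N - 1) + c * fls_nth F (i - int N - 2)" for i
  define B where "B = nat (M + 2 + int N)"
  define p where "p = (\<Sum>i<B. monom (s (int i)) i)"
  have [simp]: "coeff p i = (if i < B then s (int i) else 0)" for i
    by (simp add: p_def coeff_sum)
  have "fps_to_fls (fps_of_poly [:1, b, c:]) = 1 + fls_const b * fls_X + fls_const c * (fls_X * fls_X)"
    by (simp add: fps_of_poly_pCons fls_times_fps_to_fls algebra_simps)
  then have prod_eq: "fps_to_fls (fps_of_poly q) * F
      = fls_X ^ N * (F + fls_const b * (fls_X * F) + fls_const c * (fls_X * (fls_X * F)))"
    unfolding q_def fps_to_fls_of_poly_mult fps_of_poly_monom' fps_to_fls_power fps_X_to_fls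
    by (simp only: algebra_simps mult_1_left mult_1_right)
  have prod: "fls_nth (fps_to_fls (fps_of_poly q) * F) i = s i" for i
    unfolding prod_eq fls_X_power_times_conv_shift(1) fls_X_times_conv_shift(1)
    by (simp add: s_def diff_diff_eq)
  have "fps_to_fls (fps_of_poly q) * F = fps_to_fls (fps_of_poly p)"
  proof (rule fls_eqI)
    fix i
    show "fls_nth (fps_to_fls (fps_of_poly q) * F) i = fls_nth (fps_to_fls (fps_of_poly p)) i"
    proof (cases "i < 0")
      case True
      then have "i - int N < fls_subdegree F" by (simp add: N_def)
      then show ?thesis using True by (simp add: prod s_def)
    next
      case False
      have "s i = 0" if "i \<ge> M + 2 + int N"
        using rec[of "i - int N - 2"] that by (simp add: s_def algebra_simps)
      then show ?thesis using False by (auto simp: prod B_def)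
    qed
  qed
  moreover have "q \<noteq> 0"
  proof -
    have "monom 1 N \<noteq> (0 :: real poly)" "[:1, b, c:] \<noteq> 0" by auto
    then show ?thesis unfolding q_def mult_eq_0_iff by blast
  qed
  ultimately show ?thesis by (auto simp: rational_series_def)
qed

section \<open>Uniqueness on two strings\<close>

text \<open>The differences \<open>s\<close> of the sums and \<open>t\<close> of the products of the
  two pairs satisfy \<open>s * w1 = t * w0\<close> and \<open>s * w2 = t * w1\<close>. The
  determinant \<open>w1 * w1 - w0 * w2\<close> is the product of the two terms assumed nonzero, so
  the pairs have equal sum and product.\<close>

lemma two_roots:
  fixes a b a' b' :: real
  assumes "w2 = (a + b) * w1 - a * b * w0" "w3 = (a + b) * w2 - a * b * w1"
    and "w2 = (a' + b') * w1 - a' * b' * w0" "w3 = (a' + b') * w2 - a' * b' * w1"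
    and "w1 - a * w0 \<noteq> 0" "w1 - b * w0 \<noteq> 0"
  shows "a' = a \<and> b' = b \<or> a' = b \<and> b' = a"
proof -
  define s t where "s = a + b - (a' + b')" and "t = a * b - a' * b'"
  have 1: "s * w1 = t * w0" and 2: "s * w2 = t * w1"
    using trans[OF assms(1)[symmetric] assms(3)] trans[OF assms(2)[symmetric] assms(4)]
    by (simp_all add: s_def t_def left_diff_distrib)
  have det: "w1 * w1 - w0 * w2 = (w1 - a * w0) * (w1 - b * w0)" by (simp add: assms(1) algebra_simps)
  have "s * (w1 * w1 - w0 * w2) = (s * w1) * w1 - (s * w2) * w0" by (simp add: algebra_simps)
  also have "\<dots> = 0" unfolding 1 2 by simp
  finally have s: "s = 0" using det assms(5,6) by simp
  then have t: "t = 0" using 1 2 assms(5) by auto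
  have "(a' - a) * (a' - b) = a' * a' - a' * (a + b) + a * b" by (simp add: algebra_simps)
  also have "\<dots> = a' * a' - a' * (a' + b') + a' * b'" using s t by (simp add: s_def t_def)
  finally have "(a' - a) * (a' - b) = 0" by (simp add: algebra_simps)
  then show ?thesis using s by (auto simp: s_def)
qed

context cyl2
begin

lemma first_ge_h_period: "first_ge h (q + int N2 + 1) = first_ge h (q + 1) + int n"
  using R.first_ge_period[of "q + 1"] by (simp add: algebra_simps)

text \<open>Raising the sink by one period extends the interval of crossing edges.
  \<open>sum_extend_left\<close> removes the root \<open>P 1\<close> and leaves the window at the
  source, \<open>sum_extend_right\<close> removes \<open>P 2\<close> and leaves the window at the
  sink.\<close>

lemma path_sum_step:
  assumes st: "state G P l k r" and le: "first_ge f p \<le> first_ge h (q + 1)"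
  shows "path_sum l k r p (q + int N2) - P 1 * path_sum l k r p q = l p * r q * P 2 * win n (k 1) (first_ge f p)"
    "path_sum l k r p (q + int N2) - P 2 * path_sum l k r p q = l p * r q * P 2 * win n (k 1) (first_ge h (q + 1))"
proof -
  have r: "r (q + int N2) = P 2 * r q" by (rule mult_perD(3)[OF state2(3)[OF st]])
  have P: "P 2 \<noteq> 0" using state2(4)[OF st, of 2] by simp
  show "path_sum l k r p (q + int N2) - P 1 * path_sum l k r p q = l p * r q * P 2 * win n (k 1) (first_ge f p)"
    unfolding path_sum_def r first_ge_h_period sum_extend_left[OF state2(2)[OF st] le]
    using P by (simp add: field_simps)
  show "path_sum l k r p (q + int N2) - P 2 * path_sum l k r p q = l p * r q * P 2 * win n (k 1) (first_ge h (q + 1))"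
    unfolding path_sum_def r first_ge_h_period sum_extend_right[OF le]
    by (simp add: algebra_simps)
qed

text \<open>After removal of the root \<open>P 1\<close>, the remainder depends on the sink only
  through \<open>r\<close>, which has multiplier \<open>P 2\<close>.\<close>

lemma path_sum_rec:
  assumes st: "state G P l k r" and le: "first_ge f p \<le> first_ge h (q + 1)"
  shows "path_sum l k r p (q + int N2 + int N2) =
    (P 1 + P 2) * path_sum l k r p (q + int N2) - P 1 * P 2 * path_sum l k r p q"
proof -
  have le': "first_ge f p \<le> first_ge h (q + int N2 + 1)" using le by (simp add: first_ge_h_period)
  have r: "r (q + int N2) = P 2 * r q" by (rule mult_perD(3)[OF state2(3)[OF st]])
  have "path_sum l k r p (q + int N2 + int N2) - P 1 * path_sum l k r p (q + int N2)
      = P 2 * (path_sum l k r p (q + int N2) - P 1 * path_sum l k r p q)"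
    unfolding path_sum_step(1)[OF st le] path_sum_step(1)[OF st le'] r by simp
  then show ?thesis by (simp add: algebra_simps)
qed

text \<open>The denominators of \<open>sum_flip\<close> at the two ends are exactly the factors
  given to \<open>l\<close> and \<open>r\<close>.\<close>

lemma path_sum_mv:
  assumes st: "state G P l k r"
  shows "path_sum (mv_l G 1 k l) (mv_k G 1 k) (mv_r G 1 k r) p q = path_sum l k r p q"
proof (cases "first_ge f p \<le> first_ge h (q + 1)")
  case True
  note win = mult_perD(2)[OF mult_per_win[OF state2(2)[OF st] L.n_pos]]
  show ?thesis
    unfolding path_sum_def mv2 sum_flip[OF state2(2)[OF st] L.n_pos True] using win by simp
qed (simp add: path_sum_def)

lemma ex_first_ge_h: "\<exists>q. i \<le> first_ge h (q + 1)"
  using R.first_ge_f(2)[of i] by (intro exI[of _ "h i"]) simp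

lemma ex_first_ge_f: "\<exists>p. first_ge f p \<le> i"
  using L.first_ge_f(1)[of i] by blast

text \<open>Removing one root leaves a product in which \<open>p\<close> enters only through
  \<open>l\<close>, removing the other one in which \<open>q\<close> enters only through
  \<open>r\<close>. Sums of \<open>k\<close> over blocks are then known up to a constant, and single
  entries are differences of such sums.\<close>

lemma path_sum_determines:
  assumes st: "state G P l k r" and st': "state G P' l' k' r'"
    and P: "P' 1 = P 1" "P' 2 = P 2" and eq: "\<And>p q. path_sum l' k' r' p q = path_sum l k r p q"
  shows "face_trail2 G (flat l' k' r') = face_trail2 G (flat l k r)"
proof -
  note l = mult_perD[OF state2(1)[OF st]] and r = mult_perD[OF state2(3)[OF st]]
    and l' = mult_perD[OF state2(1)[OF st']] and r' = mult_perD[OF state2(3)[OF st']]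
  note k = mult_perD[OF state2(2)[OF st]]
  define W W' where "W = win n (k 1)" and "W' = win n (k' 1)"
  have W: "W i > 0" "W' i > 0" "W i \<noteq> 0" "W' i \<noteq> 0" for i
    using mult_perD(1,2)[OF mult_per_win[OF state2(2)[OF st] L.n_pos]]
      mult_perD(1,2)[OF mult_per_win[OF state2(2)[OF st'] L.n_pos]] by (auto simp: W_def W'_def)
  have P2: "P 2 \<noteq> 0" using state2(4)[OF st, of 2] by simp
  have A: "l' p * r' q * W' (first_ge h (q + 1)) = l p * r q * W (first_ge h (q + 1))"
    and B: "l' p * r' q * W' (first_ge f p) = l p * r q * W (first_ge f p)"
    if "first_ge f p \<le> first_ge h (q + 1)" for p q
    using path_sum_step[OF st that] path_sum_step[OF st' that] P2 unfolding eq P W_def W'_def by auto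
  have lr: "l' p1 / l p1 = l' p2 / l p2" for p1 p2
  proof -
    obtain q where q: "max (first_ge f p1) (first_ge f p2) \<le> first_ge h (q + 1)" using ex_first_ge_h by blast
    define X where "X = r q * W (first_ge h (q + 1)) / (r' q * W' (first_ge h (q + 1)))"
    have "l' p / l p = X" if "first_ge f p \<le> first_ge h (q + 1)" for p
      using A[OF that] W l(2) r'(2) by (simp add: X_def field_simps)
    then show ?thesis using q by simp
  qed
  have rr: "r' q1 / r q1 = r' q2 / r q2" for q1 q2
  proof -
    obtain p where p: "first_ge f p \<le> min (first_ge h (q1 + 1)) (first_ge h (q2 + 1))" using ex_first_ge_f by blast
    define X where "X = l p * W (first_ge f p) / (l' p * W' (first_ge f p))"
    have "r' q / r q = X" if "first_ge f p \<le> first_ge h (q + 1)" for q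
      using B[OF that] W r(2) l'(2) by (simp add: X_def field_simps)
    then show ?thesis using p by simp
  qed
  define c d where "c = l' 0 / l 0" and "d = r' 0 / r 0"
  have c: "c \<noteq> 0" "l' p = c * l p" for p using lr[of p 0] l(2)[of p] l(2)[of 0] l'(2)[of 0] by (auto simp: c_def field_simps)
  have d: "d \<noteq> 0" "r' q = d * r q" for q using rr[of q 0] r(2)[of q] r(2)[of 0] r'(2)[of 0] by (auto simp: d_def field_simps)
  define S S' where "S i j = (\<Sum>m\<in>{i..<j}. k 1 m)" and "S' i j = (\<Sum>m\<in>{i..<j}. k' 1 m)" for i j
  have S: "S (first_ge f p) (first_ge h (q + 1)) = c * d * S' (first_ge f p) (first_ge h (q + 1))" for p q
    using eq[of p q] l(2) r(2) unfolding path_sum_def c(2) d(2) S_def S'_def by simp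
  have S: "S (first_ge f p) m = c * d * S' (first_ge f p) m" if pm: "first_ge f p \<le> m" for p m
  proof -
    \<comment> \<open>Successive crossing edges never share both ends, so every \<open>m\<close> is
      the start or the end of a block. In the first case a block from \<open>m\<close> to a far sink
      is subtracted.\<close>
    have "(f (m - 1 + 1), h (m - 1 + 1)) \<noteq> (f (m - 1), h (m - 1))"
      using layer[OF layer1] unfolding layer_ok_def by blast
    then consider "f m \<noteq> f (m - 1)" | "h m \<noteq> h (m - 1)" by auto
    then show ?thesis
    proof cases
      case 1
      then have m: "m = first_ge f (f (m - 1) + 1)" using L.changes_iff[of m "f (m - 1)"] by simp
      obtain q where q: "m \<le> first_ge h (q + 1)" using ex_first_ge_h by blast
      have "S (first_ge f p) m + S m (first_ge h (q + 1)) = S (first_ge f p) (first_ge h (q + 1))"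
        and S'_sum: "S' (first_ge f p) m + S' m (first_ge h (q + 1)) = S' (first_ge f p) (first_ge h (q + 1))"
        unfolding S_def S'_def using pm q by (intro sum_int_concat; simp)+
      moreover have "S m (first_ge h (q + 1)) = c * d * S' m (first_ge h (q + 1))" by (subst (1 2) m) (rule S)
      ultimately have "S (first_ge f p) m =
          c * d * S' (first_ge f p) (first_ge h (q + 1)) - c * d * S' m (first_ge h (q + 1))"
        using S[of p q] by linarith
      also have "\<dots> = c * d * S' (first_ge f p) m" unfolding S'_sum[symmetric] by (simp add: algebra_simps)
      finally show ?thesis .
    next
      case 2
      then have "m = first_ge h (h (m - 1) + 1)" using R.changes_iff[of m "h (m - 1)"] by simp
      then show ?thesis using S[of p "h (m - 1)"] by simp
    qed
  qed
  have k': "k 1 m = c * d * k' 1 m" for m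
  proof -
    obtain p where p: "first_ge f p \<le> m" using ex_first_ge_f by blast
    then show ?thesis
      using S[of p m] S[of p "m + 1"] sum_int_Suc[OF p, of "k 1"] sum_int_Suc[OF p, of "k' 1"]
      by (simp add: S_def S'_def algebra_simps)
  qed
  have "k 1 i / k 1 (i - 1) = k' 1 i / k' 1 (i - 1)" for i unfolding k' using c(1) d(1) by simp
  then show ?thesis unfolding face_trail2_flat c(2) d(2) using c(1) d(1) k'[of 0] by simp
qed

text \<open>Four successive lifts of one sink determine the unordered pair of roots. In the swapped
  order the comparison is made with the moved weights, which have the same path sums and the string
  products in that order.\<close>

lemma path_sums_eq_cases:
  assumes st: "state G P l k r" and st': "state G P' l' k' r'"
    and eq: "\<And>p q. path_sum l' k' r' p q = path_sum l k r p q"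
  shows "face_trail2 G (flat l' k' r') = face_trail2 G (flat l k r) \<or>
    face_trail2 G (flat l' k' r') = Tf G (face_trail2 G (flat l k r))"
proof -
  obtain q where q: "first_ge f 0 \<le> first_ge h (q + 1)" using ex_first_ge_h by blast
  have q': "first_ge f 0 \<le> first_ge h (q + int N2 + 1)" using q by (simp add: first_ge_h_period)
  note rec = path_sum_rec[OF st q] path_sum_rec[OF st q'] path_sum_rec[OF st' q] path_sum_rec[OF st' q']
  have "l 0 * r q * P 2 * win n (k 1) i \<noteq> 0" for i
    using mult_perD(2)[OF state2(1)[OF st]] mult_perD(2)[OF state2(3)[OF st]] state2(4)[OF st, of 2]
      mult_perD(2)[OF mult_per_win[OF state2(2)[OF st] L.n_pos]] by simp
  then have "P' 1 = P 1 \<and> P' 2 = P 2 \<or> P' 1 = P 2 \<and> P' 2 = P 1"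
    by (intro two_roots[OF rec(1,2) rec(3,4)[unfolded eq]]) (simp_all add: path_sum_step[OF st q])
  then show ?thesis
  proof (elim disjE conjE)
    assume "P' 1 = P 1" "P' 2 = P 2"
    with path_sum_determines[OF st st'] eq show ?thesis by simp
  next
    assume *: "P' 1 = P 2" "P' 2 = P 1"
    have "face_trail2 G (flat l' k' r') = face_trail2 G (flat (mv_l G 1 k l) (mv_k G 1 k) (mv_r G 1 k r))"
      by (rule path_sum_determines[OF state_mv[OF layer1 st] st'])
        (simp_all add: swap_P_def * eq path_sum_mv[OF st])
    then show ?thesis by (simp add: Tf_flat[OF st])
  qed
qed

section \<open>Boundary measurements as generating series of path sums\<close>

definition shift_index :: "int \<Rightarrow> int \<Rightarrow> int" where
  "shift_index p q = \<lfloor>height G (Bdr q)\<rfloor> - \<lfloor>height G (Bdl p)\<rfloor>"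

lemma height_Bdr:
  assumes dr: "drawing_ok G"
  shows "height G (Bdr (q + x * int N2)) = height G (Bdr q) + of_int x"
proof -
  have 1: "height G (Bdr (j + int N2)) = height G (Bdr j) + 1" for j
    using dr loops2 unfolding drawing_ok_def by (metis verts.simps(4) vshift.simps(4))
  show ?thesis
  proof (induction x rule: int_induct[of _ 0])
    case (step1 x)
    then show ?case using 1[of "q + x * int N2"] by (simp add: algebra_simps)
  next
    case (step2 x)
    then show ?case using 1[of "q + (x - 1) * int N2"] by (simp add: algebra_simps)
  qed simp
qed

text \<open>Fixing the power \<open>x\<close> of \<zeta> selects one lift of the sink,
  \<open>shift_index p q\<close> being the power that belongs to the lift \<open>q\<close> itself.
  The sign exponent is \<open>x - 2\<close> by \<open>wind_closed_curve\<close>.\<close>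

lemma path_series_nth:
  assumes dr: "drawing_ok G" and st: "state G P l k r" and ga: "gauge_equiv G g (flat l k r) E" and bd: "bd_one g"
  shows "fls_nth (path_series G E p q) x =
    (-1) powi (x - 2) * path_sum l k r p (q + (x - shift_index p q) * int N2)"
proof -
  let ?q = "\<lambda>x. q + (x - shift_index p q) * int N2"
  have paths: "{P. P \<in> bpaths G p q \<and> cut_int G P = x} = {P. fwd G (Bdl p) P (Bdr (?q x))}" for x
  proof -
    have *: "cut_int G P = y + shift_index p q" if "fwd G (Bdl p) P (Bdr (q + y * int N2))" for P y
      unfolding fwd_cut_int[OF that] height_Bdr[OF dr] shift_index_def by simp
    show ?thesis
    proof (intro equalityI subsetI CollectI; elim CollectE conjE)
      fix P assume P: "P \<in> bpaths G p q" "cut_int G P = x"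
      then obtain y where y: "fwd G (Bdl p) P (Bdr (q + y * int N2))" by (auto simp: bpaths_def loops2)
      from *[OF this] P(2) have "y = x - shift_index p q" by simp
      then show "fwd G (Bdl p) P (Bdr (?q x))" using y by simp
    next
      fix P assume P: "fwd G (Bdl p) P (Bdr (?q x))"
      from *[OF P] P show "P \<in> bpaths G p q \<and> cut_int G P = x" by (auto simp: bpaths_def loops2)
    qed
  qed
  define a where "a x = (\<Sum>P | P \<in> bpaths G p q \<and> cut_int G P = x.
       (-1) powi (wind (closed_curve G P) - 1) * (\<Prod>e\<leftarrow>P. E e))" for x
  have a: "a x = (-1) powi (x - 2) * path_sum l k r p (?q x)" for x
  proof -
    have "a x = (\<Sum>P | P \<in> bpaths G p q \<and> cut_int G P = x. (-1) powi (x - 2) * (\<Prod>e\<leftarrow>P. E e))"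
      unfolding a_def
    proof (rule sum.cong[OF refl])
      fix P assume P: "P \<in> {P. P \<in> bpaths G p q \<and> cut_int G P = x}"
      then have "fwd G (Bdl p) P (Bdr (?q x))" using paths by blast
      from wind_closed_curve[OF dr this] P have "wind (closed_curve G P) - 1 = x - 2" by simp
      then show "(-1) powi (wind (closed_curve G P) - 1) * (\<Prod>e\<leftarrow>P. E e) = (-1) powi (x - 2) * (\<Prod>e\<leftarrow>P. E e)"
        by (rule arg_cong)
    qed
    also have "\<dots> = (-1) powi (x - 2) * path_sum l k r p (?q x)"
      unfolding sum_distrib_left[symmetric] paths sum_paths[OF ga bd] ..
    finally show ?thesis .
  qed
  \<comment> \<open>Low lifts of the sink admit no paths, so the coefficients vanish below a bound
    and \<open>Abs_fls\<close> keeps them.\<close>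
  have "path_sum l k r p (?q x) = 0" if "x < shift_index p q - \<bar>first_ge h (q + 1) - first_ge f p\<bar>" for x
  proof -
    have hp: "first_ge h (q + y * int N2 + 1) = first_ge h (q + 1) + y * int n" for y
    proof (induction y rule: int_induct[of _ 0])
      case (step1 y)
      then show ?case using first_ge_h_period[of "q + y * int N2"] by (simp add: algebra_simps)
    next
      case (step2 y)
      then show ?case using first_ge_h_period[of "q + (y - 1) * int N2"] by (simp add: algebra_simps)
    qed simp
    have "(x - shift_index p q) * int n \<le> (x - shift_index p q) * 1"
      using that L.n_pos by (intro mult_left_mono_neg) auto
    then have "first_ge h (?q x + 1) \<le> first_ge f p" unfolding hp using that by simp
    then show ?thesis by (simp add: path_sum_def)
  qed
  then have "\<forall>x < shift_index p q - \<bar>first_ge h (q + 1) - first_ge f p\<bar>. a x = 0" by (simp add: a)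
  then have "fls_nth (Abs_fls a) x = a x" by (rule nth_Abs_fls_lower_bound)
  moreover have "path_series G E p q = Abs_fls a" unfolding path_series_def a_def ..
  ultimately show ?thesis by (simp add: a)
qed

lemma rational_path_series:
  assumes dr: "drawing_ok G" and st: "state G P l k r" and ga: "gauge_equiv G g (flat l k r) E" and bd: "bd_one g"
  shows "rational_series (path_series G E p q)"
proof -
  note nth = path_series_nth[OF assms, of p q]
  define y where "y x = q + (x - shift_index p q) * int N2" for x
  have y: "y (x + 1) = y x + int N2" "y (x + 2) = y x + int N2 + int N2" for x by (auto simp: y_def algebra_simps)
  have sgn: "(-1::real) powi (x + 1 - 2) = - ((-1) powi (x - 2))" "(-1::real) powi (x + 2 - 2) = (-1) powi (x - 2)" for x
    using power_int_add[of "-1::real" "x - 2" 1] power_int_add[of "-1::real" "x - 2" 2] by (auto simp: algebra_simps)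
  obtain M where M: "\<And>x. x \<ge> M \<Longrightarrow> first_ge f p \<le> first_ge h (y x + 1)"
  proof -
    obtain q' where q': "first_ge f p \<le> first_ge h (q' + 1)" using ex_first_ge_h by blast
    have "first_ge f p \<le> first_ge h (y x + 1)" if "x \<ge> shift_index p q + \<bar>q' - q\<bar>" for x
    proof -
      have "(x - shift_index p q) * 1 \<le> (x - shift_index p q) * int N2"
        using that R.N_pos by (intro mult_left_mono) auto
      then have "q' + 1 \<le> y x + 1" using that by (simp add: y_def)
      then show ?thesis using R.first_ge_mono[of "q' + 1" "y x + 1"] q' by linarith
    qed
    then show ?thesis by (rule that)
  qed
  show ?thesis
  \<comment> \<open>The sign alternates with \<open>x\<close>, so the middle coefficient of the
    recurrence becomes \<open>+ (P 1 + P 2)\<close>.\<close>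
  proof (rule rational_of_recurrence[of M _ "P 1 + P 2" "P 1 * P 2"])
    fix x assume "x \<ge> M"
    note rec = path_sum_rec[OF st M[OF this]]
    show "fls_nth (path_series G E p q) (x + 2) + (P 1 + P 2) * fls_nth (path_series G E p q) (x + 1)
        + P 1 * P 2 * fls_nth (path_series G E p q) x = 0"
      unfolding nth y_def[symmetric] y sgn rec by (simp add: algebra_simps)
  qed
qed

lemma boundary_measurement_eq_iff:
  assumes dr: "drawing_ok G" and 1: "state G P l k r" "gauge_equiv G g (flat l k r) E" "bd_one g"
    and 2: "state G P' l' k' r'" "gauge_equiv G g' (flat l' k' r') E'" "bd_one g'"
  shows "boundary_measurement G E' = boundary_measurement G E \<longleftrightarrow>
    (\<forall>p q. path_sum l' k' r' p q = path_sum l k r p q)"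
proof
  assume eq: "\<forall>p q. path_sum l' k' r' p q = path_sum l k r p q"
  have "path_series G E' p q = path_series G E p q" for p q
    by (rule fls_eqI) (simp add: path_series_nth[OF dr 1] path_series_nth[OF dr 2] eq)
  then show "boundary_measurement G E' = boundary_measurement G E"
    by (simp add: boundary_measurement_def fun_eq_iff)
next
  assume eq: "boundary_measurement G E' = boundary_measurement G E"
  show "\<forall>p q. path_sum l' k' r' p q = path_sum l k r p q"
  proof (intro allI)
    fix p q
    have "path_series G E' p q = path_series G E p q"
      using eq by (intro rational_value_inj rational_path_series[OF dr 1] rational_path_series[OF dr 2])
        (simp add: boundary_measurement_def fun_eq_iff)
    \<comment> \<open>At this power the selected lift is \<open>q\<close> itself.\<close>
    then have "fls_nth (path_series G E' p q) (shift_index p q) = fls_nth (path_series G E p q) (shift_index p q)"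
      by simp
    then show "path_sum l' k' r' p q = path_sum l k r p q"
      unfolding path_series_nth[OF dr 1] path_series_nth[OF dr 2] by simp
  qed
qed

lemma realizes_flat:
  assumes st: "state G P l k r"
  obtains g E where "gauge_equiv G g (flat l k r) E" "bd_one g" "realizes2 G E (face_trail2 G (flat l k r))"
proof -
  obtain g E where g: "potential G P g" "gauge_equiv G g (flat l k r) E" "edge_weighting G E"
    using ex_weighting[OF st] .
  have "face_trail2 G E = face_trail2 G (flat l k r)"
    using same_weights_gauge[OF g(2) potential_bd[OF g(1)] trail2] same_weights2 by blast
  then show ?thesis using g that potential_bd by (auto simp: realizes2_def)
qed

lemma flat_of_realizes:
  assumes E: "realizes2 G E w"
  obtains P l k r g where "state G P l k r" "gauge_equiv G g (flat l k r) E" "bd_one g" "face_trail2 G (flat l k r) = w"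
proof -
  have "edge_weighting G E" using E by (simp add: realizes2_def)
  then obtain P l k r g where 1: "state G P l k r" "potential G P g" "gauge_equiv G g (flat l k r) E"
    by (rule ex_flat)
  have "face_trail2 G (flat l k r) = w"
    using same_weights_gauge[OF 1(3) potential_bd[OF 1(2)] trail2] same_weights2 E by (auto simp: realizes2_def)
  then show ?thesis using that[OF 1(1,3) potential_bd[OF 1(2)]] by blast
qed

text \<open>Scaling multiplies every path sum by \<open>c 0 * c 1 * d\<close>, which is 1 because of
  the trail.\<close>

lemma path_sum_face_trail:
  assumes 1: "state G P l k r" and 2: "state G P' l' k' r'"
    and eq: "face_trail2 G (flat l k r) = face_trail2 G (flat l' k' r')"
  shows "path_sum l' k' r' p q = path_sum l k r p q"
proof -
  have "same_weights G (trail2 G) (flat l k r) (flat l' k' r')" using eq same_weights2 by simp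
  then obtain c d where c: "\<And>i. c i > 0" "d > 0" "\<And>j. l' j = c 0 * l j"
    "\<And>s i. s \<in> {1..<loops G} \<Longrightarrow> k' s i = c s * k s i" "\<And>j. r' j = d * r j"
    "(\<Prod>i<loops G. c i) * d = 1"
    by (rule same_weights_flatD[OF trail2 1 2]) blast
  have "c 0 * c 1 * d = 1" using c(6) by (simp add: loops2 numeral_2_eq_2 One_nat_def)
  then have "c 0 * (d * c 1) = 1" by (simp add: mult_ac)
  moreover have "path_sum l' k' r' p q = c 0 * (d * c 1) * path_sum l k r p q"
    unfolding path_sum_def c(3,5) c(4)[OF layer1] by (simp add: sum_distrib_left mult_ac)
  ultimately show ?thesis by simp
qed

lemma two_loops:
  assumes dr: "drawing_ok G" and w: "face_trail_weights2 G w"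
  shows "face_trail_weights2 G (Tf G w)" "\<exists>E. realizes2 G E w" "\<exists>E'. realizes2 G E' (Tf G w)"
    "realizes2 G E w \<Longrightarrow> realizes2 G E' (Tf G w) \<Longrightarrow> boundary_measurement G E' = boundary_measurement G E"
    "Tf G (Tf G w) = w"
    "realizes2 G E w \<Longrightarrow> realizes2 G E' w' \<Longrightarrow> boundary_measurement G E' = boundary_measurement G E \<Longrightarrow>
       w' = w \<or> w' = Tf G w"
proof -
  obtain P l k r where st: "state G P l k r" and wf: "face_trail2 G (flat l k r) = w" using ex_state[OF w] .
  note mv = state_mv[OF layer1 st]
  have Tw: "Tf G w = face_trail2 G (flat (mv_l G 1 k l) (mv_k G 1 k) (mv_r G 1 k r))"
    using Tf_flat[OF st] wf by simp
  show "face_trail_weights2 G (Tf G w)" unfolding Tw by (rule face_trail_weights2_flat[OF mv])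
  show "\<exists>E. realizes2 G E w" using realizes_flat[OF st] wf by metis
  show "\<exists>E'. realizes2 G E' (Tf G w)" using realizes_flat[OF mv] Tw by metis
  show "Tf G (Tf G w) = w" using Tf_Tf_flat[OF st] wf by simp
  show "boundary_measurement G E' = boundary_measurement G E" if E: "realizes2 G E w" "realizes2 G E' (Tf G w)"
  proof -
    obtain P1 l1 k1 r1 g1 where 1: "state G P1 l1 k1 r1" "gauge_equiv G g1 (flat l1 k1 r1) E" "bd_one g1"
      "face_trail2 G (flat l1 k1 r1) = w" using flat_of_realizes[OF E(1)] .
    obtain P2 l2 k2 r2 g2 where 2: "state G P2 l2 k2 r2" "gauge_equiv G g2 (flat l2 k2 r2) E'" "bd_one g2"
      "face_trail2 G (flat l2 k2 r2) = Tf G w" using flat_of_realizes[OF E(2)] .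
    have "path_sum l2 k2 r2 p q = path_sum l1 k1 r1 p q" for p q
      using path_sum_face_trail[OF st 1(1), of p q] path_sum_face_trail[OF mv 2(1), of p q]
        path_sum_mv[OF st, of p q] wf 1(4) 2(4) Tw by simp
    then show ?thesis using boundary_measurement_eq_iff[OF dr 1(1-3) 2(1-3)] by blast
  qed
  show "w' = w \<or> w' = Tf G w" if E: "realizes2 G E w" "realizes2 G E' w'"
    "boundary_measurement G E' = boundary_measurement G E"
  proof -
    obtain P1 l1 k1 r1 g1 where 1: "state G P1 l1 k1 r1" "gauge_equiv G g1 (flat l1 k1 r1) E" "bd_one g1"
      "face_trail2 G (flat l1 k1 r1) = w" using flat_of_realizes[OF E(1)] .
    obtain P2 l2 k2 r2 g2 where 2: "state G P2 l2 k2 r2" "gauge_equiv G g2 (flat l2 k2 r2) E'" "bd_one g2"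
      "face_trail2 G (flat l2 k2 r2) = w'" using flat_of_realizes[OF E(2)] .
    show ?thesis
      using path_sums_eq_cases[OF 1(1) 2(1)] boundary_measurement_eq_iff[OF dr 1(1-3) 2(1-3)] E(3) 1(4) 2(4) by simp
  qed
qed

end

section \<open>The fine model of three strings\<close>

text \<open>
  The fine model has a source for every crossing edge \<open>i\<close> between strings 1 and 2, and a sink for
  every crossing edge \<open>k\<close> between strings 2 and 3.  On string 2, the edge \<open>i\<close> arrives below the
  start of \<open>k\<close> iff \<open>i < J k\<close>, equivalently \<open>M i \<le> k\<close>.  Sinks are indexed by exclusive upper bounds.
\<close>

type_synonym fine_weights = "(int \<Rightarrow> real) \<times> (int \<Rightarrow> real) \<times> (int \<Rightarrow> real) \<times> (int \<Rightarrow> real)"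

locale interleaving =
  fixes n m :: nat and J M :: "int \<Rightarrow> int"
  assumes n_pos: "n > 0" and m_pos: "m > 0"
    and J_period: "\<And>k. J (k + int m) = J k + int n"
    and M_period: "\<And>i. M (i + int n) = M i + int m"
    and less_J: "\<And>i k. i < J k \<longleftrightarrow> M i \<le> k"
begin

definition fine_state :: "real \<Rightarrow> real \<Rightarrow> real \<Rightarrow> fine_weights \<Rightarrow> bool" where
  "fine_state P1 P2 P3 = (\<lambda>(l, a, b, r). P1 > 0 \<and> P2 > 0 \<and> P3 > 0 \<and>
     mult_per n (1 / P1) l \<and> mult_per n (P1 / P2) a \<and> mult_per m (P2 / P3) b \<and> mult_per m P3 r)"

text \<open>Each crossing edge has its own source, so the source factor is the window at
  \<open>i\<close> itself; \<open>J k\<close> is the exclusive upper end of the edges that can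
  continue into \<open>k\<close>.\<close>

definition fine_mv1 :: "fine_weights \<Rightarrow> fine_weights" where
  "fine_mv1 = (\<lambda>(l, a, b, r). (\<lambda>i. l i * win n a i, flip n a, \<lambda>k. b k * win n a (J k), r))"

definition fine_mv2 :: "fine_weights \<Rightarrow> fine_weights" where
  "fine_mv2 = (\<lambda>(l, a, b, r). (l, \<lambda>i. a i * win m b (M i), flip m b, \<lambda>k. r k * win m b k))"

definition fine_sum :: "(int \<Rightarrow> real) \<Rightarrow> (int \<Rightarrow> real) \<Rightarrow> int \<Rightarrow> int \<Rightarrow> real" where
  "fine_sum a b i k = (\<Sum>k'\<in>{M i..<k}. b k' * (\<Sum>i'\<in>{i..<J k'}. a i'))"

definition fine_paths :: "fine_weights \<Rightarrow> int \<Rightarrow> int \<Rightarrow> real" where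
  "fine_paths = (\<lambda>(l, a, b, r) i k. l i * r k * fine_sum a b i k)"

lemma mono_M: "i \<le> i' \<Longrightarrow> M i \<le> M i'"
  using less_J[of i "M i'"] less_J[of i' "M i'"] by simp

text \<open>The pairs with \<open>i \<le> i'\<close> and \<open>M i' \<le> k' < k\<close> are summed
  in the other order; \<open>i' < J (k - 1)\<close> says that some \<open>k'\<close> remains. Each
  order puts one layer inside, as needed for the move that flips this layer.\<close>

lemma fine_sum_swap:
  "fine_sum a b i k = (\<Sum>i'\<in>{i..<J (k - 1)}. a i' * (\<Sum>k'\<in>{M i'..<k}. b k'))"
proof -
  let ?A = "{M i..<k}" and ?B = "{i..<J (k - 1)}"
  have 1: "{i' \<in> ?B. M i' \<le> k'} = {i..<J k'}" if "k' \<in> ?A" for k'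
    using that less_J[of _ k'] less_J[of _ "k - 1"] by force
  have 2: "{k' \<in> ?A. M i' \<le> k'} = {M i'..<k}" if "i' \<in> ?B" for i'
    using that mono_M[of i i'] by auto
  have "fine_sum a b i k = (\<Sum>k'\<in>?A. \<Sum>i'\<in>{i' \<in> ?B. M i' \<le> k'}. b k' * a i')"
    unfolding fine_sum_def by (rule sum.cong[OF refl], subst 1, assumption, simp add: sum_distrib_left)
  also have "\<dots> = (\<Sum>i'\<in>?B. \<Sum>k'\<in>{k' \<in> ?A. M i' \<le> k'}. b k' * a i')"
    by (rule sum.swap_restrict) auto
  also have "\<dots> = (\<Sum>i'\<in>?B. a i' * (\<Sum>k'\<in>{M i'..<k}. b k'))"
    by (rule sum.cong[OF refl], subst 2, assumption, simp add: sum_distrib_left mult.commute)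
  finally show ?thesis .
qed

text \<open>\<open>sum_flip\<close> applies to the inner sum over \<open>{i..<J k'}\<close> for each
  \<open>k'\<close> separately.\<close>

lemma fine_state_mv1:
  assumes "fine_state P1 P2 P3 x"
  shows "fine_state P2 P1 P3 (fine_mv1 x)" "fine_paths (fine_mv1 x) = fine_paths x"
proof -
  obtain l a b r where x: "x = (l, a, b, r)" by (cases x)
  have P: "P1 > 0" "P2 > 0" "P3 > 0" and l: "mult_per n (1 / P1) l" and a: "mult_per n (P1 / P2) a"
    and b: "mult_per m (P2 / P3) b" and r: "mult_per m P3 r"
    using assms by (auto simp: fine_state_def x)
  note w = mult_per_win[OF a n_pos]
  have cast: "mult_per N c f \<Longrightarrow> c = c' \<Longrightarrow> mult_per N c' f" for N c c' f by simp
  have "mult_per m (P1 / P2) (\<lambda>k. win n a (J k))" by (rule mult_per_compose[OF w]) (rule J_period)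
  then show "fine_state P2 P1 P3 (fine_mv1 x)"
    using P mult_per_flip[OF a n_pos] r cast[OF mult_per_mult[OF l w], of "1 / P2"]
      cast[OF mult_per_mult[OF b], of "P1 / P2" _ "P1 / P3"]
    by (simp add: fine_state_def x fine_mv1_def)
  show "fine_paths (fine_mv1 x) = fine_paths x"
  proof (intro ext)
    fix i k
    have "win n a i * fine_sum (flip n a) (\<lambda>k. b k * win n a (J k)) i k = fine_sum a b i k"
      unfolding fine_sum_def sum_distrib_left[where r = "win n a i"]
    proof (rule sum.cong[OF refl])
      fix k' assume "k' \<in> {M i..<k}"
      then have "i \<le> J k'" using less_J[of i k'] by simp
      from sum_flip[OF a n_pos this]
      show "win n a i * (b k' * win n a (J k') * sum (flip n a) {i..<J k'}) = b k' * sum a {i..<J k'}"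
        using mult_perD(2)[OF w] by simp
    qed
    then show "fine_paths (fine_mv1 x) i k = fine_paths x i k"
      by (simp add: fine_paths_def x fine_mv1_def)
  qed
qed

lemma fine_state_mv2:
  assumes "fine_state P1 P2 P3 x"
  shows "fine_state P1 P3 P2 (fine_mv2 x)" "fine_paths (fine_mv2 x) = fine_paths x"
proof -
  obtain l a b r where x: "x = (l, a, b, r)" by (cases x)
  have P: "P1 > 0" "P2 > 0" "P3 > 0" and l: "mult_per n (1 / P1) l" and a: "mult_per n (P1 / P2) a"
    and b: "mult_per m (P2 / P3) b" and r: "mult_per m P3 r"
    using assms by (auto simp: fine_state_def x)
  note w = mult_per_win[OF b m_pos]
  have cast: "mult_per N c f \<Longrightarrow> c = c' \<Longrightarrow> mult_per N c' f" for N c c' f by simp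
  have "mult_per n (P2 / P3) (\<lambda>i. win m b (M i))" by (rule mult_per_compose[OF w]) (rule M_period)
  then show "fine_state P1 P3 P2 (fine_mv2 x)"
    using P mult_per_flip[OF b m_pos] l cast[OF mult_per_mult[OF r w], of "P2"]
      cast[OF mult_per_mult[OF a], of "P2 / P3" _ "P1 / P3"]
    by (simp add: fine_state_def x fine_mv2_def)
  show "fine_paths (fine_mv2 x) = fine_paths x"
  proof (intro ext)
    fix i k
    have "win m b k * fine_sum (\<lambda>i. a i * win m b (M i)) (flip m b) i k = fine_sum a b i k"
      unfolding fine_sum_swap sum_distrib_left[where r = "win m b k"]
    proof (rule sum.cong[OF refl])
      fix i' assume "i' \<in> {i..<J (k - 1)}"
      then have "M i' \<le> k" using less_J[of i' "k - 1"] by simp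
      from sum_flip[OF b m_pos this]
      show "win m b k * (a i' * win m b (M i') * sum (flip m b) {M i'..<k}) = a i' * sum b {M i'..<k}"
        using mult_perD(2)[OF w] by simp
    qed
    then show "fine_paths (fine_mv2 x) i k = fine_paths x i k"
      by (simp add: fine_paths_def x fine_mv2_def)
  qed
qed

text \<open>In the form of \<open>fine_sum_swap\<close> the two sums differ in the term for
  \<open>i\<close> alone. This uses sources at all consecutive \<open>i\<close>, which the original
  graph need not have.\<close>

lemma fine_sum_square:
  "fine_sum a b i k - fine_sum a b (i + 1) k = a i * (\<Sum>k'\<in>{M i..<k}. b k')"
proof (cases "i < J (k - 1)")
  case True
  then have "{i..<J (k - 1)} = insert i {i + 1..<J (k - 1)}" by auto
  then show ?thesis unfolding fine_sum_swap by simp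
next
  case False
  then have "\<not> M i \<le> k - 1" using less_J by simp
  then show ?thesis unfolding fine_sum_swap using False by simp
qed

text \<open>A second difference over one period isolates the factor \<open>l i\<close>, respectively \<open>r k\<close>.\<close>

lemma fine_paths_left:
  assumes st: "fine_state P1 P2 P3 (l, a, b, r)" and k: "M i \<le> k"
  shows "fine_paths (l, a, b, r) i (k + int m + int m) - (P2 + P3) * fine_paths (l, a, b, r) i (k + int m)
      + P2 * P3 * fine_paths (l, a, b, r) i k
    = l i * (P2 * P3 * r k * (\<Sum>k'\<in>{k..<k + int m}. b k' * win n a (J k')))"
proof -
  have P: "P1 > 0" "P2 > 0" "P3 > 0" and l: "mult_per n (1 / P1) l" and a: "mult_per n (P1 / P2) a"
    and b: "mult_per m (P2 / P3) b" and r: "mult_per m P3 r"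
    using st by (auto simp: fine_state_def)
  define A where "A j = (\<Sum>i'\<in>{i..<j}. a i')" for j
  define S where "S k = (\<Sum>k'\<in>{k..<k + int m}. b k' * A (J k'))" for k
  have sums: "fine_sum a b i (k + int m) = fine_sum a b i k + S k" if "M i \<le> k" for k
    using sum_int_concat[OF that, of "k + int m"] by (simp add: fine_sum_def S_def A_def)
  \<comment> \<open>A shift by one period multiplies \<open>b\<close> by \<open>P2 / P3\<close> and
    lengthens the inner interval by one window of \<open>a\<close>.\<close>
  have "S (k + int m) = P2 / P3 * (\<Sum>k'\<in>{k..<k + int m}. b k' * A (J k' + int n))"
    using sum_int_shift[of "\<lambda>k'. b k' * A (J k')" k "int m" "k + int m"]
    by (simp add: S_def J_period mult_perD(3)[OF b] sum_distrib_left mult_ac)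
  also have "(\<Sum>k'\<in>{k..<k + int m}. b k' * A (J k' + int n))
      = S k + (\<Sum>k'\<in>{k..<k + int m}. b k' * win n a (J k'))"
    unfolding S_def sum.distrib[symmetric]
  proof (rule sum.cong[OF refl])
    fix k' assume "k' \<in> {k..<k + int m}"
    then have "i \<le> J k'" using k less_J[of i k'] by simp
    from sum_extend_right[OF this, where n = n and k = a]
    show "b k' * A (J k' + int n) = b k' * A (J k') + b k' * win n a (J k')"
      by (simp add: A_def algebra_simps)
  qed
  finally have S: "P3 * S (k + int m) = P2 * (S k + (\<Sum>k'\<in>{k..<k + int m}. b k' * win n a (J k')))"
    using P by simp
  define X F where "X = (\<Sum>k'\<in>{k..<k + int m}. b k' * win n a (J k'))" and "F = fine_sum a b i k"
  have 2: "fine_sum a b i (k + int m + int m) = F + S k + S (k + int m)"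
    using sums[of k] sums[of "k + int m"] k by (simp add: F_def)
  have "fine_paths (l, a, b, r) i (k + int m + int m) - (P2 + P3) * fine_paths (l, a, b, r) i (k + int m)
      + P2 * P3 * fine_paths (l, a, b, r) i k
    = l i * r k * P3 * (P3 * (F + S k + S (k + int m)) - (P2 + P3) * (F + S k) + P2 * F)"
    unfolding fine_paths_def prod.case mult_perD(3)[OF r] 2 sums[OF k] F_def[symmetric]
    by (simp add: algebra_simps)
  also have "P3 * (F + S k + S (k + int m)) - (P2 + P3) * (F + S k) + P2 * F = P2 * X"
    using S unfolding X_def[symmetric] by (simp add: algebra_simps)
  finally show ?thesis by (simp add: X_def mult_ac)
qed

lemma fine_paths_right:
  assumes st: "fine_state P1 P2 P3 (l, a, b, r)" and k: "M (i + int n + int n) < k"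
  shows "fine_paths (l, a, b, r) i k - (P1 + P2) * fine_paths (l, a, b, r) (i + int n) k
      + P1 * P2 * fine_paths (l, a, b, r) (i + int n + int n) k
    = r k * (l i * (\<Sum>i'\<in>{i..<i + int n}. a i' * win m b (M i')))"
proof -
  have P: "P1 > 0" "P2 > 0" "P3 > 0" and l: "mult_per n (1 / P1) l" and a: "mult_per n (P1 / P2) a"
    and b: "mult_per m (P2 / P3) b" and r: "mult_per m P3 r"
    using st by (auto simp: fine_state_def)
  define B where "B j = (\<Sum>k'\<in>{j..<k}. b k')" for j
  define S where "S i = (\<Sum>i'\<in>{i..<i + int n}. a i' * B (M i'))" for i
  have le: "i + int n + int n \<le> J (k - 1)" using k less_J[of "i + int n + int n" "k - 1"] by simp
  have sums: "fine_sum a b i k = S i + fine_sum a b (i + int n) k" if "i + int n \<le> J (k - 1)" for i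
    using sum_int_concat[of i "i + int n" "J (k - 1)"] that by (simp add: fine_sum_swap S_def B_def)
  have "S (i + int n) = P1 / P2 * (\<Sum>i'\<in>{i..<i + int n}. a i' * B (M i' + int m))"
    using sum_int_shift[of "\<lambda>i'. a i' * B (M i')" i "int n" "i + int n"]
    by (simp add: S_def M_period mult_perD(3)[OF a] sum_distrib_left mult_ac)
  also have "(\<Sum>i'\<in>{i..<i + int n}. a i' * B (M i' + int m))
      = S i - (\<Sum>i'\<in>{i..<i + int n}. a i' * win m b (M i'))"
    unfolding S_def sum_subtractf[symmetric]
  proof (rule sum.cong[OF refl])
    fix i' assume "i' \<in> {i..<i + int n}"
    then have "M (i' + int n) \<le> M (i + int n + int n)" by (intro mono_M) auto
    then have "M i' + int m \<le> k" using k by (simp add: M_period)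
    then have "B (M i') = win m b (M i') + B (M i' + int m)"
      using sum_int_concat[of "M i'" "M i' + int m" k b] by (simp add: B_def win_def)
    then show "a i' * B (M i' + int m) = a i' * B (M i') - a i' * win m b (M i')"
      by (simp add: algebra_simps)
  qed
  finally have S: "P2 * S (i + int n) = P1 * (S i - (\<Sum>i'\<in>{i..<i + int n}. a i' * win m b (M i')))"
    using P by simp
  define X F where "X = (\<Sum>i'\<in>{i..<i + int n}. a i' * win m b (M i'))" and "F = fine_sum a b (i + int n + int n) k"
  have 1: "fine_sum a b i k = S i + (S (i + int n) + F)" "fine_sum a b (i + int n) k = S (i + int n) + F"
    using sums[of i] sums[of "i + int n"] le by (simp_all add: F_def)
  have li: "l (j + int n) = l j / P1" for j
    by (simp add: mult_perD(3)[OF l])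
  \<comment> \<open>Multiplied by \<open>P1\<close> to clear the factors \<open>1 / P1\<close> that
    \<open>l\<close> picks up per period.\<close>
  have "P1 * (fine_paths (l, a, b, r) i k - (P1 + P2) * fine_paths (l, a, b, r) (i + int n) k
      + P1 * P2 * fine_paths (l, a, b, r) (i + int n + int n) k)
    = l i * r k * (P1 * (S i + (S (i + int n) + F)) - (P1 + P2) * (S (i + int n) + F) + P2 * F)"
    unfolding fine_paths_def prod.case li 1 F_def[symmetric] using P by (simp add: field_simps)
  also have "P1 * (S i + (S (i + int n) + F)) - (P1 + P2) * (S (i + int n) + F) + P2 * F = P1 * X"
    using S unfolding X_def[symmetric] by (simp add: algebra_simps)
  finally show ?thesis using P by (simp add: X_def mult_ac)
qed

lemma fine_paths_determine:
  assumes st: "fine_state P1 P2 P3 (l, a, b, r)" and st': "fine_state P1 P2 P3 (l', a', b', r')"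
    and eq: "fine_paths (l', a', b', r') = fine_paths (l, a, b, r)"
  obtains c d e g where "c > 0" "d > 0" "e > 0" "g > 0" "c * d * e * g = 1"
    "\<And>i. l' i = c * l i" "\<And>i. a' i = d * a i" "\<And>k. b' k = e * b k" "\<And>k. r' k = g * r k"
proof -
  have P: "P1 > 0" "P2 > 0" "P3 > 0" and l: "mult_per n (1 / P1) l" and a: "mult_per n (P1 / P2) a"
    and b: "mult_per m (P2 / P3) b" and r: "mult_per m P3 r"
    using st by (auto simp: fine_state_def)
  have l': "mult_per n (1 / P1) l'" and a': "mult_per n (P1 / P2) a'"
    and b': "mult_per m (P2 / P3) b'" and r': "mult_per m P3 r'"
    using st' by (auto simp: fine_state_def)
  note pos = mult_perD(1)[OF l] mult_perD(1)[OF a] mult_perD(1)[OF b] mult_perD(1)[OF r]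
    and pos' = mult_perD(1)[OF l'] mult_perD(1)[OF a'] mult_perD(1)[OF b'] mult_perD(1)[OF r']
  define C C' where "C k = P2 * P3 * r k * (\<Sum>k'\<in>{k..<k + int m}. b k' * win n a (J k'))"
    and "C' k = P2 * P3 * r' k * (\<Sum>k'\<in>{k..<k + int m}. b' k' * win n a' (J k'))" for k
  have C: "C k > 0" "C' k > 0" for k
    using P pos pos' mult_perD(1)[OF mult_per_win[OF a n_pos]] mult_perD(1)[OF mult_per_win[OF a' n_pos]] m_pos
    by (auto simp: C_def C'_def intro!: mult_pos_pos sum_pos)
  have lC: "l' i * C' k = l i * C k" if "M i \<le> k" for i k
    unfolding C_def C'_def
    by (rule trans[OF fine_paths_left[OF st' that, unfolded eq, symmetric] fine_paths_left[OF st that]])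
  have ll: "l' i / l i = l' 0 / l 0" for i
  proof -
    have "l' j / l j = C (max (M i) (M 0)) / C' (max (M i) (M 0))" if "j \<in> {i, 0}" for j
      using lC[of j "max (M i) (M 0)"] that C[of "max (M i) (M 0)"] pos(1)[of j] by (auto simp: field_simps)
    then show ?thesis by simp
  qed
  define D D' where "D i = l i * (\<Sum>i'\<in>{i..<i + int n}. a i' * win m b (M i'))"
    and "D' i = l' i * (\<Sum>i'\<in>{i..<i + int n}. a' i' * win m b' (M i'))" for i
  have D: "D i > 0" "D' i > 0" for i
    using P pos pos' mult_perD(1)[OF mult_per_win[OF b m_pos]] mult_perD(1)[OF mult_per_win[OF b' m_pos]] n_pos
    by (auto simp: D_def D'_def intro!: mult_pos_pos sum_pos)
  have rD: "r' k * D' i = r k * D i" if "M (i + int n + int n) < k" for i k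
    unfolding D_def D'_def
    by (rule trans[OF fine_paths_right[OF st' that, unfolded eq, symmetric] fine_paths_right[OF st that]])
  have rr: "r' k / r k = r' 0 / r 0" for k
  proof -
    \<comment> \<open>Chosen so that \<open>i + 2 * n\<close> is the last index below
      \<open>J (min k 0 - 1)\<close>; one such source serves both sinks \<open>k\<close> and
      \<open>0\<close>.\<close>
    define i where "i = J (min k 0 - 1) - 1 - int n - int n"
    have "M (i + int n + int n) < min k 0"
      using less_J[of "i + int n + int n" "min k 0 - 1"] by (simp add: i_def)
    then have "r' j / r j = D i / D' i" if "j \<in> {k, 0}" for j
      using rD[of i j] that D[of i] pos(4)[of j] by (auto simp: field_simps)
    then show ?thesis by simp
  qed
  define c g where "c = l' 0 / l 0" and "g = r' 0 / r 0"
  have c: "c > 0" and g: "g > 0" using pos pos' by (auto simp: c_def g_def)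
  have lc: "l' i = c * l i" for i using ll[of i] pos(1)[of i] by (simp add: c_def field_simps)
  have rg: "r' k = g * r k" for k using rr[of k] pos(4)[of k] by (simp add: g_def field_simps)
  have F: "fine_sum a b i k = c * g * fine_sum a' b' i k" for i k
    using fun_cong[OF fun_cong[OF eq, of i], of k] pos(1)[of i] pos(4)[of k] by (simp add: fine_paths_def lc rg)
  have B: "a i * (\<Sum>k'\<in>{M i..<k}. b k') = c * g * (a' i * (\<Sum>k'\<in>{M i..<k}. b' k'))" for i k
    unfolding fine_sum_square[symmetric] F by (simp add: algebra_simps)
  \<comment> \<open>A further difference in \<open>k\<close> leaves a single product, for every pair
    of edges that can follow each other on a path.\<close>
  have ab: "a i * b k = c * g * (a' i * b' k)" if "M i \<le> k" for i k
    using B[of i "k + 1"] B[of i k] unfolding sum_int_Suc[OF that] by (simp add: algebra_simps)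
  have aa: "a' i / a i = a' 0 / a 0" for i
  proof -
    let ?k = "max (M i) (M 0)"
    have "a' j / a j = b ?k / (c * g * b' ?k)" if "j \<in> {i, 0}" for j
      using ab[of j ?k] that c g pos(2)[of j] pos'(3)[of ?k] by (auto simp: field_simps)
    then show ?thesis by simp
  qed
  define d e where "d = a' 0 / a 0" and "e = 1 / (c * g * d)"
  have d: "d > 0" using pos pos' by (simp add: d_def)
  have ad: "a' i = d * a i" for i using aa[of i] pos(2)[of i] by (simp add: d_def field_simps)
  have be: "b' k = e * b k" for k
  proof -
    have "M (J k - 1) \<le> k" using less_J[of "J k - 1" k] by simp
    from ab[OF this] show ?thesis using c g d pos(2)[of "J k - 1"] by (simp add: ad e_def field_simps)
  qed
  show ?thesis by (rule that[of c d e g]) (use c g d lc ad be rg in \<open>auto simp: e_def\<close>)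
qed

text \<open>Both words turn \<open>(P1, P2, P3)\<close> into \<open>(P3, P2, P1)\<close>, so
  \<open>fine_paths_determine\<close> applies to the two results.\<close>

lemma fine_braid:
  assumes st: "fine_state P1 P2 P3 x"
    and y: "fine_mv1 (fine_mv2 (fine_mv1 x)) = (l, a, b, r)" and z: "fine_mv2 (fine_mv1 (fine_mv2 x)) = (l', a', b', r')"
  obtains c d e g where "c > 0" "d > 0" "e > 0" "g > 0" "c * d * e * g = 1"
    "\<And>i. l' i = c * l i" "\<And>i. a' i = d * a i" "\<And>k. b' k = e * b k" "\<And>k. r' k = g * r k"
proof -
  note 1 = fine_state_mv1[OF st] note 2 = fine_state_mv2[OF 1(1)] note 3 = fine_state_mv1[OF 2(1)]
  note 4 = fine_state_mv2[OF st] note 5 = fine_state_mv1[OF 4(1)] note 6 = fine_state_mv2[OF 5(1)]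
  show ?thesis
    by (rule fine_paths_determine[OF 3(1)[unfolded y] 6(1)[unfolded z]])
      (use 1(2) 2(2) 3(2) 4(2) 5(2) 6(2) y z in simp, rule that)
qed

end

section \<open>Three strings\<close>

definition sub_potential :: "nat \<Rightarrow> (vertex \<Rightarrow> real) \<Rightarrow> vertex \<Rightarrow> real" where
  "sub_potential s g v = (case v of Blk q j \<Rightarrow> g (Blk (s + q - 1) j) | Wht q j \<Rightarrow> g (Wht (s + q - 1) j) | _ \<Rightarrow> 1)"

lemma sub_graph_simps [simp]:
  "loops (sub_graph G s) = 2" "strlen (sub_graph G s) q = strlen G (s + q - 1)" "ncr (sub_graph G s) q = ncr G s"
  "lft (sub_graph G s) q = lft G s" "rgt (sub_graph G s) q = rgt G s"
  by (simp_all add: sub_graph_def)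

context cyl
begin

lemma sub_string: "s \<in> {1..<loops G} \<Longrightarrow> 1 \<le> q \<Longrightarrow> q \<le> 2 \<Longrightarrow> s + q - 1 \<in> {1..loops G}"
  by auto

lemma cyl2_sub_graph:
  assumes s: "s \<in> {1..<loops G}"
  shows "cyl2 (sub_graph G s)"
proof unfold_locales
  show "strlen (sub_graph G s) q > 0" if "q \<in> {1..loops (sub_graph G s)}" for q
    using that strlen_pos[OF sub_string[OF s, of q]] by simp
  show "layer_ok (sub_graph G s) q" if "q \<in> {1..<loops (sub_graph G s)}" for q
    using that layer[OF s] unfolding layer_ok_def by (cases "q = 1") (simp_all add: Suc_eq_plus1)
qed simp_all

text \<open>The boundary edges of the cut-out network have weight 1, so in the flat gauge they carry
  the potential of the large graph at their inner ends.\<close>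

lemma gauge_sub:
  assumes s: "s \<in> {1..<loops G}" and ga: "gauge_equiv G g (flat l k r) E"
  shows "gauge_equiv (sub_graph G s) (sub_potential s g)
    (flat (\<lambda>j. 1 / g (Blk s j)) (\<lambda>_. k s) (\<lambda>j. g (Wht (s + 1) j))) (sub_weighting s E)"
  unfolding gauge_equiv_def
proof (intro conjI allI impI)
  have g: "g v > 0" "g v \<noteq> 0" for v using ga less_irrefl unfolding gauge_equiv_def by metis+
  show "sub_potential s g v > 0" for v using g(1) by (auto simp: sub_potential_def split: vertex.split)
  have E: "edges G e \<Longrightarrow> E e = flat l k r e * g (tgt G e) / g (src G e)" for e using ga by (auto simp: gauge_equiv_def)
  fix e assume e: "edges (sub_graph G s) e"
  show "sub_weighting s E e = flat (\<lambda>j. 1 / g (Blk s j)) (\<lambda>_. k s) (\<lambda>j. g (Wht (s + 1) j)) e *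
      sub_potential s g (tgt (sub_graph G s) e) / sub_potential s g (src (sub_graph G s) e)"
  proof (cases e)
    case (Up q j)
    then show ?thesis using e E[of "Up (s + q - 1) j"] sub_string[OF s, of q] by (simp add: sub_potential_def)
  next
    case (Nxt q j)
    then show ?thesis using e E[of "Nxt (s + q - 1) j"] sub_string[OF s, of q] by (simp add: sub_potential_def)
  next
    case (Crs q i)
    then have "q = 1" using e by simp
    then show ?thesis using Crs s E[of "Crs s i"] by (simp add: sub_potential_def Suc_eq_plus1)
  qed (use g in \<open>simp_all add: sub_potential_def Suc_eq_plus1\<close>)
qed

lemma state_sub:
  assumes s: "s \<in> {1..<loops G}" and st: "state G P l k r" and pot: "potential G P g"
  shows "state (sub_graph G s) (\<lambda>q. P (s + q - 1)) (\<lambda>j. 1 / g (Blk s j)) (\<lambda>_. k s) (\<lambda>j. g (Wht (s + 1) j))"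
proof -
  have "\<And>s. P s > 0" "mult_per (ncr G s) (P s / P (s + 1)) (k s)" using st s by (auto simp: state_def)
  moreover have "{1..<2} = {1::nat}" "s + 2 - 1 = s + 1" by auto
  ultimately show ?thesis
    using pot s by (auto simp: state_def mult_per_def potential_def Suc_eq_plus1)
qed

lemma bd_one_sub_potential: "bd_one (sub_potential s g)"
  by (simp add: bd_one_def sub_potential_def)

lemma face_trail2_sub:
  assumes s: "s \<in> {1..<loops G}" and ga: "gauge_equiv G g (flat l k r) E"
  shows "face_trail2 (sub_graph G s) (sub_weighting s E) =
    face_trail2 (sub_graph G s) (flat (\<lambda>j. 1 / g (Blk s j)) (\<lambda>_. k s) (\<lambda>j. g (Wht (s + 1) j)))"
proof -
  interpret S: cyl2 "sub_graph G s" by (rule cyl2_sub_graph[OF s])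
  show ?thesis
    using S.same_weights_gauge[OF gauge_sub[OF s ga] bd_one_sub_potential S.trail2] S.same_weights2 by simp
qed

text \<open>The new weighting is the moved flat form with potential \<open>g * mv_g\<close>. On the
  cut-out network the window factors of the boundary edges are the change of the potential at their
  inner ends, so \<open>Tf_flat\<close> applies there.\<close>

lemma ex_Tf_move:
  assumes s: "s \<in> {1..<loops G}" and st: "state G P l k r" and pot: "potential G P g"
    and ga: "gauge_equiv G g (flat l k r) E"
  obtains g' E' where "potential G (swap_P s P) g'" "gauge_equiv G g' (flat (mv_l G s k l) (mv_k G s k) (mv_r G s k r)) E'"
    "Tf_move G s E E'"
proof -
  interpret S: cyl2 "sub_graph G s" by (rule cyl2_sub_graph[OF s])
  define g' where "g' v = g v * mv_g G s k v" for v
  define F where "F = flat (mv_l G s k l) (mv_k G s k) (mv_r G s k r)"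
  have pot': "potential G (swap_P s P) g'" unfolding g'_def by (rule potential_mv[OF s st pot])
  have ga': "gauge_equiv G g' F (bend G F g')" using potential_pos[OF pot'] by (rule gauge_bend)
  have st': "state G (swap_P s P) (mv_l G s k l) (mv_k G s k) (mv_r G s k r)" by (rule state_mv[OF s st])
  have low: "mv_l (sub_graph G s) 1 (\<lambda>_. k s) (\<lambda>j. 1 / g (Blk s j)) = (\<lambda>j. 1 / g' (Blk s j))"
    by (auto simp: mv_l_def g'_def mv_g_def)
  have high: "mv_r (sub_graph G s) 1 (\<lambda>_. k s) (\<lambda>j. g (Wht (s + 1) j)) = (\<lambda>j. g' (Wht (s + 1) j))"
    by (auto simp: mv_r_def g'_def mv_g_def)
  have "face_trail2 (sub_graph G s) (sub_weighting s (bend G F g')) =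
      face_trail2 (sub_graph G s) (flat (mv_l (sub_graph G s) 1 (\<lambda>_. k s) (\<lambda>j. 1 / g (Blk s j)))
        (mv_k (sub_graph G s) 1 (\<lambda>_. k s)) (mv_r (sub_graph G s) 1 (\<lambda>_. k s) (\<lambda>j. g (Wht (s + 1) j))))"
    unfolding low high face_trail2_sub[OF s ga'[unfolded F_def], folded F_def] face_trail2_flat
    by (simp add: mv_k_def)
  also have "\<dots> = Tf (sub_graph G s) (face_trail2 (sub_graph G s) (sub_weighting s E))"
    unfolding face_trail2_sub[OF s ga] S.Tf_flat[OF state_sub[OF s st pot]] ..
  finally have "Tf_move G s E (bend G F g')"
    using gauge_flat_weighting[OF st pot ga] gauge_flat_weighting[OF st' pot' ga'[unfolded F_def], folded F_def]
      gauge_mv_outside[OF s st ga ga'[unfolded F_def g'_def]]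
    unfolding Tf_move_def F_def g'_def by blast
  then show ?thesis using that pot' ga' by (auto simp: F_def)
qed

lemma edge_weighting_sub:
  assumes s: "s \<in> {1..<loops G}" and E: "edge_weighting G E"
  shows "edge_weighting (sub_graph G s) (sub_weighting s E)"
  unfolding edge_weighting_def
proof (intro allI impI)
  fix e assume e: "edges (sub_graph G s) e"
  have E: "edges G e \<Longrightarrow> E e > 0 \<and> E (eshift G e) = E e" for e using E by (simp add: edge_weighting_def)
  show "sub_weighting s E e > 0 \<and> sub_weighting s E (eshift (sub_graph G s) e) = sub_weighting s E e"
  proof (cases e)
    case (Up q j)
    then show ?thesis using e E[of "Up (s + q - 1) j"] sub_string[OF s, of q] by simp
  next
    case (Nxt q j)
    then show ?thesis using e E[of "Nxt (s + q - 1) j"] sub_string[OF s, of q] by simp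
  next
    case (Crs q i)
    then show ?thesis using e s E[of "Crs s i"] by simp
  qed simp_all
qed

text \<open>The ratio of the two potentials is 1 at the black vertices of string \<open>s\<close>
  and the white vertices of string \<open>s + 1\<close>, because both weightings give the boundary
  edges of the cut-out network weight 1. The other vertices of the two strings meet no outside
  edges, so the gauge extends by 1.\<close>

lemma gauge_of_sub:
  assumes s: "s \<in> {1..<loops G}" and E: "edge_weighting G E1" "edge_weighting G E2"
    and out: "\<And>e. edges G e \<Longrightarrow> \<not> in_sub s e \<Longrightarrow> E2 e = E1 e"
    and eq: "face_trail2 (sub_graph G s) (sub_weighting s E1) = face_trail2 (sub_graph G s) (sub_weighting s E2)"
  obtains h where "gauge_equiv G h E1 E2" "bd_one h"
proof -
  interpret S: cyl2 "sub_graph G s" by (rule cyl2_sub_graph[OF s])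
  have "same_weights (sub_graph G s) (trail2 (sub_graph G s)) (sub_weighting s E1) (sub_weighting s E2)"
    using eq S.same_weights2 by simp
  then obtain P l k r g1 g2 where st: "state (sub_graph G s) P l k r"
    and g1: "potential (sub_graph G s) P g1" "gauge_equiv (sub_graph G s) g1 (flat l k r) (sub_weighting s E1)"
    and g2: "potential (sub_graph G s) P g2" "gauge_equiv (sub_graph G s) g2 (flat l k r) (sub_weighting s E2)"
    by (rule S.common_flat[OF S.trail2 edge_weighting_sub[OF s E(1)] edge_weighting_sub[OF s E(2)]])
  define hs where "hs v = g2 v / g1 v" for v
  have pos: "g1 v > 0" "g2 v > 0" "g1 v \<noteq> 0" "g2 v \<noteq> 0" for v
    using potential_pos[OF g1(1), of v] potential_pos[OF g2(1), of v] by auto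
  have hs_pos: "hs v > 0" for v using pos by (simp add: hs_def)
  then have hs_nz: "hs v \<noteq> 0" for v using less_irrefl by metis
  have hs: "sub_weighting s E2 e = sub_weighting s E1 e * hs (tgt (sub_graph G s) e) / hs (src (sub_graph G s) e)"
    if "edges (sub_graph G s) e" for e
    using g1(2) g2(2) that pos by (simp add: gauge_equiv_def hs_def)
  have bd: "hs (Bdl j) = 1" "hs (Bdr j) = 1" for j
    using potential_bd[OF g1(1)] potential_bd[OF g2(1)] by (auto simp: hs_def bd_one_def)
  have ends: "hs (Blk 1 j) = 1" "hs (Wht 2 j) = 1" for j
    using hs[of "Ein j"] hs[of "Eout j"] hs_nz[of "Wht 2 j"] by (simp_all add: bd)
  define h where "h v = (case v of Wht q j \<Rightarrow> if q = s then hs (Wht 1 j) else 1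
      | Blk q j \<Rightarrow> if q = s + 1 then hs (Blk 2 j) else 1 | _ \<Rightarrow> 1)" for v
  have "gauge_equiv G h E1 E2" unfolding gauge_equiv_def
  proof (intro conjI allI impI)
    show "h v > 0" for v using hs_pos by (auto simp: h_def split: vertex.split)
    fix e assume e: "edges G e"
    show "E2 e = E1 e * h (tgt G e) / h (src G e)"
    proof (cases "in_sub s e")
      case False
      then show ?thesis using out[OF e] e s by (cases e) (auto simp: h_def)
    next
      case True
      then show ?thesis
      proof (cases e)
        case (Up q j)
        then show ?thesis using True hs[of "Up 1 j"] hs[of "Up 2 j"] by (auto simp: h_def ends Suc_eq_plus1)
      next
        case (Nxt q j)
        then show ?thesis using True hs[of "Nxt 1 j"] hs[of "Nxt 2 j"] by (auto simp: h_def ends Suc_eq_plus1)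
      next
        case (Crs q i)
        then show ?thesis using True hs[of "Crs 1 i"] by (auto simp: h_def Suc_eq_plus1)
      qed auto
    qed
  qed
  moreover have "bd_one h" by (simp add: bd_one_def h_def)
  ultimately show ?thesis by (rule that)
qed

lemma same_weights_Tf_move:
  assumes s: "s \<in> {1..<loops G}" and \<tau>: "trail G \<tau>" and st: "state G P l k r" and pot: "potential G P g"
    and ga: "gauge_equiv G g (flat l k r) E" and mv: "Tf_move G s E E'"
  shows "same_weights G \<tau> E' (flat (mv_l G s k l) (mv_k G s k) (mv_r G s k r))"
proof -
  obtain g1 E1 where 1: "potential G (swap_P s P) g1"
    "gauge_equiv G g1 (flat (mv_l G s k l) (mv_k G s k) (mv_r G s k r)) E1" "Tf_move G s E E1"
    using ex_Tf_move[OF s st pot ga] .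
  obtain h where "gauge_equiv G h E1 E'" "bd_one h"
    by (rule gauge_of_sub[OF s, of E1 E']) (use 1(3) mv in \<open>auto simp: Tf_move_def\<close>)
  then show ?thesis
    using same_weights_trans same_weights_gauge[OF _ _ \<tau>] same_weights_gauge[OF 1(2) potential_bd[OF 1(1)] \<tau>] by blast
qed

text \<open>Makes the move on two strings a well-defined map on face and trail weights of the whole
  graph.\<close>

lemma same_weights_Tf_moves:
  assumes s: "s \<in> {1..<loops G}" and \<tau>: "trail G \<tau>" and mv: "Tf_move G s E1 E1'" "Tf_move G s E2 E2'"
    and eq: "same_weights G \<tau> E1 E2"
  shows "same_weights G \<tau> E1' E2'"
proof -
  obtain P l k r g1 g2 where *: "state G P l k r" "potential G P g1" "gauge_equiv G g1 (flat l k r) E1"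
    "potential G P g2" "gauge_equiv G g2 (flat l k r) E2"
    by (rule common_flat[OF \<tau> _ _ eq]) (use mv that in \<open>auto simp: Tf_move_def\<close>)
  show ?thesis
    using same_weights_Tf_move[OF s \<tau> *(1,2,3) mv(1)] same_weights_Tf_move[OF s \<tau> *(1,4,5) mv(2)]
      same_weights_trans same_weights_sym by blast
qed

end

section \<open>Three strings as a coarsening of the fine model\<close>

locale cyl3 = cyl + assumes loops3: "loops G = 3"
begin

abbreviation "n \<equiv> ncr G 1"
abbreviation "m \<equiv> ncr G 2"

lemma layers: "(1::nat) \<in> {1..<loops G}" "(2::nat) \<in> {1..<loops G}"
  using loops3 by auto

sublocale L1: staircase "lft G 1" n "strlen G 1"
  by (rule staircase_lft[OF layers(1)])

sublocale R1: staircase "rgt G 1" n "strlen G 2"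
  using staircase_rgt[OF layers(1)] by simp

sublocale L2: staircase "lft G 2" m "strlen G 2"
  by (rule staircase_lft[OF layers(2)])

sublocale R2: staircase "rgt G 2" m "strlen G 3"
  using staircase_rgt[OF layers(2)] by simp

text \<open>Black vertex \<open>j\<close> of string 2 lies just below white vertex \<open>j\<close>,
  so edge \<open>i\<close> can continue into \<open>k\<close> iff
  \<open>rgt G 1 i \<le> lft G 2 k\<close>; hence the \<open>+ 1\<close>.\<close>

definition J :: "int \<Rightarrow> int" where
  "J k = first_ge (rgt G 1) (lft G 2 k + 1)"

definition M :: "int \<Rightarrow> int" where
  "M i = first_ge (lft G 2) (rgt G 1 i)"

sublocale interleaving n m J M
proof
  show "n > 0" "m > 0" using L1.n_pos L2.n_pos by auto
  show "J (k + int m) = J k + int n" for k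
    using R1.first_ge_period[of "lft G 2 k + 1"] by (simp add: J_def L2.period algebra_simps)
  show "M (i + int n) = M i + int m" for i
    by (simp add: M_def R1.period L2.first_ge_period)
  show "i < J k \<longleftrightarrow> M i \<le> k" for i k
    using R1.first_ge[of "lft G 2 k + 1" i] L2.first_ge[of "rgt G 1 i" k] by (auto simp: J_def M_def)
qed

definition refines :: "fine_weights \<Rightarrow> (int \<Rightarrow> real) \<Rightarrow> (nat \<Rightarrow> int \<Rightarrow> real) \<Rightarrow> (int \<Rightarrow> real) \<Rightarrow> bool" where
  "refines x l k r \<longleftrightarrow> (case x of (lf, a, b, rf) \<Rightarrow> (\<forall>p. l p = lf (first_ge (lft G 1) p)) \<and>
     k 1 = a \<and> k 2 = b \<and> (\<forall>q. r q = rf (first_ge (rgt G 2) (q + 1))))"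

text \<open>Fine moves use windows at every index and coarse moves at the sampled indices only, so
  sampling commutes with the moves.\<close>

lemma refines_mv:
  assumes "refines x l k r"
  shows "refines (fine_mv1 x) (mv_l G 1 k l) (mv_k G 1 k) (mv_r G 1 k r)"
    and "refines (fine_mv2 x) (mv_l G 2 k l) (mv_k G 2 k) (mv_r G 2 k r)"
proof -
  obtain lf rf where x: "x = (lf, k 1, k 2, rf)"
    and l: "\<And>p. l p = lf (first_ge (lft G 1) p)" and r: "\<And>q. r q = rf (first_ge (rgt G 2) (q + 1))"
    using assms by (cases x) (auto simp: refines_def)
  show "refines (fine_mv1 x) (mv_l G 1 k l) (mv_k G 1 k) (mv_r G 1 k r)"
    using loops3 by (auto simp: x l r refines_def fine_mv1_def mv_l_def mv_r_def mv_k_def J_def intro!: ext)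
  show "refines (fine_mv2 x) (mv_l G 2 k l) (mv_k G 2 k) (mv_r G 2 k r)"
    using loops3 by (auto simp: x l r refines_def fine_mv2_def mv_l_def mv_r_def mv_k_def M_def intro!: ext)
qed

lemma ex_refines:
  assumes st: "state G P l k r"
  obtains x where "fine_state (P 1) (P 2) (P 3) x" "refines x l k r"
proof -
  \<comment> \<open>Every crossing edge gets the boundary factor of the vertex where it is attached.
    A sink index is an exclusive bound, so its last edge is \<open>i - 1\<close>.\<close>
  define x where "x = (\<lambda>i. l (lft G 1 i), k 1, k 2, \<lambda>i. r (rgt G 2 (i - 1)))"
  have P: "P s > 0" for s using st by (simp add: state_def)
  have l: "mult_per (strlen G 1) (1 / P 1) l" and r: "mult_per (strlen G 3) (P 3) r"
    using st loops3 by (auto simp: state_def)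
  have "mult_per n (P 1 / P (1 + 1)) (k 1)" "mult_per m (P 2 / P (2 + 1)) (k 2)"
    using st layers unfolding state_def by blast+
  then have k: "mult_per n (P 1 / P 2) (k 1)" "mult_per m (P 2 / P 3) (k 2)" by simp_all
  have lf: "mult_per n (1 / P 1) (\<lambda>i. l (lft G 1 i))" by (rule mult_per_compose[OF l]) (rule L1.period)
  have "rgt G 2 (i + int m - 1) = rgt G 2 (i - 1) + int (strlen G 3)" for i
    using R2.period[of "i - 1"] by (simp add: algebra_simps)
  then have rf: "mult_per m (P 3) (\<lambda>i. r (rgt G 2 (i - 1)))" by (rule mult_per_compose[OF r])
  have "fine_state (P 1) (P 2) (P 3) x" using P k lf rf by (simp add: fine_state_def x_def)
  moreover have "refines x l k r"
    by (simp add: refines_def x_def L1.f_first_ge R2.f_before_first_ge)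
  ultimately show ?thesis by (rule that)
qed

definition mv :: "nat \<Rightarrow> (int \<Rightarrow> real) \<times> (nat \<Rightarrow> int \<Rightarrow> real) \<times> (int \<Rightarrow> real) \<Rightarrow>
    (int \<Rightarrow> real) \<times> (nat \<Rightarrow> int \<Rightarrow> real) \<times> (int \<Rightarrow> real)" where
  "mv s = (\<lambda>(l, k, r). (mv_l G s k l, mv_k G s k, mv_r G s k r))"

definition ft :: "(edge \<times> bool) list \<Rightarrow> (int \<Rightarrow> real) \<times> (nat \<Rightarrow> int \<Rightarrow> real) \<times> (int \<Rightarrow> real) \<Rightarrow> weights3" where
  "ft \<tau> = (\<lambda>(l, k, r). face_trail3 G \<tau> (flat l k r))"

definition is_state :: "(nat \<Rightarrow> real) \<Rightarrow> (int \<Rightarrow> real) \<times> (nat \<Rightarrow> int \<Rightarrow> real) \<times> (int \<Rightarrow> real) \<Rightarrow> bool" where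
  "is_state P = (\<lambda>(l, k, r). state G P l k r)"

lemma is_state_mv: "s \<in> {1..<loops G} \<Longrightarrow> is_state P x \<Longrightarrow> is_state (swap_P s P) (mv s x)"
  by (cases x) (simp add: is_state_def mv_def state_mv)

lemma same_weights3: "same_weights G \<tau> E E' \<longleftrightarrow> face_trail3 G \<tau> E = face_trail3 G \<tau> E'"
  by (rule same_weights_loops3[OF loops3])

text \<open>Existence comes from \<open>ex_Tf_move\<close>, uniqueness from
  \<open>same_weights_Tf_moves\<close>.\<close>

lemma Tf_strings_rel_iff:
  assumes s: "s \<in> {1..<loops G}" and \<tau>: "trail G \<tau>" and x: "is_state P x"
  shows "Tf_strings_rel G \<tau> s (ft \<tau> x) v' \<longleftrightarrow> v' = ft \<tau> (mv s x)"
proof -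
  obtain l k r where xl: "x = (l, k, r)" by (cases x)
  have st: "state G P l k r" using x by (simp add: is_state_def xl)
  obtain g E where E: "potential G P g" "gauge_equiv G g (flat l k r) E" "edge_weighting G E"
    using ex_weighting[OF st] .
  obtain g' E' where "potential G (swap_P s P) g'"
    "gauge_equiv G g' (flat (mv_l G s k l) (mv_k G s k) (mv_r G s k r)) E'" and mv: "Tf_move G s E E'"
    using ex_Tf_move[OF s st E(1,2)] .
  then have ft': "face_trail3 G \<tau> E' = ft \<tau> (mv s x)"
    using same_weights_gauge[OF _ _ \<tau>] potential_bd by (simp add: same_weights3 ft_def mv_def xl)
  have ft: "face_trail3 G \<tau> E = ft \<tau> x"
    using same_weights_gauge[OF E(2) potential_bd[OF E(1)] \<tau>] by (simp add: same_weights3 ft_def xl)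
  show ?thesis
  proof
    assume "v' = ft \<tau> (mv s x)"
    then show "Tf_strings_rel G \<tau> s (ft \<tau> x) v'" unfolding Tf_strings_rel_def using mv ft ft' by blast
  next
    assume "Tf_strings_rel G \<tau> s (ft \<tau> x) v'"
    then obtain E1 E1' where 1: "Tf_move G s E1 E1'" "face_trail3 G \<tau> E1 = ft \<tau> x" "face_trail3 G \<tau> E1' = v'"
      by (auto simp: Tf_strings_rel_def)
    have "same_weights G \<tau> E1 E" using 1(2) ft same_weights3 by simp
    from same_weights_Tf_moves[OF s \<tau> 1(1) mv this] show "v' = ft \<tau> (mv s x)"
      using 1(3) ft' same_weights3 by simp
  qed
qed

lemma Tf_strings_eq:
  "s \<in> {1..<loops G} \<Longrightarrow> trail G \<tau> \<Longrightarrow> is_state P x \<Longrightarrow> Tf_strings G \<tau> s (ft \<tau> x) = ft \<tau> (mv s x)"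
  unfolding Tf_strings_def by (rule the_equality) (simp_all add: Tf_strings_rel_iff)

lemma braid:
  assumes \<tau>: "trail G \<tau>" and x: "is_state P x"
  shows "ft \<tau> (mv 1 (mv 2 (mv 1 x))) = ft \<tau> (mv 2 (mv 1 (mv 2 x)))"
proof -
  obtain l k r where xl: "x = (l, k, r)" by (cases x)
  obtain y where y: "fine_state (P 1) (P 2) (P 3) y" "refines y l k r"
    by (rule ex_refines[of P l k r]) (use x that in \<open>auto simp: is_state_def xl\<close>)
  obtain l1 k1 r1 where 1: "mv 1 (mv 2 (mv 1 x)) = (l1, k1, r1)" by (cases "mv 1 (mv 2 (mv 1 x))")
  obtain l2 k2 r2 where 2: "mv 2 (mv 1 (mv 2 x)) = (l2, k2, r2)" by (cases "mv 2 (mv 1 (mv 2 x))")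
  obtain lf1 a1 b1 rf1 where y1: "fine_mv1 (fine_mv2 (fine_mv1 y)) = (lf1, a1, b1, rf1)" by (cases "fine_mv1 (fine_mv2 (fine_mv1 y))")
  obtain lf2 a2 b2 rf2 where y2: "fine_mv2 (fine_mv1 (fine_mv2 y)) = (lf2, a2, b2, rf2)" by (cases "fine_mv2 (fine_mv1 (fine_mv2 y))")
  have "refines (fine_mv1 (fine_mv2 (fine_mv1 y))) l1 k1 r1"
    using refines_mv(1)[OF refines_mv(2)[OF refines_mv(1)[OF y(2)]]] 1 by (simp add: mv_def xl)
  then have f1: "\<And>p. l1 p = lf1 (first_ge (lft G 1) p)" "k1 1 = a1" "k1 2 = b1"
    "\<And>q. r1 q = rf1 (first_ge (rgt G 2) (q + 1))" by (auto simp: y1 refines_def)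
  have "refines (fine_mv2 (fine_mv1 (fine_mv2 y))) l2 k2 r2"
    using refines_mv(2)[OF refines_mv(1)[OF refines_mv(2)[OF y(2)]]] 2 by (simp add: mv_def xl)
  then have f2: "\<And>p. l2 p = lf2 (first_ge (lft G 1) p)" "k2 1 = a2" "k2 2 = b2"
    "\<And>q. r2 q = rf2 (first_ge (rgt G 2) (q + 1))" by (auto simp: y2 refines_def)
  obtain c d e g where cdeg: "c > 0" "d > 0" "e > 0" "g > 0" "c * d * e * g = 1"
    and eqs: "\<And>i. lf2 i = c * lf1 i" "\<And>i. a2 i = d * a1 i" "\<And>k. b2 k = e * b1 k" "\<And>k. rf2 k = g * rf1 k"
    by (rule fine_braid[OF y(1) y1 y2]) (rule that)
  \<comment> \<open>The constants of \<open>fine_braid\<close> become a scaling of the flat form;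
    their product 1 makes it trivial on the right boundary.\<close>
  define w where "w s = (if s = 0 then c else if s = 1 then d else e)" for s :: nat
  have prod: "(\<Prod>i<loops G. w i) = c * d * e"
    by (simp add: loops3 numeral_3_eq_3 w_def One_nat_def)
  have ga: "gauge_equiv G (scaling G w g) (flat l1 k1 r1) (flat l2 k2 r2)"
  proof (rule gauge_scaling)
    fix s i assume "s \<in> {1..<loops G}"
    then consider "s = 1" | "s = 2" using loops3 by force
    then show "k2 s i = w s * k1 s i" by cases (simp_all add: f1 f2 eqs w_def)
  qed (use cdeg in \<open>simp_all add: w_def f1 f2 eqs\<close>)
  moreover have "bd_one (scaling G w g)" using cdeg(5) by (simp add: bd_one_def scaling_def prod)
  ultimately show ?thesis
    using same_weights_gauge[OF _ _ \<tau>] by (simp add: same_weights3 ft_def 1 2)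
qed

lemma ex_state3:
  assumes v: "face_trail_weights3 G v" and \<tau>: "trail G \<tau>"
  obtains P x where "is_state P x" "ft \<tau> x = v"
proof -
  obtain a c d b t where vabc: "v = (a, c, d, b, t)" by (cases v)
  have a: "cyc_pos (strlen G 1) a" and c: "cyc_pos n c" and d: "cyc_pos m d" and b: "cyc_pos (strlen G 3) b"
    and t: "t > 0"
    and one: "(\<Prod>j<strlen G 1. a (int j)) * (\<Prod>i<n. c (int i)) * (\<Prod>i<m. d (int i)) * (\<Prod>j<strlen G 3. b (int j)) = 1"
    using v by (auto simp: vabc)
  define pa pb pc pd where "pa = (\<Prod>j<strlen G 1. a (int j))" and "pb = (\<Prod>j<strlen G 3. b (int j))"
    and "pc = (\<Prod>i<n. c (int i))" and "pd = (\<Prod>i<m. d (int i))"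
  obtain l where l: "\<And>j. l (j + 1) = l j * a j" "mult_per (strlen G 1) pa l"
    by (rule ex_mult_primitive[OF a L1.N_pos, folded pa_def]) (rule that)
  obtain r where r: "\<And>j. r (j + 1) = r j * b j" "mult_per (strlen G 3) pb r"
    by (rule ex_mult_primitive[OF b R2.N_pos, folded pb_def]) (rule that)
  obtain k1 where k1: "\<And>i. k1 i = k1 (i - 1) * c i" "mult_per n pc k1"
    by (rule ex_mult_primitive_back[OF c L1.n_pos, folded pc_def]) (rule that)
  obtain k2 where k2: "\<And>i. k2 i = k2 (i - 1) * d i" "mult_per m pd k2"
    by (rule ex_mult_primitive_back[OF d L2.n_pos, folded pd_def]) (rule that)
  have pos: "pa > 0" "pb > 0" "pc > 0" "pd > 0"
    using mult_per_pos[OF l(2)] mult_per_pos[OF r(2)] mult_per_pos[OF k1(2)] mult_per_pos[OF k2(2)] by auto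
  define k where "k s = (if s = 1 then k1 else k2)" for s :: nat
  \<comment> \<open>Read off from the left by \<open>1 / P 1 = pa\<close> and
    \<open>P 1 / P 2 = pc\<close>; the product condition makes \<open>P 2 / P 3 = pd\<close> agree
    with \<open>P 3 = pb\<close>.\<close>
  define P where "P s = (if s = 1 then 1 / pa else if s = 2 then 1 / (pa * pc) else pb)" for s :: nat
  have one: "pd = 1 / (pa * pc) / pb"
    using one pos by (simp add: pa_def[symmetric] pb_def[symmetric] pc_def[symmetric] pd_def[symmetric] field_simps)
  have nz: "l j \<noteq> 0" "r j \<noteq> 0" "k s j \<noteq> 0" for s j
    using mult_perD(2)[OF l(2)] mult_perD(2)[OF r(2)] mult_perD(2)[OF k1(2)] mult_perD(2)[OF k2(2)] by (auto simp: k_def)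
  have st: "state G P (\<lambda>j. u * l j) k r" if "u > 0" for u
    unfolding state_def
  proof (intro conjI allI ballI)
    show "P s > 0" for s using pos by (simp add: P_def)
    show "mult_per (strlen G 1) (1 / P 1) (\<lambda>j. u * l j)" using l(2) that by (auto simp: P_def mult_per_def)
    show "mult_per (strlen G (loops G)) (P (loops G)) r" using r(2) by (simp add: loops3 P_def)
    fix s assume "s \<in> {1..<loops G}"
    then consider "s = 1" | "s = 2" using loops3 by force
    then show "mult_per (ncr G s) (P s / P (s + 1)) (k s)"
      using k1(2) k2(2) pos by cases (simp_all add: P_def k_def one)
  qed
  obtain i j where w: "walk G (Bdl i) \<tau> (Bdr j)" using \<tau> by (auto simp: trail_def)
  \<comment> \<open>Rescaling the left boundary edges by \<open>u\<close> multiplies the weight of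
    any trail by \<open>u\<close>, backtracking or not, since only its ends matter.\<close>
  have scale: "walk_weight (flat (\<lambda>j. u * l j) k r) \<tau> = walk_weight (flat l k r) \<tau> * u" if "u > 0" for u
  proof -
    have "gauge_equiv G (scaling G (\<lambda>s. if s = 0 then u else 1) 1) (flat l k r) (flat (\<lambda>j. u * l j) k r)"
      by (rule gauge_scaling) (use that in auto)
    from walk_weight_gauge[OF this w] show ?thesis
      by (simp add: scaling_def loops3 numeral_3_eq_3 One_nat_def)
  qed
  have st1: "state G P l k r" using st[of 1] by simp
  have "walk_weight (flat l k r) \<tau> > 0"
  proof -
    have flat: "flat l k r e > 0" if "edges G e" for e
      using mult_perD(1)[OF l(2)] mult_perD(1)[OF r(2)] mult_perD(1)[OF k1(2)] mult_perD(1)[OF k2(2)]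
      by (cases e) (auto simp: k_def)
    from walk_weight_pos[of G "flat l k r", OF flat w] show ?thesis .
  qed
  then have u: "t / walk_weight (flat l k r) \<tau> > 0" "walk_weight (flat l k r) \<tau> \<noteq> 0" using t by auto
  define u where "u = t / walk_weight (flat l k r) \<tau>"
  have "is_state P (\<lambda>j. u * l j, k, r)" using st[OF u(1)] by (simp add: is_state_def u_def)
  moreover have "ft \<tau> (\<lambda>j. u * l j, k, r) = v"
  proof -
    have "walk_weight (flat (\<lambda>j. u * l j) k r) \<tau> = t" using scale[OF u(1)] u(2) by (simp add: u_def)
    moreover have "u * l (j + 1) / (u * l j) = a j" "r (j + 1) / r j = b j" for j
      using l(1) r(1) nz(1,2)[of j] u t by (simp_all add: u_def)
    moreover have "k 1 i / k 1 (i - 1) = c i" "k 2 i / k 2 (i - 1) = d i" for i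
      using k1(1)[of i] k2(1)[of i] nz(3)[of 1 "i - 1"] nz(3)[of 2 "i - 1"] by (simp_all add: k_def)
    ultimately show ?thesis by (simp add: ft_def face_trail3_def walk_weight_flat_faces vabc)
  qed
  ultimately show ?thesis by (rule that)
qed

lemma three_loops:
  assumes \<tau>: "trail G \<tau>" and v: "face_trail_weights3 G v"
  shows "s \<in> {1, 2} \<Longrightarrow> \<exists>!v'. Tf_strings_rel G \<tau> s v v'"
    and "(Tf_strings G \<tau> 1 \<circ> Tf_strings G \<tau> 2 \<circ> Tf_strings G \<tau> 1) v =
      (Tf_strings G \<tau> 2 \<circ> Tf_strings G \<tau> 1 \<circ> Tf_strings G \<tau> 2) v"
proof -
  obtain P x where x: "is_state P x" and vx: "ft \<tau> x = v" using ex_state3[OF v \<tau>] .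
  show "\<exists>!v'. Tf_strings_rel G \<tau> s v v'" if "s \<in> {1, 2}"
  proof -
    have "s \<in> {1..<loops G}" using that layers by auto
    from Tf_strings_rel_iff[OF this \<tau> x] show ?thesis unfolding vx by simp
  qed
  have "(Tf_strings G \<tau> 1 \<circ> Tf_strings G \<tau> 2 \<circ> Tf_strings G \<tau> 1) v = ft \<tau> (mv 1 (mv 2 (mv 1 x)))"
    unfolding vx[symmetric] comp_def
    by (simp only: Tf_strings_eq[OF layers(1) \<tau> x] Tf_strings_eq[OF layers(2) \<tau> is_state_mv[OF layers(1) x]]
      Tf_strings_eq[OF layers(1) \<tau> is_state_mv[OF layers(2) is_state_mv[OF layers(1) x]]])
  moreover have "(Tf_strings G \<tau> 2 \<circ> Tf_strings G \<tau> 1 \<circ> Tf_strings G \<tau> 2) v = ft \<tau> (mv 2 (mv 1 (mv 2 x)))"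
    unfolding vx[symmetric] comp_def
    by (simp only: Tf_strings_eq[OF layers(2) \<tau> x] Tf_strings_eq[OF layers(1) \<tau> is_state_mv[OF layers(2) x]]
      Tf_strings_eq[OF layers(2) \<tau> is_state_mv[OF layers(1) is_state_mv[OF layers(2) x]]])
  ultimately show "(Tf_strings G \<tau> 1 \<circ> Tf_strings G \<tau> 2 \<circ> Tf_strings G \<tau> 1) v =
      (Tf_strings G \<tau> 2 \<circ> Tf_strings G \<tau> 1 \<circ> Tf_strings G \<tau> 2) v"
    using braid[OF \<tau> x] by simp
qed

end

lemma cyl_of_plabic: "cylindric_plabic G \<Longrightarrow> loops G \<ge> 1 \<Longrightarrow> cyl G"
  by unfold_locales (auto simp: cylindric_plabic_def)

theorem theorem4p18:
  "(\<forall>G w. cylindric_plabic G \<and> loops G = 2 \<and> face_trail_weights2 G w \<longrightarrow>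
      (face_trail_weights2 G (Tf G w) \<and>
       (\<exists>E. realizes2 G E w) \<and> (\<exists>E'. realizes2 G E' (Tf G w)) \<and>
       (\<forall>E E'. realizes2 G E w \<and> realizes2 G E' (Tf G w) \<longrightarrow>
          boundary_measurement G E' = boundary_measurement G E)) \<and>
      Tf G (Tf G w) = w \<and>
      (\<forall>w' E E'. realizes2 G E w \<and> realizes2 G E' w' \<and>
          boundary_measurement G E' = boundary_measurement G E \<longrightarrow> w' = w \<or> w' = Tf G w)) \<and>
   (\<forall>H \<tau> v. cylindric_plabic H \<and> loops H = 3 \<and> trail H \<tau> \<and> face_trail_weights3 H v \<longrightarrow>
      (\<forall>s\<in>{1, 2}. \<exists>!v'. Tf_strings_rel H \<tau> s v v') \<and>
      (Tf_strings H \<tau> 1 \<circ> Tf_strings H \<tau> 2 \<circ> Tf_strings H \<tau> 1) v =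
      (Tf_strings H \<tau> 2 \<circ> Tf_strings H \<tau> 1 \<circ> Tf_strings H \<tau> 2) v)"
proof (intro conjI allI impI; elim conjE)
  fix G w assume G: "cylindric_plabic G" "loops G = 2" and w: "face_trail_weights2 G w"
  interpret cyl G by (rule cyl_of_plabic) (use G in auto)
  interpret cyl2 G by unfold_locales (rule G(2))
  have dr: "drawing_ok G" using G(1) by (simp add: cylindric_plabic_def)
  note T = two_loops[OF dr w]
  show "face_trail_weights2 G (Tf G w)" "\<exists>E. realizes2 G E w" "\<exists>E'. realizes2 G E' (Tf G w)" "Tf G (Tf G w) = w"
    by (fact T)+
  show "boundary_measurement G E' = boundary_measurement G E"
    if "realizes2 G E w" "realizes2 G E' (Tf G w)" for E E' using that by (rule T(4))
  show "w' = w \<or> w' = Tf G w"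
    if "realizes2 G E w" "realizes2 G E' w'" "boundary_measurement G E' = boundary_measurement G E" for w' E E'
    using that by (rule T(6))
next
  fix H \<tau> v assume H: "cylindric_plabic H" "loops H = 3" and \<tau>: "trail H \<tau>" and v: "face_trail_weights3 H v"
  interpret cyl H by (rule cyl_of_plabic) (use H in auto)
  interpret cyl3 H by unfold_locales (rule H(2))
  show "\<forall>s\<in>{1, 2}. \<exists>!v'. Tf_strings_rel H \<tau> s v v'" using three_loops(1)[OF \<tau> v] by blast
  show "(Tf_strings H \<tau> 1 \<circ> Tf_strings H \<tau> 2 \<circ> Tf_strings H \<tau> 1) v =
      (Tf_strings H \<tau> 2 \<circ> Tf_strings H \<tau> 1 \<circ> Tf_strings H \<tau> 2) v"
    by (rule three_loops(2)[OF \<tau> v])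
qed

end
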